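(* Let $\beta_1,\beta_2,\dots,\beta_d,\beta_{d+2},\dots,\beta_{2d}$ be fixed positive numbers. Then there exists an $\varepsilon\in(0,1)$, depending on these numbers, such that if $\beta_{1+d}>0$ is chosen so that $\beta_{1+d}\le\varepsilon$, the random walk in i.i.d. Dirichlet environment on $\mathbb{Z}^d$ with parameters $(\beta_1,\dots,\beta_{2d})$ satisfies the polynomial condition $(P)_M\mid e_1$ for $M\ge 15d+5$.
   Context: Environment and walk. Let $U=\{e\in\mathbb{Z}^d:|e|_1=1\}=\{e_1,\dots,e_{2d}\}$ with $e_1,\dots,e_d$ the canonical basis and $e_{d+i}=-e_i$ for $1\le i\le d$. Let $\mathcal{P}=\{(p(e))_{e\in U}: p(e)\ge 0,\ \sum_{e\in U}p(e)=1\}$ and $\Omega=\mathcal{P}^{\mathbb{Z}^d}$. An environment is $\omega=\{\omega(x):x\in\mathbb{Z}^d\}\in\Omega$, with components $\omega(x,e)$. For $\omega\in\Omega$, $P_{x,\omega}$ is the law of the Markov chain $(X_n)_{n\ge0}$ on $\mathbb{Z}^d$ with $X_0=x$ and $P_{x,\omega}(X_{n+1}=y+e\mid X_n=y)=\omega(y,e)$. For a probability measure $\mathbb{P}$ on $\Omega$ with expectation $\mathbb{E}$, $P_x=\int P_{x,\omega}\,d\mathbb{P}(\omega)$ is the annealed law. Dirichlet environment. Given positive weights $(\beta_1,\dots,\beta_{2d})$, the i.i.d. Dirichlet environment with these parameters is the law $\mathbb{P}$ on $\Omega$ under which the vectors $(\omega(x,e_i))_{1\le i\le 2d}$, $x\in\mathbb{Z}^d$,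 are independent, each with the Dirichlet law with density $$\frac{\Gamma\big(\sum_{i=1}^{2d}\beta_i\big)}{\prod_{i=1}^{2d}\Gamma(\beta_i)}\Big(\prod_{i=1}^{2d}x_i^{\beta_i-1}\Big)\,dx_1\cdots dx_{2d-1}$$ on the simplex $\{(x_1,\dots,x_{2d})\in(0,1]^{2d}:\sum_{i=1}^{2d}x_i=1\}$, where $\Gamma$ is the Gamma function. Polynomial condition. For $l\in\mathbb{S}^{d-1}$ let $H_l=\{l'\in\mathbb{R}^d: l'\cdot l\ge 0\}$. For $L,\tilde L>0$ let $B_{l,L,\tilde L}=R\big((-L,L)\times(-\tilde L,\tilde L)^{d-1}\big)\cap\mathbb{Z}^d$, where $R$ is a rotation of $\mathbb{R}^d$ with $R(e_1)=l$. For $A\subset\mathbb{Z}^d$ let $T_A=\min\{n\ge0:X_n\notin A\}$. Choose $\alpha>0$ such that $\eta_\alpha:=\max_{e\in H_l\cap U}\mathbb{E}\big(\omega(0,e)^{-\alpha}\big)<\infty$ and let $$c_0=\tfrac23\,3^{\,120d^4+3000d\left(\frac1\alpha\log\eta_\alpha\right)^2}.$$ For $M\ge1$, condition $(P)_M\mid l$ (condition $(P)_M$ in direction $l$) is satisfied if there exist $L\ge c_0$ and $\tilde L\le 70L^3$ such that $P_0\big(X_{T_{B_{l,L,\tilde L}}}\cdot l<L\big)\le L^{-M}$. *)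

theory Defs
  imports "HOL-Probability.Probability"
begin

section \<open>Environments\<close>

text \<open>The lattice \<open>\<int>\<^sup>d\<close> is \<^typ>\<open>int ^ 'n\<close> with \<open>d = CARD('n)\<close>. Since \<open>'n\<close> carries no order, the
  coordinate called \<open>1\<close> in informal notation is an arbitrary index \<open>k :: 'n\<close>, so that \<open>e\<^sub>1\<close> becomes
  \<^term>\<open>axis k 1\<close>. Families indexed by \<open>1,\<dots>,2d\<close> are indexed by the unit vectors themselves.\<close>

definition unit_steps :: "(int ^ 'n) set" where
  "unit_steps = {e. (\<Sum>i\<in>UNIV. \<bar>e $ i\<bar>) = 1}"

definition real_vec :: "int ^ 'n \<Rightarrow> real ^ 'n" where
  "real_vec x = (\<chi> i. real_of_int (x $ i))"

definition prob_vectors :: "(int ^ 'n \<Rightarrow> real) set" where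
  "prob_vectors = {p \<in> unit_steps \<rightarrow>\<^sub>E UNIV. (\<forall>e\<in>unit_steps. 0 \<le> p e) \<and> (\<Sum>e\<in>unit_steps. p e) = 1}"

definition site_algebra :: "(int ^ 'n \<Rightarrow> real) measure" where
  "site_algebra = restrict_space (PiM unit_steps (\<lambda>_. borel)) prob_vectors"

definition env_algebra :: "(int ^ 'n \<Rightarrow> int ^ 'n \<Rightarrow> real) measure" where
  "env_algebra = PiM UNIV (\<lambda>_. site_algebra)"

section \<open>The walk\<close>

definition step_law :: "(int ^ 'n \<Rightarrow> int ^ 'n \<Rightarrow> real) \<Rightarrow> int ^ 'n \<Rightarrow> (int ^ 'n) measure" where
  "step_law \<omega> y =
     distr (point_measure unit_steps (\<lambda>e. ennreal (\<omega> y e))) (count_space UNIV) (\<lambda>e. y + e)"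

definition walk_kernel ::
  "int ^ 'n \<Rightarrow> (int ^ 'n \<Rightarrow> int ^ 'n \<Rightarrow> real) \<Rightarrow> nat \<Rightarrow> (nat \<Rightarrow> int ^ 'n) \<Rightarrow> (int ^ 'n) measure" where
  "walk_kernel x \<omega> n h =
     (case n of 0 \<Rightarrow> return (count_space UNIV) x | Suc m \<Rightarrow> step_law \<omega> (h m))"

abbreviation path_algebra :: "(nat \<Rightarrow> int ^ 'n) measure" where
  "path_algebra \<equiv> PiM UNIV (\<lambda>_. count_space UNIV)"

text \<open>The Ionescu-Tulcea measure of the kernel; its finite-dimensional distributions are given by
  \<open>quenched_law_cylinder\<close> below.\<close>

definition quenched_law ::
  "int ^ 'n \<Rightarrow> (int ^ 'n \<Rightarrow> int ^ 'n \<Rightarrow> real) \<Rightarrow> (nat \<Rightarrow> int ^ 'n) measure" where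
  "quenched_law x \<omega> =
     projective_family.lim UNIV
       (Ionescu_Tulcea.CI (walk_kernel x \<omega>) (\<lambda>_. count_space UNIV)) (\<lambda>_. count_space UNIV)"

definition annealed_law ::
  "(int ^ 'n \<Rightarrow> int ^ 'n \<Rightarrow> real) measure \<Rightarrow> int ^ 'n \<Rightarrow> (nat \<Rightarrow> int ^ 'n) measure" where
  "annealed_law \<PP> x = \<PP> \<bind> quenched_law x"

section \<open>Dirichlet environments\<close>

text \<open>The density refers to Lebesgue measure in all coordinates but one, the coordinate \<open>j\<close>, which
  is recovered as one minus the sum of the others; the resulting law does not depend on \<open>j\<close>.\<close>

definition dirichlet_density :: "(int ^ 'n \<Rightarrow> real) \<Rightarrow> (int ^ 'n \<Rightarrow> real) \<Rightarrow> real" where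
  "dirichlet_density \<beta> p =
     Gamma (\<Sum>e\<in>unit_steps. \<beta> e) / (\<Prod>e\<in>unit_steps. Gamma (\<beta> e)) *
     (\<Prod>e\<in>unit_steps. p e powr (\<beta> e - 1))"

definition complete_at :: "int ^ 'n \<Rightarrow> (int ^ 'n \<Rightarrow> real) \<Rightarrow> int ^ 'n \<Rightarrow> real" where
  "complete_at j q = q(j := 1 - (\<Sum>e\<in>unit_steps - {j}. q e))"

definition simplex_chart :: "int ^ 'n \<Rightarrow> (int ^ 'n \<Rightarrow> real) set" where
  "simplex_chart j =
     {q \<in> (unit_steps - {j}) \<rightarrow>\<^sub>E UNIV. \<forall>e\<in>unit_steps. complete_at j q e \<in> {0<..1}}"

definition dirichlet_law :: "int ^ 'n \<Rightarrow> (int ^ 'n \<Rightarrow> real) \<Rightarrow> (int ^ 'n \<Rightarrow> real) measure" where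
  "dirichlet_law j \<beta> =
     distr
       (density (restrict_space (PiM (unit_steps - {j}) (\<lambda>_. lborel)) (simplex_chart j))
         (\<lambda>q. ennreal (dirichlet_density \<beta> (complete_at j q))))
       site_algebra (complete_at j)"

definition dirichlet_env ::
  "int ^ 'n \<Rightarrow> (int ^ 'n \<Rightarrow> real) \<Rightarrow> (int ^ 'n \<Rightarrow> int ^ 'n \<Rightarrow> real) measure" where
  "dirichlet_env j \<beta> = PiM UNIV (\<lambda>_. dirichlet_law j \<beta>)"

section \<open>The polynomial condition\<close>

text \<open>The expectation of \<open>\<omega>(0,e)\<^bsup>-\<alpha>\<^esup>\<close> is taken in the extended nonnegative reals, where
  \<open>1 / 0 = \<infinity>\<close>; real division and \<^term>\<open>(powr)\<close> would give \<open>0\<close> at \<open>\<omega>(0,e) = 0\<close>.\<close>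

definition eta :: "(int ^ 'n \<Rightarrow> int ^ 'n \<Rightarrow> real) measure \<Rightarrow> real ^ 'n \<Rightarrow> real \<Rightarrow> ennreal" where
  "eta \<PP> l \<alpha> =
     Max ((\<lambda>e. \<integral>\<^sup>+ \<omega>. 1 / ennreal (\<omega> 0 e powr \<alpha>) \<partial>\<PP>) ` {e \<in> unit_steps. real_vec e \<bullet> l \<ge> 0})"

definition c0 :: "(int ^ 'n \<Rightarrow> int ^ 'n \<Rightarrow> real) measure \<Rightarrow> real ^ 'n \<Rightarrow> real \<Rightarrow> real" where
  "c0 \<PP> l \<alpha> =
     2 / 3 * 3 powr (120 * real CARD('n) ^ 4 +
       3000 * real CARD('n) * (1 / \<alpha> * ln (enn2real (eta \<PP> l \<alpha>)))\<^sup>2)"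

definition tilted_box :: "'n \<Rightarrow> real ^ 'n ^ 'n \<Rightarrow> real \<Rightarrow> real \<Rightarrow> (int ^ 'n) set" where
  "tilted_box k R L L' =
     {x. real_vec x \<in> (*v) R ` {v. v $ k \<in> {-L<..<L} \<and> (\<forall>i. i \<noteq> k \<longrightarrow> v $ i \<in> {-L'<..<L'})}}"

definition exit_time :: "(int ^ 'n) set \<Rightarrow> (nat \<Rightarrow> int ^ 'n) \<Rightarrow> enat" where
  "exit_time A X = (INF n\<in>{n. X n \<notin> A}. enat n)"

text \<open>The rotation \<open>R\<close> taking \<^term>\<open>axis k 1\<close> to \<open>l\<close>, and the exponent \<open>\<alpha>\<close>, which
  enter the condition through the box and through \<^const>\<open>c0\<close>, are explicit arguments.
  They are meant to satisfy \<^term>\<open>rotation_matrix R\<close>, \<^term>\<open>R *v axis k 1 = l\<close>,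
  \<^term>\<open>\<alpha> > 0\<close> and \<^term>\<open>eta \<PP> l \<alpha> < \<infinity>\<close>.\<close>

definition polynomial_condition ::
  "'n \<Rightarrow> real ^ 'n ^ 'n \<Rightarrow> real \<Rightarrow> (int ^ 'n \<Rightarrow> int ^ 'n \<Rightarrow> real) measure \<Rightarrow> real \<Rightarrow> real ^ 'n \<Rightarrow> bool"
where
  "polynomial_condition k R \<alpha> \<PP> M l \<longleftrightarrow>
     (\<exists>L L'. L \<ge> c0 \<PP> l \<alpha> \<and> 0 < L' \<and> L' \<le> 70 * L ^ 3 \<and>
        measure (annealed_law \<PP> 0)
          {X. exit_time (tilted_box k R L L') X < \<infinity> \<and>
              real_vec (X (the_enat (exit_time (tilted_box k R L L') X))) \<bullet> l < L}
        \<le> L powr (- M))"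

section \<open>Measurability and finite-dimensional distributions\<close>

lemma finite_unit_steps [simp]: "finite (unit_steps :: (int ^ 'n) set)"
proof -
  have "unit_steps \<subseteq> {e :: int ^ 'n. \<forall>i. e $ i \<in> {-1..1}}"
  proof (intro subsetI CollectI allI)
    fix e :: "int ^ 'n" and i assume "e \<in> unit_steps"
    then have "\<bar>e $ i\<bar> \<le> 1"
      using member_le_sum[of i UNIV "\<lambda>i. \<bar>e $ i\<bar>"] by (simp add: unit_steps_def)
    then show "e $ i \<in> {-1..1}" by auto
  qed
  moreover have "finite {e :: int ^ 'n. \<forall>i. e $ i \<in> {-1..1}}"
    using finite_PiE[of UNIV "\<lambda>_::'n. {-1..1::int}"]
    by (intro finite_subset[OF _ finite_imageI[of "PiE UNIV (\<lambda>_. {-1..1})" vec_lambda]])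
       (auto intro!: image_eqI[of _ _ "vec_nth _"])
  ultimately show ?thesis by (rule finite_subset)
qed

lemma unit_steps_eq:
  "(unit_steps :: (int ^ 'n) set) = (\<lambda>i. axis i 1) ` UNIV \<union> (\<lambda>i. - axis i 1) ` UNIV"
proof safe
  fix e :: "int ^ 'n" assume e: "e \<in> unit_steps" and neg: "e \<notin> range (\<lambda>i. - axis i 1)"
  have s: "(\<Sum>i\<in>UNIV. \<bar>e $ i\<bar>) = 1" using e by (simp add: unit_steps_def)
  then obtain i where i: "e $ i \<noteq> 0"
    by (metis abs_zero sum.neutral zero_neq_one)
  have "(\<Sum>i\<in>UNIV. \<bar>e $ i\<bar>) = \<bar>e $ i\<bar> + (\<Sum>j\<in>UNIV - {i}. \<bar>e $ j\<bar>)"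
    by (simp add: sum.remove)
  moreover have "(\<Sum>j\<in>UNIV - {i}. \<bar>e $ j\<bar>) \<ge> 0" by (simp add: sum_nonneg)
  ultimately have 1: "\<bar>e $ i\<bar> = 1" and 0: "(\<Sum>j\<in>UNIV - {i}. \<bar>e $ j\<bar>) = 0"
    using s i by linarith+
  from 0 have z: "e $ j = 0" if "j \<noteq> i" for j
    using that by (subst (asm) sum_nonneg_eq_0_iff) auto
  from 1 consider "e $ i = 1" | "e $ i = -1" by linarith
  then show "e \<in> range (\<lambda>i. axis i 1)"
  proof cases
    case 1 then have "e = axis i 1" using z by (auto simp: vec_eq_iff axis_def)
    then show ?thesis by blast
  next
    case 2 then have "e = - axis i 1" using z by (auto simp: vec_eq_iff axis_def)
    then show ?thesis using neg by blast
  qed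
qed (auto simp: unit_steps_def axis_def if_distrib sum.delta cong: if_cong)

lemma space_env:
  "space (env_algebra :: (int ^ 'n \<Rightarrow> int ^ 'n \<Rightarrow> real) measure) = {\<omega>. \<forall>y. \<omega> y \<in> prob_vectors}"
  by (auto simp: env_algebra_def space_PiM site_algebra_def space_restrict_space prob_vectors_def)

lemma emeasure_step_law:
  "emeasure (step_law \<omega> y) A = (\<Sum>e\<in>unit_steps. ennreal (\<omega> y e) * indicator A (y + e))"
proof -
  have "emeasure (step_law \<omega> y) A =
      emeasure (point_measure unit_steps (\<lambda>e. ennreal (\<omega> y e))) {e\<in>unit_steps. y + e \<in> A}"
    unfolding step_law_def
    by (subst emeasure_distr) (auto simp: space_point_measure intro!: arg_cong2[where f=emeasure])
  also have "\<dots> = (\<Sum>e\<in>{e\<in>unit_steps. y + e \<in> A}. ennreal (\<omega> y e))"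
    by (rule emeasure_point_measure_finite) auto
  also have "\<dots> = (\<Sum>e\<in>unit_steps. ennreal (\<omega> y e) * indicator A (y + e))"
    by (rule sum.mono_neutral_cong_left) (auto simp: indicator_def)
  finally show ?thesis .
qed

lemma sets_step_law [simp, measurable_cong]: "sets (step_law \<omega> y) = sets (count_space UNIV)"
  by (simp add: step_law_def)

lemma space_step_law [simp]: "space (step_law \<omega> y) = UNIV"
  by (simp add: step_law_def)

lemma prob_space_step_law: "\<omega> \<in> space env_algebra \<Longrightarrow> prob_space (step_law \<omega> y)"
  by (rule prob_spaceI)
     (auto simp: emeasure_step_law space_env prob_vectors_def sum_ennreal)

lemma measurable_site:
  assumes "e \<in> unit_steps"
  shows "(\<lambda>\<omega>. \<omega> y e) \<in> borel_measurable env_algebra"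
proof -
  have "(\<lambda>\<omega>. \<omega> y) \<in> measurable env_algebra site_algebra"
    unfolding env_algebra_def by (rule measurable_component_singleton) simp
  moreover have "(\<lambda>p. p e) \<in> borel_measurable site_algebra"
    unfolding site_algebra_def
    by (rule measurable_restrict_space1) (use assms in \<open>simp add: measurable_component_singleton\<close>)
  ultimately show ?thesis by (rule measurable_compose)
qed

lemma measurable_step_law:
  "(\<lambda>\<omega>. step_law \<omega> y) \<in> measurable env_algebra (subprob_algebra (count_space UNIV))"
proof (rule measurable_subprob_algebra)
  fix A :: "(int ^ 'a) set"
  show "(\<lambda>\<omega>. emeasure (step_law \<omega> y) A) \<in> borel_measurable env_algebra"
    unfolding emeasure_step_law
    by (intro borel_measurable_sum borel_measurable_times_ennreal borel_measurable_const
          measurable_compose[OF measurable_site measurable_ennreal])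
qed (auto intro: prob_space_imp_subprob_space prob_space_step_law)

lemma measurable_walk_kernel:
  "(\<lambda>(\<omega>, h). walk_kernel x \<omega> n h) \<in>
     measurable (env_algebra \<Otimes>\<^sub>M PiM {0..<n} (\<lambda>_. count_space UNIV)) (subprob_algebra (count_space UNIV))"
proof (cases n)
  case 0
  then show ?thesis
    by (simp add: walk_kernel_def space_subprob_algebra prob_space_return prob_space_imp_subprob_space)
next
  case (Suc m)
  have "(\<lambda>p. step_law (fst p) (snd p m)) \<in>
     measurable (env_algebra \<Otimes>\<^sub>M PiM {0..<n} (\<lambda>_. count_space UNIV)) (subprob_algebra (count_space UNIV))"
  proof (rule measurable_compose_countable)
    show "(\<lambda>p. step_law (fst p) y) \<in>
       measurable (env_algebra \<Otimes>\<^sub>M PiM {0..<n} (\<lambda>_. count_space UNIV)) (subprob_algebra (count_space UNIV))" for y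
      by (rule measurable_compose[OF measurable_fst measurable_step_law])
    show "(\<lambda>p. snd p m) \<in>
       measurable (env_algebra \<Otimes>\<^sub>M PiM {0..<n} (\<lambda>_. count_space UNIV)) (count_space UNIV)"
      by (rule measurable_compose[OF measurable_snd measurable_component_singleton]) (simp add: Suc)
  qed
  then show ?thesis by (simp add: walk_kernel_def Suc case_prod_unfold)
qed

lemma Ionescu_Tulcea_walk_kernel:
  assumes "\<omega> \<in> space env_algebra"
  shows "Ionescu_Tulcea (walk_kernel x \<omega>) (\<lambda>_. count_space UNIV)"
proof (rule Ionescu_Tulcea.intro)
  show "walk_kernel x \<omega> n \<in> measurable (PiM {0..<n} (\<lambda>_. count_space UNIV)) (subprob_algebra (count_space UNIV))" for n
    using measurable_Pair2[OF measurable_walk_kernel assms, of x n] by simp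
  show "prob_space (walk_kernel x \<omega> n h)" for n h
    using assms by (auto simp: walk_kernel_def prob_space_return prob_space_step_law split: nat.split)
qed

lemma prob_space_quenched_law:
  assumes "\<omega> \<in> space env_algebra"
  shows "prob_space (quenched_law x \<omega>)" and "sets (quenched_law x \<omega>) = sets path_algebra"
proof -
  interpret Ionescu_Tulcea "walk_kernel x \<omega>" "\<lambda>_. count_space UNIV"
    by (rule Ionescu_Tulcea_walk_kernel[OF assms])
  interpret L: prob_space PF.lim
  proof (rule prob_spaceI)
    have "PF.emb UNIV {} {\<lambda>_. undefined} = UNIV" by (auto simp: prod_emb_def space_PiM)
    moreover have "emeasure PF.lim (PF.emb UNIV {} {\<lambda>_. undefined}) = emeasure (CI {}) {\<lambda>_. undefined}"
      by (rule lim) (auto simp: PiM_empty)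
    moreover have "space (CI {}) = {\<lambda>_. undefined}" by (simp add: CI_def space_PiM)
    ultimately show "emeasure PF.lim (space PF.lim) = 1"
      using prob_space.emeasure_space_1[OF PF.prob_space_P, of "{}"] by (simp add: space_PiM)
  qed
  show "prob_space (quenched_law x \<omega>)" "sets (quenched_law x \<omega>) = sets path_algebra"
    unfolding quenched_law_def by (simp_all add: L.prob_space_axioms)
qed

lemma quenched_law_cylinder:
  assumes \<omega>: "\<omega> \<in> space env_algebra"
  shows "emeasure (quenched_law x \<omega>) {X. \<forall>i\<le>n. X i = a i} =
    (if a 0 = x then \<Prod>i<n. if a (Suc i) - a i \<in> unit_steps then ennreal (\<omega> (a i) (a (Suc i) - a i)) else 0
     else 0)"
proof -
  interpret Ionescu_Tulcea "walk_kernel x \<omega>" "\<lambda>_. count_space UNIV"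
    by (rule Ionescu_Tulcea_walk_kernel[OF \<omega>])
  let ?S = "\<lambda>n. {restrict a {0..<n}}"
  have S: "?S n = PiE {0..<n} (\<lambda>i. {a i})" for n
    by (auto simp: PiE_singleton restrict_def fun_eq_iff extensional_def)
      (metis PiE_arb PiE_mem atLeastLessThan_iff singletonD le0)+
  have sets_S [measurable]: "?S n \<in> sets (PiM {0..<n} (\<lambda>_. count_space UNIV))" for n
    unfolding S by (rule sets_PiM_I_finite) auto
  have *: "emeasure (C 0 (Suc n) (\<lambda>_. undefined)) (?S (Suc n)) =
    emeasure (C 0 n (\<lambda>_. undefined)) (?S n) * emeasure (walk_kernel x \<omega> n (restrict a {0..<n})) {a n}" for n
  proof -
    have u: "(\<lambda>_. undefined) \<in> space (PiM {0..<0::nat} (\<lambda>_. count_space (UNIV :: (int^'a) set)))"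
      by (simp add: space_PiM)
    have "emeasure (C 0 (Suc n) (\<lambda>_. undefined)) (?S (Suc n)) =
       (\<integral>\<^sup>+h. emeasure (eP n h) (?S (Suc n)) \<partial>C 0 n (\<lambda>_. undefined))"
      using measurable_eP[of n] 
      by (simp, subst emeasure_bind[where N="PiM {0..<Suc n} (\<lambda>_. count_space UNIV)"])
         (use space_C[OF u, of n] sets_C[OF u, of n] in
           \<open>auto simp: space_PiM PiE_eq_empty_iff cong: measurable_cong_sets\<close>)
    also have "\<dots> = (\<integral>\<^sup>+h. emeasure (walk_kernel x \<omega> n (restrict a {0..<n})) {a n} * indicator (?S n) h \<partial>C 0 n (\<lambda>_. undefined))"
    proof (rule nn_integral_cong)
      fix h assume "h \<in> space (C 0 n (\<lambda>_. undefined))"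
      then have h: "h \<in> space (PiM {0..<n} (\<lambda>_. count_space UNIV))" using space_C[OF u] by simp
      then have "h \<in> extensional {0..<n}" by (auto simp: space_PiM PiE_def)
      then have "fun_upd h n -` ?S (Suc n) = (if h = restrict a {0..<n} then {a n} else {})"
        by (auto simp: fun_eq_iff extensional_def less_Suc_eq split: if_splits; metis less_irrefl)
      then show "emeasure (eP n h) (?S (Suc n)) =
         emeasure (walk_kernel x \<omega> n (restrict a {0..<n})) {a n} * indicator (?S n) h"
        by (subst emeasure_eP[OF h sets_S]) (auto simp: indicator_def)
    qed
    also have "\<dots> = emeasure (walk_kernel x \<omega> n (restrict a {0..<n})) {a n} * emeasure (C 0 n (\<lambda>_. undefined)) (?S n)"
      using sets_C[OF u, of n] sets_S by (subst nn_integral_cmult_indicator) auto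
    finally show ?thesis by (simp add: mult.commute)
  qed
  have step: "emeasure (step_law \<omega> y) {z} = (if z - y \<in> unit_steps then ennreal (\<omega> y (z - y)) else 0)" for y z
  proof -
    have "emeasure (step_law \<omega> y) {z} = (\<Sum>e\<in>unit_steps. if e = z - y then ennreal (\<omega> y e) else 0)"
      unfolding emeasure_step_law by (rule sum.cong) (auto simp: indicator_def algebra_simps)
    then show ?thesis by simp
  qed
  have C: "emeasure (C 0 (Suc n) (\<lambda>_. undefined)) (?S (Suc n)) =
    (if a 0 = x then \<Prod>i<n. if a (Suc i) - a i \<in> unit_steps then ennreal (\<omega> (a i) (a (Suc i) - a i)) else 0
     else 0)" for n
  proof (induction n)
    case 0
    show ?case
      by (subst *) (auto simp: walk_kernel_def PiM_empty indicator_def restrict_def)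
  next
    case (Suc n)
    show ?case
      by (subst *) (auto simp: Suc walk_kernel_def step simp del: C.simps)
  qed
  have "{X. \<forall>i\<le>n. X i = a i} = PF.emb UNIV {0..<Suc n} (?S (Suc n))"
    by (auto simp: prod_emb_def space_PiM fun_eq_iff restrict_def less_Suc_eq_le split: if_splits)
  moreover have "emeasure PF.lim (PF.emb UNIV {0..<Suc n} (?S (Suc n))) = emeasure (C 0 (Suc n) (\<lambda>_. undefined)) (?S (Suc n))"
    by (subst lim, simp, rule sets_S, subst emeasure_CI[where n="Suc n"])
       (use sets_S[of "Suc n"] in \<open>auto simp: prod_emb_id dest: sets.sets_into_space\<close>)
  ultimately show ?thesis by (simp only: quenched_law_def C)
qed


lemma measurable_quenched_law:
  "quenched_law x \<in> measurable env_algebra (subprob_algebra path_algebra)"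
proof -
  let ?K = "walk_kernel x"
  let ?M = "\<lambda>_::nat. count_space (UNIV :: (int^'a) set)"
  have eP: "(\<lambda>p. Ionescu_Tulcea.eP (?K (fst p)) ?M n (snd p)) \<in>
      measurable (env_algebra \<Otimes>\<^sub>M PiM {0..<n} ?M) (subprob_algebra (PiM {0..<Suc n} ?M))" for n
  proof -
    have "(\<lambda>p. distr (?K (fst p) n (snd p)) (PiM {0..<Suc n} ?M) (fun_upd (snd p) n)) \<in>
      measurable (env_algebra \<Otimes>\<^sub>M PiM {0..<n} ?M) (subprob_algebra (PiM {0..<Suc n} ?M))"
    proof (rule measurable_distr2)
      show "(\<lambda>p. ?K (fst p) n (snd p)) \<in>
        measurable (env_algebra \<Otimes>\<^sub>M PiM {0..<n} ?M) (subprob_algebra (count_space UNIV))"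
        using measurable_walk_kernel[of x n] by (simp add: case_prod_unfold)
      show "(\<lambda>(p, y). fun_upd (snd p) n y) \<in>
        measurable ((env_algebra \<Otimes>\<^sub>M PiM {0..<n} ?M) \<Otimes>\<^sub>M count_space UNIV) (PiM {0..<Suc n} ?M)"
        unfolding case_prod_unfold
        by (rule measurable_fun_upd[where J="{0..<n}"]) (auto intro: measurable_compose[OF measurable_fst])
    qed
    then show ?thesis
      by (subst measurable_cong[where g="\<lambda>p. distr (?K (fst p) n (snd p)) (PiM {0..<Suc n} ?M) (fun_upd (snd p) n)"])
         (auto simp: space_pair_measure Ionescu_Tulcea.eP_def[OF Ionescu_Tulcea_walk_kernel])
  qed
  have C: "(\<lambda>\<omega>. Ionescu_Tulcea.C (?K \<omega>) ?M 0 n (\<lambda>_. undefined)) \<in>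
      measurable env_algebra (subprob_algebra (PiM {0..<n} ?M))" for n
  proof (induction n)
    case 0
    have "return (PiM {0..<0} ?M) (\<lambda>_. undefined) \<in> space (subprob_algebra (PiM {0..<0} ?M))"
      by (auto simp: space_subprob_algebra space_PiM intro!: prob_space_imp_subprob_space prob_space_return)
    then show ?case
      by (subst measurable_cong[where g="\<lambda>_. return (PiM {0..<0} ?M) (\<lambda>_. undefined)"])
         (auto simp: Ionescu_Tulcea.C.simps[OF Ionescu_Tulcea_walk_kernel])
  next
    case (Suc n)
    have "(\<lambda>\<omega>. Ionescu_Tulcea.C (?K \<omega>) ?M 0 n (\<lambda>_. undefined) \<bind> Ionescu_Tulcea.eP (?K \<omega>) ?M n) \<in>
      measurable env_algebra (subprob_algebra (PiM {0..<Suc n} ?M))"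
      by (rule measurable_bind[OF Suc]) (use eP[of n] in \<open>simp add: case_prod_unfold\<close>)
    then show ?case
      by (subst measurable_cong[where g="\<lambda>\<omega>. Ionescu_Tulcea.C (?K \<omega>) ?M 0 n (\<lambda>_. undefined) \<bind> Ionescu_Tulcea.eP (?K \<omega>) ?M n"])
         (auto simp: Ionescu_Tulcea.C.simps[OF Ionescu_Tulcea_walk_kernel])
  qed
  show ?thesis
  proof (rule measurable_subprob_algebra_generated[OF sets_PiM Int_stable_prod_algebra prod_algebra_sets_into_space])
    fix \<omega> :: "int^'a \<Rightarrow> int^'a \<Rightarrow> real" assume \<omega>: "\<omega> \<in> space env_algebra"
    show "subprob_space (quenched_law x \<omega>)"
      by (rule prob_space_imp_subprob_space[OF prob_space_quenched_law(1)[OF \<omega>]])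
    show "sets (quenched_law x \<omega>) = sets path_algebra"
      by (rule prob_space_quenched_law(2)[OF \<omega>])
  next
    fix A assume "A \<in> prod_algebra UNIV ?M"
    then obtain J X where J: "A = prod_emb UNIV ?M J (PiE J X)" "finite J" "\<And>i. i \<in> J \<Longrightarrow> X i \<in> sets (?M i)"
      by (rule prod_algebraE) auto
    then have X: "PiE J X \<in> sets (PiM J ?M)" by (intro sets_PiM_I_finite) auto
    from \<open>finite J\<close> obtain n where n: "J \<subseteq> {0..<n}"
      by (metis finite_nat_iff_bounded lessThan_atLeast0)
    have "emeasure (quenched_law x \<omega>) A =
        emeasure (Ionescu_Tulcea.C (?K \<omega>) ?M 0 n (\<lambda>_. undefined)) (prod_emb {0..<n} ?M J (PiE J X))"
      if "\<omega> \<in> space env_algebra" for \<omega>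
    proof -
      interpret Ionescu_Tulcea "?K \<omega>" ?M by (rule Ionescu_Tulcea_walk_kernel[OF that])
      show ?thesis
        unfolding quenched_law_def J(1) by (subst lim[OF J(2) X]) (rule emeasure_CI[OF n X])
    qed
    moreover have "(\<lambda>\<omega>. emeasure (Ionescu_Tulcea.C (?K \<omega>) ?M 0 n (\<lambda>_. undefined)) (prod_emb {0..<n} ?M J (PiE J X)))
        \<in> borel_measurable env_algebra"
      by (rule measurable_emeasure_kernel[OF C]) (rule measurable_prod_emb[OF n X])
    ultimately show "(\<lambda>\<omega>. emeasure (quenched_law x \<omega>) A) \<in> borel_measurable env_algebra"
      by (subst measurable_cong) auto
  next
    have "(\<lambda>\<omega>. emeasure (quenched_law x \<omega>) (\<Pi>\<^sub>E i\<in>UNIV. space (?M i))) \<in> borel_measurable env_algebra \<longleftrightarrow>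
        (\<lambda>_. 1::ennreal) \<in> borel_measurable (env_algebra :: (int^'a \<Rightarrow> int^'a \<Rightarrow> real) measure)"
    proof (rule measurable_cong)
      fix \<omega> :: "int^'a \<Rightarrow> int^'a \<Rightarrow> real" assume \<omega>: "\<omega> \<in> space env_algebra"
      have "space (quenched_law x \<omega>) = UNIV"
        using sets_eq_imp_space_eq[OF prob_space_quenched_law(2)[OF \<omega>]] by (simp add: space_PiM)
      then show "emeasure (quenched_law x \<omega>) (\<Pi>\<^sub>E i\<in>UNIV. space (?M i)) = 1"
        using prob_space.emeasure_space_1[OF prob_space_quenched_law(1)[OF \<omega>], of x] by simp
    qed
    then show "(\<lambda>\<omega>. emeasure (quenched_law x \<omega>) (\<Pi>\<^sub>E i\<in>UNIV. space (?M i))) \<in> borel_measurable env_algebra"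
      by simp
  qed
qed

lemma emeasure_annealed_law:
  assumes "prob_space \<PP>" and "sets \<PP> = sets env_algebra" and "A \<in> sets path_algebra"
  shows "emeasure (annealed_law \<PP> x) A = (\<integral>\<^sup>+\<omega>. emeasure (quenched_law x \<omega>) A \<partial>\<PP>)"
  unfolding annealed_law_def
proof (rule emeasure_bind[OF prob_space.not_empty[OF assms(1)] _ assms(3)])
  show "quenched_law x \<in> measurable \<PP> (subprob_algebra path_algebra)"
    using measurable_quenched_law measurable_cong_sets[OF assms(2) refl] by blast
qed

lemma sets_dirichlet_env: "sets (dirichlet_env j \<beta>) = sets env_algebra"
  unfolding dirichlet_env_def env_algebra_def by (rule sets_PiM_cong) (simp_all add: dirichlet_law_def)

lemma measurable_complete_at:
  fixes j :: "int ^ 'n"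
  assumes j: "j \<in> unit_steps"
  shows "simplex_chart j \<in> sets (PiM (unit_steps - {j}) (\<lambda>_. lborel))" (is ?A)
    and "complete_at j \<in>
      measurable (restrict_space (PiM (unit_steps - {j}) (\<lambda>_. lborel)) (simplex_chart j)) site_algebra" (is ?B)
proof -
  let ?L = "PiM (unit_steps - {j}) (\<lambda>_. lborel :: real measure)"
  have m: "(\<lambda>q. complete_at j q e) \<in> borel_measurable ?L" if "e \<in> unit_steps" for e
  proof -
    have c: "(\<lambda>q. q e') \<in> borel_measurable ?L" if "e' \<in> unit_steps - {j}" for e'
      using measurable_component_singleton[OF that, of "\<lambda>_. lborel :: real measure"] by simp
    show ?thesis
      using c[of e] that unfolding complete_at_def by (cases "e = j") (auto intro: c)
  qed
  have "simplex_chart j = {q \<in> space ?L. \<forall>e\<in>unit_steps. complete_at j q e \<in> {0<..1}}"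
    by (auto simp: simplex_chart_def space_PiM)
  also have "\<dots> \<in> sets ?L"
    by (intro sets.sets_Collect_finite_All' measurable_sets_Collect[OF m])
      (use j in auto)
  finally show ?A .
  show ?B
    unfolding site_algebra_def
  proof (rule measurable_restrict_space2)
    show "complete_at j \<in> space (restrict_space ?L (simplex_chart j)) \<rightarrow> prob_vectors"
    proof
      fix q assume "q \<in> space (restrict_space ?L (simplex_chart j))"
      then have q: "q \<in> simplex_chart j" by (simp add: space_restrict_space)
      have "(\<Sum>e\<in>unit_steps. complete_at j q e) =
          complete_at j q j + (\<Sum>e\<in>unit_steps - {j}. complete_at j q e)"
        using j by (simp add: sum.remove)
      also have "(\<Sum>e\<in>unit_steps - {j}. complete_at j q e) = (\<Sum>e\<in>unit_steps - {j}. q e)"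
        by (rule sum.cong) (auto simp: complete_at_def)
      finally have "(\<Sum>e\<in>unit_steps. complete_at j q e) = 1" by (simp add: complete_at_def)
      moreover have "complete_at j q \<in> unit_steps \<rightarrow>\<^sub>E UNIV"
        using q j by (auto simp: simplex_chart_def complete_at_def PiE_def extensional_def)
      ultimately show "complete_at j q \<in> prob_vectors"
        using q by (auto simp: prob_vectors_def simplex_chart_def less_imp_le)
    qed
    show "complete_at j \<in> measurable (restrict_space ?L (simplex_chart j)) (PiM unit_steps (\<lambda>_. borel))"
    proof (rule measurable_restrict_space1, rule measurable_PiM_single')
      show "complete_at j \<in> space ?L \<rightarrow> (\<Pi>\<^sub>E e\<in>unit_steps. space borel)"
        using j by (auto simp: space_PiM complete_at_def PiE_def extensional_def)
    qed (rule m)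
  qed
qed

lemma sets_exit_event:
  "{X. exit_time A X < \<infinity> \<and> real_vec (X (the_enat (exit_time A X))) \<bullet> l < L} \<in> sets path_algebra"
proof -
  have *: "(exit_time A X = enat n) \<longleftrightarrow> X n \<notin> A \<and> (\<forall>m<n. X m \<in> A)" for X n
  proof -
    have "exit_time A X = enat (LEAST n. X n \<notin> A)" if "X n \<notin> A" for n
      unfolding exit_time_def
      by (rule antisym[OF INF_lower INF_greatest]) (use that LeastI[of "\<lambda>n. X n \<notin> A"] in \<open>auto intro: Least_le\<close>)
    moreover have "exit_time A X = \<infinity>" if "\<And>n. X n \<in> A"
      using that by (simp add: exit_time_def top_enat_def)
    ultimately show ?thesis
      by (smt (verit) LeastI_ex Least_equality enat.inject enat.distinct(1) linorder_not_less not_less_Least)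
  qed
  have "{X. exit_time A X < \<infinity> \<and> real_vec (X (the_enat (exit_time A X))) \<bullet> l < L} =
     (\<Union>n. {X. exit_time A X = enat n \<and> real_vec (X n) \<bullet> l < L})"
    by (auto simp: less_infinityE)
  also have "\<dots> \<in> sets path_algebra"
  proof (rule sets.countable_UN, clarify)
    fix n
    have c: "{X. X m \<in> B} \<in> sets path_algebra" for m B
      using measurable_sets[OF measurable_component_singleton[of m UNIV "\<lambda>_. count_space UNIV"], of B]
      by (simp add: space_PiM vimage_def)
    have "{X. exit_time A X = enat n \<and> real_vec (X n) \<bullet> l < L} =
       {X. X n \<in> - A} \<inter> (space path_algebra \<inter> (\<Inter>m\<in>{..<n}. {X. X m \<in> A})) \<inter> {X. X n \<in> {x. real_vec x \<bullet> l < L}}"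
      by (auto simp: * space_PiM)
    also have "\<dots> \<in> sets path_algebra"
      by (cases "n = 0") (auto intro!: sets.Int c sets.finite_INT sets.top simp del: Compl_iff mem_Collect_eq)
    finally show "{X. exit_time A X = enat n \<and> real_vec (X n) \<bullet> l < L} \<in> sets path_algebra" .
  qed
  finally show ?thesis .
qed

end

theory Submission
  imports Defs "HOL-Real_Asymp.Real_Asymp"
begin

text \<open>A step to the left is rare but may be repeated, and \<open>M\<close> and \<open>c\<^sub>0\<close> are chosen after \<open>\<epsilon>\<close>, so a
  single scale does not suffice: the probability of a wrong exit has to decay faster than every power
  along a sequence of scales. Call a site bad at scale \<open>l\<close> if the walk started there leaves the block of
  half-length \<open>l\<close> and half-width \<open>l\<^sup>2\<close> around it through the right face with quenched probability below
  \<open>15/16\<close>. At scale \<open>l\<^sup>5\<close> the block is good as soon as only a bounded number of bad sites with disjoint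
  blocks occur in it and \<open>\<omega>(x,e\<^sub>1) \<ge> 2\<^bsup>-l\<^esup>\<close> throughout: an explicit superharmonic barrier shows that the
  drift accumulated over \<open>l\<^sup>4\<close> good block steps beats the cost \<open>2\<^bsup>O(l^3)\<^esup>\<close> of forcing the walk straight
  through the few bad windows. By independence the probability of a bad block is essentially raised to a large
  power when passing from \<open>l\<close> to \<open>l\<^sup>5\<close>, which makes it superpolynomially small once it is below a
  fixed power of \<open>l\<close> at one large scale.

  At that scale \<open>\<beta>(-e\<^sub>1) \<rightarrow> 0\<close> suppresses all steps to the left up to a finite time horizon. Without them,
  the walk steps to the right with probability bounded below at each fresh site, and it cannot travel far
  sideways without visiting many fresh sites. The moments of the Dirichlet law make these bounds uniform in
  \<open>\<beta>(-e\<^sub>1) \<le> 1\<close>.\<close>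

section \<open>Leaving a box on the wrong side\<close>

text \<open>A bad site gives no information on where the walk goes from its block. Forward, it is
  left by force only: with \<open>\<omega>(x,e) \<ge> 2 powr (- l)\<close> ahead, the
  \<open>l^2 + l\<close> steps through a window and one block length beyond it succeed with
  probability at least \<open>2 powr (- (l^3 + l^2))\<close>; this is the source of the cost.
  Sideways, pigeonhole finds on each lateral side a strip free of bad sites, and a walk can reach
  that side only through the strip, by good block steps. The half-width \<open>l^10\<close> repeats
  the shape of the blocks, \<open>l^10 = (l^5)^2\<close>, and has room for enough candidate strips
  of width of order \<open>l^6\<close>. The threshold \<open>2 powr (- l)\<close> is chosen so low
  that its violation somewhere in the large block is exponentially unlikely in \<open>l\<close>, in
  spite of polynomially many sites. Exponents are measured relative to the current scale, and each
  passage from \<open>l\<close> to \<open>l^5\<close> doubles them, so they exceed any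
  \<open>M\<close>. The recursion starts as soon as the exponent beats the number of sites, at
  \<open>22 * d\<close>. Only this fixed exponent has to be produced by a small weight of the step
  to the left, which is why \<open>\<epsilon>\<close> can precede \<open>M\<close> and the constant
  \<open>c0\<close>.\<close>

type_synonym 'n environment = "int ^ 'n \<Rightarrow> int ^ 'n \<Rightarrow> real"

definition slab :: "'n \<Rightarrow> int \<Rightarrow> int \<Rightarrow> (int ^ 'n) set" where
  "slab k l w = {x. \<bar>x $ k\<bar> < l \<and> (\<forall>i. i \<noteq> k \<longrightarrow> \<bar>x $ i\<bar> < w)}"

text \<open>Walks that are still inside the slab after \<open>N\<close> steps count as failures, so that no information on
  exit times is needed.\<close>

primrec fail :: "'n \<Rightarrow> int \<Rightarrow> int \<Rightarrow> 'n environment \<Rightarrow> nat \<Rightarrow> int ^ 'n \<Rightarrow> real" where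
  "fail k l w \<omega> 0 x = (if l \<le> x $ k then 0 else 1)"
| "fail k l w \<omega> (Suc N) x =
     (if l \<le> x $ k then 0 else if x \<notin> slab k l w then 1
      else \<Sum>e\<in>unit_steps. \<omega> x e * fail k l w \<omega> N (x + e))"

definition env_shift :: "int ^ 'n \<Rightarrow> 'n environment \<Rightarrow> 'n environment" where
  "env_shift c \<omega> y = \<omega> (y + c)"

text \<open>The barrier used below is halved on the right face of a block and at most doubled elsewhere, so any
  threshold \<open>p\<close> with \<open>(1 - p) / 2 + 2 * p < 1\<close> and some room to spare would do.\<close>

definition bad :: "'n \<Rightarrow> int \<Rightarrow> int \<Rightarrow> 'n environment \<Rightarrow> int ^ 'n \<Rightarrow> bool" where
  "bad k l w \<omega> x \<longleftrightarrow> (\<forall>N. fail k l w (env_shift x \<omega>) N 0 > 1 / 16)"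

lemma prob_vectorsD:
  assumes "p \<in> prob_vectors"
  shows "e \<in> unit_steps \<Longrightarrow> 0 \<le> p e" and "(\<Sum>e\<in>unit_steps. p e) = 1"
  using assms by (auto simp: prob_vectors_def)

lemma prob_vectors_average:
  assumes "p \<in> prob_vectors"
  shows "(\<And>e. e \<in> unit_steps \<Longrightarrow> f e \<le> (c::real)) \<Longrightarrow> (\<Sum>e\<in>unit_steps. p e * f e) \<le> c"
    and "(\<And>e. e \<in> unit_steps \<Longrightarrow> c \<le> f e) \<Longrightarrow> c \<le> (\<Sum>e\<in>unit_steps. p e * f e)"
proof -
  have c: "(\<Sum>e\<in>unit_steps. p e * c) = c"
    using prob_vectorsD(2)[OF assms] by (simp flip: sum_distrib_right)
  show "(\<Sum>e\<in>unit_steps. p e * f e) \<le> c" if "\<And>e. e \<in> unit_steps \<Longrightarrow> f e \<le> c"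
    using sum_mono[of unit_steps "\<lambda>e. p e * f e" "\<lambda>e. p e * c"] that prob_vectorsD(1)[OF assms] c
    by (simp add: mult_left_mono)
  show "c \<le> (\<Sum>e\<in>unit_steps. p e * f e)" if "\<And>e. e \<in> unit_steps \<Longrightarrow> c \<le> f e"
    using sum_mono[of unit_steps "\<lambda>e. p e * c" "\<lambda>e. p e * f e"] that prob_vectorsD(1)[OF assms] c
    by (simp add: mult_left_mono)
qed

lemma axis_unit_steps [simp]: "axis i 1 \<in> unit_steps" "- axis i 1 \<in> unit_steps"
  by (auto simp: unit_steps_eq)

lemma unit_steps_abs_le: "e \<in> unit_steps \<Longrightarrow> \<bar>e $ i\<bar> \<le> 1"
  using member_le_sum[of i UNIV "\<lambda>i. \<bar>e $ i\<bar>"] by (simp add: unit_steps_def)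

lemma unit_steps_cases:
  assumes "e \<in> unit_steps"
  obtains "e = axis k 1" | "e = - axis k 1" | "e $ k = 0"
proof -
  from assms obtain i where "e = axis i 1 \<or> e = - axis i 1" by (auto simp: unit_steps_eq)
  then show thesis using that by (cases "i = k") (auto simp: axis_def)
qed

lemma finite_slab [simp]: "finite (slab k l w)"
proof -
  let ?m = "max l w"
  have "slab k l w \<subseteq> {x. \<forall>i. x $ i \<in> {-?m..?m}}"
  proof (intro subsetI CollectI allI)
    fix x :: "int ^ 'a" and i assume "x \<in> slab k l w"
    then have "\<bar>x $ i\<bar> < l \<or> \<bar>x $ i\<bar> < w" by (cases "i = k") (auto simp: slab_def)
    then show "x $ i \<in> {-?m..?m}" by auto
  qed
  moreover have "finite {x :: int ^ 'a. \<forall>i. x $ i \<in> {-?m..?m}}"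
    using finite_PiE[of UNIV "\<lambda>_::'a. {-?m..?m}"]
    by (intro finite_subset[OF _ finite_imageI[of "PiE UNIV (\<lambda>_. {-?m..?m})" vec_lambda]])
       (auto intro!: image_eqI[of _ _ "vec_nth _"])
  ultimately show ?thesis by (rule finite_subset)
qed

section \<open>Failure over an infinite horizon as a harmonic function\<close>

context
  fixes k :: "'n::finite" and \<omega> :: "'n environment"
  assumes env: "\<And>y. \<omega> y \<in> prob_vectors"
begin

lemma fail_bounds: "0 \<le> fail k l w \<omega> N x" "fail k l w \<omega> N x \<le> 1"
proof (induction N arbitrary: x)
  case (Suc N)
  { case 1 show ?case using prob_vectors_average(2)[OF env, of 0] Suc(1) by simp }
  { case 2 show ?case using prob_vectors_average(1)[OF env, of _ 1] Suc(2) by simp }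
qed auto

lemma fail_Suc_le: "fail k l w \<omega> (Suc N) x \<le> fail k l w \<omega> N x"
proof (induction N arbitrary: x)
  case 0
  show ?case using fail_bounds[of l w "Suc 0" x] by (cases "l \<le> x $ k") auto
next
  case (Suc N)
  show ?case
    by (subst fail.simps(2)[of _ _ _ _ N], subst fail.simps(2))
       (auto simp del: fail.simps intro!: sum_mono mult_left_mono Suc prob_vectorsD(1)[OF env])
qed

lemma decseq_fail: "decseq (\<lambda>N. fail k l w \<omega> N x)"
  by (rule decseq_SucI) (rule fail_Suc_le)

text \<open>Passing to the limit trades the horizon for harmonicity in the slab. Nothing is lost for
  \<open>bad\<close>: a strict bound below \<open>1/16\<close> on the limit already yields a finite
  horizon with the same bound.\<close>

definition fail_inf :: "int \<Rightarrow> int \<Rightarrow> int ^ 'n \<Rightarrow> real" where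
  "fail_inf l w x = lim (\<lambda>N. fail k l w \<omega> N x)"

lemma fail_inf_lim: "(\<lambda>N. fail k l w \<omega> N x) \<longlonglongrightarrow> fail_inf l w x"
proof -
  have "convergent (\<lambda>N. fail k l w \<omega> N x)"
    by (rule Bseq_monoseq_convergent[OF BseqI'[of _ 1] decseq_imp_monoseq[OF decseq_fail]])
       (use fail_bounds[of l w _ x] in simp)
  then show ?thesis unfolding fail_inf_def by (simp add: convergent_LIMSEQ_iff)
qed

lemma fail_inf_bounds: "0 \<le> fail_inf l w x" "fail_inf l w x \<le> 1"
  by (rule LIMSEQ_le_const[OF fail_inf_lim], use fail_bounds in blast)
     (rule LIMSEQ_le_const2[OF fail_inf_lim], use fail_bounds in blast)

lemma fail_inf_right: "l \<le> x $ k \<Longrightarrow> fail_inf l w x = 0"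
proof -
  assume "l \<le> x $ k"
  then have "(\<lambda>N. fail k l w \<omega> N x) = (\<lambda>_. 0)"
  proof (intro ext)
    fix N show "l \<le> x $ k \<Longrightarrow> fail k l w \<omega> N x = 0" by (cases N) auto
  qed
  then show ?thesis using fail_inf_lim[of l w x] by (simp add: LIMSEQ_const_iff)
qed

lemma fail_inf_harmonic:
  assumes "x \<in> slab k l w"
  shows "fail_inf l w x = (\<Sum>e\<in>unit_steps. \<omega> x e * fail_inf l w (x + e))"
proof (rule LIMSEQ_unique)
  show "(\<lambda>N. fail k l w \<omega> (Suc N) x) \<longlonglongrightarrow> fail_inf l w x"
    using fail_inf_lim by (rule LIMSEQ_Suc)
  have "(\<lambda>N. fail k l w \<omega> (Suc N) x) = (\<lambda>N. \<Sum>e\<in>unit_steps. \<omega> x e * fail k l w \<omega> N (x + e))"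
    using assms by (auto simp: slab_def)
  then show "(\<lambda>N. fail k l w \<omega> (Suc N) x) \<longlonglongrightarrow> (\<Sum>e\<in>unit_steps. \<omega> x e * fail_inf l w (x + e))"
    by (auto intro!: tendsto_sum tendsto_mult tendsto_const fail_inf_lim)
qed

text \<open>Equality holds in the slab, and from level \<open>l\<close> on the left side is
  \<open>0\<close>. The second case matters because a block or a straight path started near the
  right face may overshoot it.\<close>

lemma fail_inf_subharmonic:
  assumes "x \<in> slab k l w \<or> l \<le> x $ k"
  shows "fail_inf l w x \<le> (\<Sum>e\<in>unit_steps. \<omega> x e * fail_inf l w (x + e))"
  using assms fail_inf_harmonic[of x l w]
  by (auto simp: fail_inf_right intro!: sum_nonneg mult_nonneg_nonneg prob_vectorsD(1)[OF env] fail_inf_bounds)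

text \<open>A maximum principle: evaluating at a maximiser of \<open>fail_inf / h\<close> removes any need to know that
  the walk leaves the box.\<close>

lemma fail_inf_le_barrier:
  assumes pos: "\<And>x. 0 < h x"
    and out: "\<And>x. x $ k < l \<Longrightarrow> x \<notin> slab k l w \<Longrightarrow> 1 \<le> h x"
    and step: "\<And>x S. x \<in> slab k l w \<Longrightarrow> h x < 1 \<Longrightarrow> 1 \<le> S \<Longrightarrow> (\<And>y. fail_inf l w y \<le> S * h y)
      \<Longrightarrow> fail_inf l w x < S * h x"
  shows "fail_inf l w x \<le> h x"
proof -
  have outside: "fail_inf l w y \<le> S * h y" if "y \<notin> slab k l w" "1 \<le> S" for y S
  proof (cases "y $ k < l")
    case True
    then have "1 \<le> S * h y" using out[OF True that(1)] that(2) by (metis mult_mono' mult_1 zero_le_one)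
    then show ?thesis using fail_inf_bounds(2)[of l w y] by linarith
  next
    case False
    then show ?thesis using fail_inf_right[of l y w] pos[of y] that(2) by (simp add: mult_nonneg_nonneg)
  qed
  show ?thesis
  proof (cases "slab k l w = {}")
    case True
    then show ?thesis using outside[of x 1] by simp
  next
    case False
    \<comment> \<open>\<open>S\<close> is the best constant with \<open>fail_inf \<le> S * h\<close>
      on the finite slab, attained at some \<open>z\<close>. If it exceeded \<open>1\<close>, then
      \<open>h z < 1\<close>, because \<open>fail_inf\<close> is at most \<open>1\<close>, and
      \<open>step\<close> would make the inequality strict at \<open>z\<close>.\<close>
    define S where "S = Max ((\<lambda>x. fail_inf l w x / h x) ` slab k l w)"
    have "S \<in> (\<lambda>x. fail_inf l w x / h x) ` slab k l w"
      unfolding S_def by (rule Max_in) (use False in auto)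
    then obtain z where z: "z \<in> slab k l w" "S = fail_inf l w z / h z" by auto
    have le: "fail_inf l w y \<le> S * h y" if "y \<in> slab k l w" for y
    proof -
      have "fail_inf l w y / h y \<le> S" unfolding S_def using that by (intro Max_ge) auto
      then show ?thesis using pos[of y] by (simp add: divide_le_eq)
    qed
    have "S \<le> 1"
    proof (rule ccontr)
      assume "\<not> S \<le> 1"
      then have S: "1 \<le> S" "1 < S" by auto
      have all: "fail_inf l w y \<le> S * h y" for y using le outside S(1) by blast
      have eq: "fail_inf l w z = S * h z" using z(2) pos[of z] by (simp add: field_simps)
      have "h z < 1"
      proof (rule ccontr)
        assume "\<not> h z < 1"
        then have "S * 1 \<le> S * h z" using S by (intro mult_left_mono) auto
        then show False using fail_inf_bounds(2)[of l w z] eq S by linarith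
      qed
      then show False using step[OF z(1) _ S(1) all] eq by simp
    qed
    show ?thesis
    proof (cases "x \<in> slab k l w")
      case True
      have "S * h x \<le> 1 * h x" using \<open>S \<le> 1\<close> pos[of x] by (intro mult_right_mono) auto
      then show ?thesis using le[OF True] by linarith
    qed (use outside[of x 1] in simp)
  qed
qed

text \<open>Optional stopping at the exit from the block around \<open>c\<close>, carried out by
  induction on the horizon: \<open>A + (C - A) * fail\<close> dominates \<open>g\<close>, with value
  \<open>A\<close> on the right face and \<open>C\<close> elsewhere, and a good centre keeps the
  weight of \<open>C\<close> at most \<open>1/16\<close>.\<close>

lemma good_block_le:
  assumes good: "\<not> bad k l w \<omega> c" and l: "0 < l" "0 < w"
    and sub: "\<And>y. y - c \<in> slab k l w \<Longrightarrow> g y \<le> (\<Sum>e\<in>unit_steps. \<omega> y e * g (y + e))"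
    and A: "\<And>y. y $ k = c $ k + l \<Longrightarrow> (\<And>i. i \<noteq> k \<Longrightarrow> \<bar>y $ i - c $ i\<bar> \<le> w) \<Longrightarrow> g y \<le> A"
    and C: "\<And>y. \<bar>y $ k - c $ k\<bar> \<le> l \<Longrightarrow> (\<And>i. i \<noteq> k \<Longrightarrow> \<bar>y $ i - c $ i\<bar> \<le> w) \<Longrightarrow> g y \<le> C"
    and AC: "A \<le> C"
  shows "g c \<le> 15 / 16 * A + 1 / 16 * (C :: real)"
proof -
  let ?f = "fail k l w (env_shift c \<omega>)"
  let ?cl = "\<lambda>y. \<bar>y $ k\<bar> \<le> l \<and> (\<forall>i. i \<noteq> k \<longrightarrow> \<bar>y $ i\<bar> \<le> w)"
  have main: "g (c + y) \<le> A + (C - A) * ?f N y" if "?cl y" for N y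
    using that
  proof (induction N arbitrary: y)
    case 0
    then show ?case using A[of "c + y"] C[of "c + y"] by auto
  next
    case (Suc N)
    consider "l \<le> y $ k" | "y $ k < l" "y \<notin> slab k l w" | "y \<in> slab k l w" by force
    then show ?case
    proof cases
      case 1
      then show ?thesis using A[of "c + y"] Suc.prems by auto
    next
      case 2
      then show ?thesis using C[of "c + y"] Suc.prems by auto
    next
      case 3
      have cl: "?cl (y + e)" if "e \<in> unit_steps" for e
      proof -
        have b: "\<bar>y $ k\<bar> < l" "\<And>i. i \<noteq> k \<Longrightarrow> \<bar>y $ i\<bar> < w" using 3 by (auto simp: slab_def)
        have "\<bar>y $ i + e $ i\<bar> \<le> w" if "i \<noteq> k" for i
          using b(2)[OF that] unit_steps_abs_le[OF \<open>e \<in> unit_steps\<close>, of i] by linarith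
        moreover have "\<bar>y $ k + e $ k\<bar> \<le> l" using b(1) unit_steps_abs_le[OF \<open>e \<in> unit_steps\<close>, of k] by linarith
        ultimately show ?thesis by simp
      qed
      have sh: "env_shift c \<omega> y = \<omega> (c + y)" by (simp add: env_shift_def add.commute)
      have "g (c + y) \<le> (\<Sum>e\<in>unit_steps. \<omega> (c + y) e * g (c + (y + e)))"
        using sub[of "c + y"] 3 by (simp add: add.assoc)
      also have "\<dots> \<le> (\<Sum>e\<in>unit_steps. \<omega> (c + y) e * (A + (C - A) * ?f N (y + e)))"
        by (intro sum_mono mult_left_mono Suc.IH cl prob_vectorsD(1)[OF env])
      also have "\<dots> = A * (\<Sum>e\<in>unit_steps. \<omega> (c + y) e) + (C - A) * (\<Sum>e\<in>unit_steps. \<omega> (c + y) e * ?f N (y + e))"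
        by (simp add: algebra_simps sum.distrib sum_distrib_left sum_subtractf)
      also have "\<dots> = A + (C - A) * ?f (Suc N) y"
        using 3 prob_vectorsD(2)[OF env, of "c + y"] sh by (auto simp: slab_def)
      finally show ?thesis .
    qed
  qed
  from good obtain N where "?f N 0 \<le> 1 / 16" by (auto simp: bad_def not_less)
  then have "(C - A) * ?f N 0 \<le> (C - A) * (1 / 16)" using AC by (intro mult_left_mono) auto
  moreover have "g c \<le> A + (C - A) * ?f N 0" using main[of 0 N] l by simp
  ultimately show ?thesis by (simp add: field_simps)
qed

text \<open>Only the single event of \<open>m\<close> steps straight ahead is exploited: each has
  probability at least \<open>\<kappa>\<close>, and every deviation is charged the crude value
  \<open>C\<close>.\<close>

lemma straight_path_le:
  assumes "0 < \<kappa>" "\<kappa> \<le> 1"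
    and "\<And>j. j < m \<Longrightarrow> \<kappa> \<le> \<omega> (x + of_nat j *s axis k 1) (axis k 1)"
    and "\<And>j. j < m \<Longrightarrow> g (x + of_nat j *s axis k 1) \<le>
      (\<Sum>e\<in>unit_steps. \<omega> (x + of_nat j *s axis k 1) e * g (x + of_nat j *s axis k 1 + e))"
    and "\<And>j e. j < m \<Longrightarrow> e \<in> unit_steps \<Longrightarrow> g (x + of_nat j *s axis k 1 + e) \<le> C"
    and "g (x + of_nat m *s axis k 1) \<le> D" "D \<le> C"
  shows "g x \<le> (1 - \<kappa> ^ m) * C + \<kappa> ^ m * (D::real)"
  using assms(3-)
proof (induction m arbitrary: x)
  case 0
  then show ?case by simp
next
  case (Suc m)
  let ?a = "axis k 1 :: int ^ 'n"
  have eq: "x + ?a + of_nat j *s ?a = x + of_nat (Suc j) *s ?a" for j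
    by (simp add: vector_sadd_rdistrib algebra_simps)
  have IH: "g (x + ?a) \<le> (1 - \<kappa> ^ m) * C + \<kappa> ^ m * D"
  proof (rule Suc.IH; (unfold eq)?)
    show "\<kappa> \<le> \<omega> (x + of_nat (Suc j) *s ?a) ?a" if "j < m" for j
      by (rule Suc.prems(1)) (use that in simp)
    show "g (x + of_nat (Suc j) *s ?a) \<le>
      (\<Sum>e\<in>unit_steps. \<omega> (x + of_nat (Suc j) *s ?a) e * g (x + of_nat (Suc j) *s ?a + e))" if "j < m" for j
      by (rule Suc.prems(2)) (use that in simp)
    show "g (x + of_nat (Suc j) *s ?a + e) \<le> C" if "j < m" "e \<in> unit_steps" for j e
      by (rule Suc.prems(3)) (use that in simp_all)
  qed (rule Suc.prems(4), rule Suc.prems(5))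
  have "0 \<le> \<kappa> ^ m" "\<kappa> ^ m \<le> 1" using assms by (auto intro: power_le_one)
  then have b: "(1 - \<kappa> ^ m) * C + \<kappa> ^ m * D \<le> C"
    using mult_left_mono[OF Suc.prems(5), of "\<kappa> ^ m"] by (simp add: algebra_simps)
  have p: "\<kappa> \<le> \<omega> x ?a" using Suc.prems(1)[of 0] by simp
  have "g x \<le> (\<Sum>e\<in>unit_steps. \<omega> x e * g (x + e))" using Suc.prems(2)[of 0] by simp
  also have "\<dots> = \<omega> x ?a * g (x + ?a) + (\<Sum>e\<in>unit_steps - {?a}. \<omega> x e * g (x + e))"
    by (rule sum.remove) simp_all
  also have "(\<Sum>e\<in>unit_steps - {?a}. \<omega> x e * g (x + e)) \<le> (\<Sum>e\<in>unit_steps - {?a}. \<omega> x e * C)"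
    using Suc.prems(3)[of 0] by (intro sum_mono mult_left_mono) (auto intro: prob_vectorsD(1)[OF env])
  also have "\<dots> = (1 - \<omega> x ?a) * C"
    using prob_vectorsD(2)[OF env, of x] by (simp flip: sum_distrib_right add: sum_diff1)
  also have "\<omega> x ?a * g (x + ?a) + (1 - \<omega> x ?a) * C = C - \<omega> x ?a * (C - g (x + ?a))"
    by (simp add: algebra_simps)
  \<comment> \<open>Lowering the weight of the favourable step to \<open>\<kappa>\<close> is
    legitimate because the bracket is nonnegative, by \<open>IH\<close> and
    \<open>b\<close>.\<close>
  also have "\<dots> \<le> C - \<kappa> * (C - g (x + ?a))"
    using p IH b by (intro diff_left_mono mult_right_mono) auto
  also have "\<dots> \<le> C - \<kappa> * (C - ((1 - \<kappa> ^ m) * C + \<kappa> ^ m * D))"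
    using IH assms by (intro diff_left_mono mult_left_mono) auto
  finally show ?case by (simp add: algebra_simps)
qed

end

section \<open>A barrier on the line\<close>

text \<open>A barrier for a walk on the line that drifts to the right except in the windows
  \<open>[s * w, (s + 1) * w)\<close> with \<open>s \<in> B\<close>, where it is only known to cross the window with a tiny probability.
  A term that is constant up to the end of the window \<open>s\<close> and decays afterwards
  pays for the crossing; its weight has to dominate all the weights to the left of the window.\<close>

definition window_weight :: "int set \<Rightarrow> real \<Rightarrow> real \<Rightarrow> int \<Rightarrow> real" where
  "window_weight B d0 K s = d0 * (1 + K) ^ card {r \<in> B. r < s}"

definition barrier :: "int set \<Rightarrow> real \<Rightarrow> real \<Rightarrow> real \<Rightarrow> real \<Rightarrow> real \<Rightarrow> real" where
  "barrier B d0 K l w t = d0 * 2 powr (- t / l) +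
     (\<Sum>s\<in>B. K * window_weight B d0 K s * 2 powr (- max t ((of_int s + 1) * w) / l))"

text \<open>The weight of a window is the total collected to its left, so adding the windows from
  left to right multiplies the total by \<open>1 + K\<close> each time.\<close>

lemma sum_window_weight:
  assumes "finite (B :: int set)"
  shows "d0 + (\<Sum>s\<in>B. K * window_weight B d0 K s) = d0 * (1 + K) ^ card B"
  using assms
proof (induction B rule: finite_linorder_max_induct)
  case empty
  then show ?case by simp
next
  case (insert b A)
  have b: "b \<notin> A" using insert by auto
  have "{r \<in> insert b A. r < s} = {r \<in> A. r < s}" if "s \<in> A" for s
    using insert that by auto
  moreover have "{r \<in> insert b A. r < b} = A" using insert by auto
  ultimately have w: "window_weight (insert b A) d0 K s = window_weight A d0 K s" if "s \<in> A" for s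
    using that by (simp add: window_weight_def)
  have wb: "window_weight (insert b A) d0 K b = d0 * (1 + K) ^ card A"
    using \<open>{r \<in> insert b A. r < b} = A\<close> by (simp add: window_weight_def)
  have "d0 + (\<Sum>s\<in>insert b A. K * window_weight (insert b A) d0 K s) =
      K * (d0 * (1 + K) ^ card A) + (d0 + (\<Sum>s\<in>A. K * window_weight A d0 K s))"
    using insert b w wb by simp
  also have "\<dots> = d0 * (1 + K) ^ card (insert b A)"
    using insert b by (simp add: algebra_simps)
  finally show ?case .
qed

text \<open>This is why one window can pay for all earlier ones: its own coefficient in the barrier
  is \<open>K\<close> times the left-hand side, which collects \<open>d0\<close> and every window
  before \<open>b\<close>.\<close>

lemma sum_window_weight_below:
  assumes "finite (B :: int set)"
  shows "d0 + (\<Sum>s\<in>{r\<in>B. r < b}. K * window_weight B d0 K s) = window_weight B d0 K b"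
proof -
  have "window_weight B d0 K s = window_weight {r\<in>B. r < b} d0 K s" if "s \<in> {r\<in>B. r < b}" for s
    unfolding window_weight_def by (rule arg_cong[where f="\<lambda>A. d0 * (1 + K) ^ card A"]) (use that in auto)
  then have "(\<Sum>s\<in>{r\<in>B. r < b}. K * window_weight B d0 K s) =
      (\<Sum>s\<in>{r\<in>B. r < b}. K * window_weight {r\<in>B. r < b} d0 K s)"
    by (intro sum.cong refl) simp
  then show ?thesis using sum_window_weight[of "{r\<in>B. r < b}" d0 K] assms
    by (simp add: window_weight_def)
qed

context
  fixes B :: "int set" and d0 K l w :: real
  assumes fin: "finite B" and d0: "0 < d0" and K: "0 < K" and l: "1 \<le> l" and w: "0 < w"
begin

lemma window_weight_pos: "d0 \<le> window_weight B d0 K s" "0 < window_weight B d0 K s"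
  using d0 K by (auto simp: window_weight_def intro!: mult_pos_pos)

lemma barrier_pos: "0 < barrier B d0 K l w t"
  unfolding barrier_def using d0 K window_weight_pos(2)
  by (intro add_pos_nonneg sum_nonneg mult_nonneg_nonneg mult_pos_pos) (auto intro: less_imp_le)

lemma barrier_antimono: "t \<le> t' \<Longrightarrow> barrier B d0 K l w t' \<le> barrier B d0 K l w t"
  unfolding barrier_def using d0 K l window_weight_pos(2)
  by (intro add_mono sum_mono mult_left_mono powr_mono divide_right_mono mult_nonneg_nonneg)
     (auto intro: less_imp_le)

lemma barrier_le: "barrier B d0 K l w t \<le> 2 powr (- t / l) * (d0 * (1 + K) ^ card B)"
proof -
  have "barrier B d0 K l w t \<le> d0 * 2 powr (- t / l) + (\<Sum>s\<in>B. K * window_weight B d0 K s * 2 powr (- t / l))"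
    unfolding barrier_def using d0 K l window_weight_pos(2)
    by (intro add_mono sum_mono mult_left_mono powr_mono divide_right_mono mult_nonneg_nonneg)
       (auto intro: less_imp_le)
  also have "\<dots> = 2 powr (- t / l) * (d0 + (\<Sum>s\<in>B. K * window_weight B d0 K s))"
    by (simp add: algebra_simps sum_distrib_left)
  finally show ?thesis by (simp add: sum_window_weight[OF fin])
qed

lemma powr_shift: "2 powr (- (t + l) / l) = 2 powr (- t / l) / 2" "2 powr (- (t - l) / l) = 2 * 2 powr (- t / l)"
proof -
  have "- (t + l) / l = - t / l - 1" "- (t - l) / l = - t / l + 1" using l by (simp_all add: field_simps)
  then show "2 powr (- (t + l) / l) = 2 powr (- t / l) / 2" "2 powr (- (t - l) / l) = 2 * 2 powr (- t / l)"
    by (simp_all only: powr_diff powr_add) auto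
qed

text \<open>A shift by \<open>l\<close> to the right halves an exponential and one to the left
  doubles it, and \<open>15/16 * 1/2 + 1/16 * 2 = 19/32 < 1\<close>. Terms still flat at
  \<open>t\<close> give only a weak inequality; strictness comes from the \<open>d0\<close>
  term.\<close>

lemma barrier_drift:
  "15 / 16 * barrier B d0 K l w (t + l) + 1 / 16 * barrier B d0 K l w (t - l) < barrier B d0 K l w t"
proof -
  have mono: "2 powr (- x / l) \<le> 2 powr (- y / l)" if "y \<le> x" for x y
    using that l by (simp add: divide_right_mono)
  have drift: "15 / 16 * 2 powr (- max (t + l) e / l) + 1 / 16 * 2 powr (- max (t - l) e / l) \<le> 2 powr (- max t e / l)" for e
  proof (cases "e \<le> t")
    case True
    have 1: "2 powr (- max (t - l) e / l) \<le> 2 * 2 powr (- t / l)"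
      unfolding powr_shift(2)[symmetric] by (rule mono) simp
    have 2: "max (t + l) e = t + l" "max t e = t" using True l by auto
    show ?thesis unfolding 2 powr_shift(1) using 1 powr_ge_zero[of 2 "- t / l"] by linarith
  next
    case False
    have 1: "2 powr (- max (t + l) e / l) \<le> 2 powr (- e / l)" by (rule mono) simp
    have 2: "max (t - l) e = e" "max t e = e" using False l by auto
    show ?thesis unfolding 2 using 1 by linarith
  qed
  have "15 / 16 * (\<Sum>s\<in>B. K * window_weight B d0 K s * 2 powr (- max (t + l) ((of_int s + 1) * w) / l)) +
      1 / 16 * (\<Sum>s\<in>B. K * window_weight B d0 K s * 2 powr (- max (t - l) ((of_int s + 1) * w) / l)) =
      (\<Sum>s\<in>B. K * window_weight B d0 K s * (15 / 16 * 2 powr (- max (t + l) ((of_int s + 1) * w) / l) +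
         1 / 16 * 2 powr (- max (t - l) ((of_int s + 1) * w) / l)))"
    by (simp add: sum_distrib_left sum.distrib algebra_simps)
  also have "\<dots> \<le> (\<Sum>s\<in>B. K * window_weight B d0 K s * 2 powr (- max t ((of_int s + 1) * w) / l))"
    using K window_weight_pos(2) by (intro sum_mono mult_left_mono drift) (auto intro: less_imp_le)
  moreover have "15 / 16 * (d0 * 2 powr (- (t + l) / l)) + 1 / 16 * (d0 * 2 powr (- (t - l) / l)) < d0 * 2 powr (- t / l)"
    using d0 unfolding powr_shift by (simp add: field_simps)
  ultimately show ?thesis unfolding barrier_def by (simp add: algebra_simps)
qed

text \<open>With \<open>D\<close> the weight of window \<open>s\<close> and
  \<open>u = 2 powr (- t / l)\<close>: the term of \<open>s\<close> is flat up to the window's end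
  and at least halved at \<open>t'\<close>, a gain of at least \<open>2 * D * u\<close> by the
  condition on \<open>K * p\<close>, where \<open>2 powr (w / l)\<close> compares the two ends of
  the window. The term \<open>d0\<close> and the windows to the left lose at most
  \<open>D * u\<close> together, those to the right lose nothing. The remaining surplus, at least
  \<open>d0 * u\<close>, is kept in the statement to pay for lateral errors.\<close>

lemma barrier_cross_window:
  assumes s: "s \<in> B" and t: "of_int s * w \<le> t" "t < (of_int s + 1) * w"
    and p: "0 < p" "p \<le> 1" "4 * 2 powr (w / l) \<le> K * p" and t': "t + (w + l) \<le> t'"
  shows "(1 - p) * barrier B d0 K l w (t - 1) + p * barrier B d0 K l w t' + d0 * 2 powr (- t / l)
    \<le> barrier B d0 K l w t"
proof -
  define u where "u \<equiv> \<lambda>x. 2 powr (- x / l)"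
  define D where "D = window_weight B d0 K s"
  define c where "c \<equiv> \<lambda>r. K * window_weight B d0 K r"
  define e where "e \<equiv> \<lambda>r::int. (of_int r + 1) * w"
  have mono: "u x \<le> u y" if "y \<le> x" for x y
    using that l by (simp add: u_def divide_right_mono)
  have u0: "0 < u x" for x by (simp add: u_def)
  have c0: "0 \<le> c r" for r using K window_weight_pos(2)[of r] by (simp add: c_def)
  have dbl: "u (t - 1) \<le> 2 * u t"
  proof -
    have "u (t - 1) \<le> u (t - l)" using l by (intro mono) simp
    also have "u (t - l) = 2 * u t" unfolding u_def by (rule powr_shift)
    finally show ?thesis .
  qed
  define G where "G \<equiv> \<lambda>x y z. (1 - p) * u x + p * u y - u z"
  define T where "T r = c r * G (max (t - 1) (e r)) (max t' (e r)) (max t (e r))" for r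
  have H: "barrier B d0 K l w x = d0 * u x + (\<Sum>r\<in>B. c r * u (max x (e r)))" for x
    by (simp add: barrier_def u_def c_def e_def)
  have eq: "(1 - p) * barrier B d0 K l w (t - 1) + p * barrier B d0 K l w t' - barrier B d0 K l w t =
      d0 * G (t - 1) t' t + (\<Sum>r\<in>B. T r)"
    unfolding H T_def G_def by (simp add: algebra_simps sum_distrib_left sum.distrib sum_subtractf)
  have B: "B = {r\<in>B. r < s} \<union> {s} \<union> {r\<in>B. s < r}" using s by auto
  have "(\<Sum>r\<in>B. T r) =
     (\<Sum>r\<in>{r\<in>B. r < s}. T r) +
     T s +
     (\<Sum>r\<in>{r\<in>B. s < r}. T r)"
    by (subst B, subst sum.union_disjoint; (subst sum.union_disjoint)?) (use fin in auto)
  also have "(\<Sum>r\<in>{r\<in>B. s < r}. T r) \<le> 0"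
    unfolding T_def
  proof (intro sum_nonpos mult_nonneg_nonpos c0)
    fix r assume r: "r \<in> {r\<in>B. s < r}"
    then have "(of_int s + 1) * w \<le> e r" unfolding e_def using w by (intro mult_right_mono) auto
    then have "max (t - 1) (e r) = e r" "max t (e r) = e r" using t by auto
    moreover have "p * u (max t' (e r)) \<le> p * u (e r)" using p by (intro mult_left_mono mono) auto
    ultimately show "G (max (t - 1) (e r)) (max t' (e r)) (max t (e r)) \<le> 0"
      by (simp add: G_def algebra_simps)
  qed
  also have "(\<Sum>r\<in>{r\<in>B. r < s}. T r) \<le> (\<Sum>r\<in>{r\<in>B. r < s}. c r * u t)"
    unfolding T_def
  proof (intro sum_mono mult_left_mono c0)
    fix r assume r: "r \<in> {r\<in>B. r < s}"
    then have "r + 1 \<le> s" by simp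
    then have "real_of_int (r + 1) \<le> of_int s" by (simp only: of_int_le_iff)
    then have "e r \<le> of_int s * w" unfolding e_def using w by (intro mult_right_mono) auto
    then have 1: "max t (e r) = t" using t by auto
    have "u (max (t - 1) (e r)) \<le> 2 * u t" using mono[of "t - 1" "max (t - 1) (e r)"] dbl by linarith
    then have "(1 - p) * u (max (t - 1) (e r)) \<le> (1 - p) * (2 * u t)" using p by (intro mult_left_mono) auto
    moreover have "p * u (max t' (e r)) \<le> p * u t" using p t' w l by (intro mult_left_mono mono) auto
    moreover have "0 \<le> p * u t" using p u0[of t] by simp
    ultimately show "G (max (t - 1) (e r)) (max t' (e r)) (max t (e r)) \<le> u t"
      unfolding G_def 1 by (simp add: algebra_simps)
  qed
  also have "T s \<le> c s * (- (p / 2) * u (e s))"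
  proof -
    have "G (max (t - 1) (e s)) (max t' (e s)) (max t (e s)) \<le> - (p / 2) * u (e s)"
    proof -
      have "max (t - 1) (e s) = e s" "max t (e s) = e s" using t by (auto simp: e_def)
      moreover have "u (max t' (e s)) \<le> u (e s) / 2"
      proof -
        have "u (max t' (e s)) \<le> u (e s + l)" using t' t by (intro mono) (auto simp: e_def algebra_simps)
        also have "u (e s + l) = u (e s) / 2" unfolding u_def by (rule powr_shift)
        finally show ?thesis .
      qed
      then have "p * u (max t' (e s)) \<le> p * (u (e s) / 2)" using p by (intro mult_left_mono) auto
      ultimately show ?thesis by (simp add: G_def algebra_simps)
    qed
    then show ?thesis unfolding T_def by (intro mult_left_mono c0)
  qed
  also have "\<dots> \<le> - (2 * D * u t)"
  proof -
    have "u (of_int s * w) = 2 powr (w / l) * u (e s)"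
    proof -
      have "w / l + - e s / l = - (of_int s * w) / l" using l by (simp add: e_def field_simps)
      then show ?thesis unfolding u_def by (metis powr_add)
    qed
    then have "4 * u t \<le> 4 * (2 powr (w / l) * u (e s))" using mono[OF t(1)] by simp
    also have "\<dots> \<le> K * p * u (e s)" 
      using mult_right_mono[OF p(3), of "u (e s)"] u0[of "e s"] by simp
    finally have "D * (4 * u t) \<le> D * (K * p * u (e s))"
      using window_weight_pos(2)[of s] by (intro mult_left_mono) (auto simp: D_def)
    then show ?thesis by (simp add: c_def D_def algebra_simps)
  qed
  finally have "(\<Sum>r\<in>B. T r)
      \<le> (\<Sum>r\<in>{r\<in>B. r < s}. c r * u t) - 2 * D * u t"
    by simp
  moreover have "d0 * G (t - 1) t' t \<le> d0 * u t"
  proof (rule mult_left_mono)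
    have "(1 - p) * u (t - 1) \<le> (1 - p) * (2 * u t)" using p dbl by (intro mult_left_mono) auto
    moreover have "p * u t' \<le> p * u t" using p t' w l by (intro mult_left_mono mono) auto
    moreover have "0 \<le> p * u t" using p u0[of t] by simp
    ultimately show "G (t - 1) t' t \<le> u t" unfolding G_def by (simp add: algebra_simps)
  qed (use d0 in simp)
  moreover have "d0 * u t + (\<Sum>r\<in>{r\<in>B. r < s}. c r * u t) = D * u t"
    using sum_window_weight_below[OF fin, of d0 K s] unfolding c_def D_def
    by (metis distrib_right sum_distrib_right)
  moreover have "d0 * u t \<le> D * u t"
    using window_weight_pos(1)[of s] u0[of t] by (simp add: D_def)
  ultimately have "(1 - p) * barrier B d0 K l w (t - 1) + p * barrier B d0 K l w t' + d0 * u t \<le> barrier B d0 K l w t"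
    using eq by linarith
  then show ?thesis by (simp only: u_def)
qed

end

section \<open>Renormalisation in a fixed environment\<close>

text \<open>Lateral exits are controlled by runs of length
  \<open>G\<close> free of bad sites, which the walk can cross only by making many block steps without gaining level.\<close>

lemma fail_inf_renormalization:
  fixes k :: "'n::finite" and \<omega> :: "'n environment" and l w L W G :: int and A :: "'n \<Rightarrow> int \<Rightarrow> int"
  assumes env: "\<And>y. \<omega> y \<in> prob_vectors"
    and l: "1 \<le> l" "0 < w" "0 < L" "0 < W" and m: "int m = w + l" and \<kappa>: "0 < \<kappa>" "\<kappa> \<le> 1" and fin: "finite B"
    and B: "\<And>x. x \<in> slab k L W \<Longrightarrow> bad k l w \<omega> x \<Longrightarrow> x $ k div w \<in> B"
    and A: "\<And>i \<sigma>. i \<noteq> k \<Longrightarrow> \<sigma> \<in> {1, -1} \<Longrightarrow> 0 \<le> A i \<sigma> \<and> A i \<sigma> + G \<le> W - w"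
    and clean: "\<And>x i \<sigma>. x \<in> slab k L W \<Longrightarrow> bad k l w \<omega> x \<Longrightarrow> i \<noteq> k \<Longrightarrow> \<sigma> \<in> {1, -1} \<Longrightarrow>
      \<not> (A i \<sigma> \<le> \<sigma> * x $ i \<and> \<sigma> * x $ i < A i \<sigma> + G)"
    and ell: "\<And>x j. x \<in> slab k L W \<Longrightarrow> j < m \<Longrightarrow> \<kappa> \<le> \<omega> (x + of_nat j *s axis k 1) (axis k 1)"
    and q: "q = 2 * CARD('n) * 2 powr (2 * L / l) * (5 / 4) powr (- G / w)"
    and q_less: "q < 2 powr (1 - 2 * L / l)"
    and K: "K = 4 * 2 powr (w / l) / \<kappa> ^ m"
  shows "fail_inf k \<omega> L W 0 \<le> 2 powr (1 - L / l) * (1 + K) ^ card B + q"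
proof -
  \<comment> \<open>Normalised so that the barrier reaches \<open>1\<close> already at level
    \<open>- L + l\<close>: wherever it is below \<open>1\<close>, a block of half-length
    \<open>l\<close> does not cross the left face.\<close>
  define d0 :: real where "d0 = 2 powr (1 - L / l)"
  define I where "I = (UNIV - {k}) \<times> {1, -1 :: int}"
  define bar where "bar = barrier B d0 K l w"
  \<comment> \<open>One lateral barrier per side: it grows by \<open>5/4\<close> per width
    \<open>w\<close> towards the side and halves with every \<open>l\<close> levels gained. Beyond
    the clean run it is at least \<open>1\<close>; before the run it is tiny because of the length
    \<open>G\<close>.\<close>
  define Qt where "Qt = (\<lambda>(i, \<sigma>) (x :: int ^ 'n).
    2 powr (real_of_int (L - x $ k) / l) * (5 / 4 :: real) powr (real_of_int (\<sigma> * x $ i - A i \<sigma> - G) / w))"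
  define Q where "Q = (\<lambda>x. \<Sum>p\<in>I. Qt p x)"
  define h where "h = (\<lambda>x :: int ^ 'n. bar (x $ k) + Q x)"
  let ?F = "fail_inf k \<omega> L W"
  have d0: "0 < d0" by (simp add: d0_def)
  have K0: "0 < K" using \<kappa> by (simp add: K)
  have rl: "(1::real) \<le> l" "(0::real) < w" using l by simp_all
  note bar_facts = fin d0 K0 rl
  have finI: "finite I" by (simp add: I_def)
  have cardI: "card I \<le> 2 * CARD('n)"
    by (simp add: I_def card_cartesian_product)
  have Qt_pos: "0 < Qt p x" for p x by (cases p) (simp add: Qt_def)
  have Q_nonneg: "0 \<le> Q x" for x unfolding Q_def using Qt_pos by (intro sum_nonneg) (auto intro: less_imp_le)
  have Qt_le_Q: "Qt p x \<le> Q x" if "p \<in> I" for p x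
    unfolding Q_def using that finI Qt_pos by (intro member_le_sum) (auto intro: less_imp_le)
  have Q_le_q: "Q y \<le> q" if "- L \<le> y $ k" and "\<And>i \<sigma>. (i, \<sigma>) \<in> I \<Longrightarrow> \<sigma> * y $ i \<le> A i \<sigma>" for y
  proof -
    have "Q y \<le> (\<Sum>p\<in>I. 2 powr (2 * L / l) * (5 / 4) powr (- G / w))"
      unfolding Q_def
    proof (rule sum_mono)
      fix p assume p: "p \<in> I"
      obtain i \<sigma> where pi: "p = (i, \<sigma>)" by (cases p)
      have "L - y $ k \<le> 2 * L" "\<sigma> * y $ i - A i \<sigma> - G \<le> - G"
        using that(1) that(2)[of i \<sigma>] p pi by simp_all
      then have "real_of_int (L - y $ k) \<le> real_of_int (2 * L)"
        "real_of_int (\<sigma> * y $ i - A i \<sigma> - G) \<le> real_of_int (- G)"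
        by (simp_all only: of_int_le_iff)
      then show "Qt p y \<le> 2 powr (2 * L / l) * (5 / 4) powr (- G / w)"
        unfolding pi Qt_def prod.case using rl
        by (intro mult_mono powr_mono divide_right_mono) auto
    qed
    also have "\<dots> = card I * (2 powr (2 * L / l) * (5 / 4) powr (- G / w))" by simp
    also have "\<dots> \<le> (2 * CARD('n)) * (2 powr (2 * L / l) * (5 / 4) powr (- G / w))"
      using cardI by (intro mult_right_mono) (simp_all flip: of_nat_mult)
    finally show ?thesis by (simp add: q mult.assoc)
  qed
  have h_pos: "0 < h x" for x
    unfolding h_def bar_def using barrier_pos[OF bar_facts] Q_nonneg by (intro add_pos_nonneg)
  have bar_ge: "1 \<le> bar t" if "t \<le> - L + l" for t :: real
  proof -
    have "(1::real) = 2 powr 0" by simp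
    also have "\<dots> \<le> 2 powr (1 - L / l + - t / l)"
    proof (rule powr_mono)
      have "1 - L / l + - t / l = (l - L - t) / l" using rl by (simp add: field_simps)
      also have "0 \<le> \<dots>" using that rl by (intro divide_nonneg_nonneg) auto
      finally show "0 \<le> 1 - L / l + - t / l" .
    qed simp
    also have "\<dots> = d0 * 2 powr (- t / l)" by (simp only: powr_add d0_def)
    also have "\<dots> \<le> bar t"
      unfolding bar_def barrier_def using K0 window_weight_pos(2)[OF bar_facts]
      by (simp add: sum_nonneg less_imp_le)
    finally show ?thesis .
  qed
  have Q_ge: "1 \<le> Q x" if "x $ k \<le> L" "(i, \<sigma>) \<in> I" "A i \<sigma> + G \<le> \<sigma> * x $ i" for x i \<sigma>
  proof -
    have "0 \<le> real_of_int (L - x $ k)" "0 \<le> real_of_int (\<sigma> * x $ i - A i \<sigma> - G)"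
      using that by (simp_all only: of_int_0_le_iff)
    then have "2 powr 0 * (5 / 4) powr 0 \<le> Qt (i, \<sigma>) x"
      unfolding Qt_def prod.case using rl
      by (intro mult_mono powr_mono divide_nonneg_nonneg) (simp_all del: of_int_diff of_int_mult)
    then show ?thesis using Qt_le_Q[OF that(2), of x] by simp
  qed
  \<comment> \<open>Where \<open>h\<close> is below \<open>1\<close>, the whole block around the
    point fits into the slab, except possibly across the right face. The reserve
    \<open>W - w\<close> in the hypothesis on \<open>A\<close> serves this purpose.\<close>
  have h_lessD: "- L + l < x $ k" "\<And>i \<sigma>. (i, \<sigma>) \<in> I \<Longrightarrow> \<sigma> * x $ i < A i \<sigma> + G" "\<And>i. i \<noteq> k \<Longrightarrow> \<bar>x $ i\<bar> < W - w"
    if "h x < 1" "x \<in> slab k L W" for x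
  proof -
    have "0 < bar (x $ k)" unfolding bar_def by (rule barrier_pos[OF bar_facts])
    have "\<not> real_of_int (x $ k) \<le> - L + l"
      using bar_ge[of "x $ k"] that Q_nonneg[of x] by (auto simp: h_def)
    then show "- L + l < x $ k" by linarith
    show 2: "\<sigma> * x $ i < A i \<sigma> + G" if "(i, \<sigma>) \<in> I" for i \<sigma>
      using Q_ge[of x i \<sigma>] \<open>h x < 1\<close> \<open>x \<in> slab k L W\<close> that \<open>0 < bar (x $ k)\<close>
      by (force simp: h_def slab_def)
    show "\<bar>x $ i\<bar> < W - w" if "i \<noteq> k" for i
      using 2[of i 1] 2[of i "-1"] A[of i 1] A[of i "-1"] that by (auto simp: I_def)
  qed
  have "?F 0 \<le> h 0"
  proof (rule fail_inf_le_barrier[OF env h_pos])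
    fix x assume x: "x $ k < L" "x \<notin> slab k L W"
    show "1 \<le> h x"
    proof (cases "x $ k \<le> - L")
      case True
      then have "real_of_int (x $ k) \<le> - L + l" using l by linarith
      then show ?thesis using bar_ge Q_nonneg[of x] by (simp add: h_def add_increasing2)
    next
      case False
      then obtain i where i: "i \<noteq> k" "W \<le> \<bar>x $ i\<bar>" using x by (auto simp: slab_def not_less)
      define \<sigma> :: int where "\<sigma> = (if 0 \<le> x $ i then 1 else - 1)"
      have "(i, \<sigma>) \<in> I" "\<sigma> \<in> {1, -1}" "\<sigma> * x $ i = \<bar>x $ i\<bar>" using i by (auto simp: I_def \<sigma>_def)
      then have "1 \<le> Q x" using Q_ge[of x i \<sigma>] A[OF i(1), of \<sigma>] x i l by linarith
      then show ?thesis using barrier_pos[OF bar_facts, of "x $ k"] by (simp add: h_def bar_def)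
    qed
  next
    fix x S assume x: "x \<in> slab k L W" "h x < 1" and S: "(1::real) \<le> S" and le: "\<And>y. ?F y \<le> S * h y"
    let ?t = "real_of_int (x $ k)"
    note xD = h_lessD[OF x(2,1)]
    have tL: "x $ k < L" using x(1) by (auto simp: slab_def)
    have near: "y \<in> slab k L W \<or> L \<le> y $ k" if "- L < y $ k" "\<And>i. i \<noteq> k \<Longrightarrow> \<bar>y $ i\<bar> < W" for y
      using that by (auto simp: slab_def)
    show "?F x < S * h x"
    proof (cases "bad k l w \<omega> x")
      case False
      \<comment> \<open>The lateral factors are \<open>1/2 * 5/4\<close> on the right face of the
        block and at most \<open>2 * 5/4\<close> elsewhere.\<close>
      let ?hA = "bar (?t + l) + 5 / 8 * Q x" and ?hC = "bar (?t - l) + 5 / 2 * Q x"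
      have Qy: "Q y \<le> 2 powr (real_of_int (x $ k - y $ k) / l) * (5 / 4) * Q x"
        if dist: "\<And>i. i \<noteq> k \<Longrightarrow> \<bar>y $ i - x $ i\<bar> \<le> w" for y
      proof -
        have "Qt p y \<le> 2 powr (real_of_int (x $ k - y $ k) / l) * (5 / 4) * Qt p x" if p: "p \<in> I" for p
        proof -
          obtain i \<sigma> where pi: "p = (i, \<sigma>)" by (cases p)
          have *: "i \<noteq> k" "\<sigma> \<in> {1, -1}" using p pi by (auto simp: I_def)
          let ?r = "\<lambda>x. real_of_int (\<sigma> * x $ i - A i \<sigma> - G)" and ?z = "2 powr (real_of_int (x $ k - y $ k) / l)"
          have "\<sigma> * (y $ i - x $ i) \<le> w" using dist[OF *(1)] *(2) by auto
          then have "?r y \<le> real_of_int (\<sigma> * x $ i - A i \<sigma> - G + w)"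
            by (simp add: algebra_simps del: of_int_mult of_int_diff of_int_add)
          then have "(5 / 4 :: real) powr (?r y / w) \<le>
              (5 / 4) powr (real_of_int (\<sigma> * x $ i - A i \<sigma> - G + w) / w)"
            using rl by (intro powr_mono divide_right_mono) auto
          also have "real_of_int (\<sigma> * x $ i - A i \<sigma> - G + w) / w = ?r x / w + 1"
            using rl by (simp add: field_simps)
          also have "(5 / 4 :: real) powr \<dots> = (5 / 4) * (5 / 4) powr (?r x / w)"
            by (simp only: powr_add) simp
          finally have 1: "(5 / 4 :: real) powr (?r y / w) \<le>
              (5 / 4) * (5 / 4) powr (?r x / w)" .
          have "real_of_int (L - y $ k) / l = real_of_int (x $ k - y $ k) / l + real_of_int (L - x $ k) / l"
            using rl by (simp add: field_simps)
          then have 2: "2 powr (real_of_int (L - y $ k) / l) =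
              ?z * 2 powr (real_of_int (L - x $ k) / l)"
            by (simp only: powr_add)
          show ?thesis
            unfolding pi Qt_def prod.case 2
            using mult_left_mono[OF 1, of "?z * 2 powr (real_of_int (L - x $ k) / l)"]
            by (simp add: mult_ac)
        qed
        then show ?thesis unfolding Q_def sum_distrib_left by (intro sum_mono)
      qed
      have "?F x \<le> 15 / 16 * (S * ?hA) + 1 / 16 * (S * ?hC)"
      proof (rule good_block_le[OF env False])
        show "0 < l" "0 < w" using l by auto
        fix y assume y: "y - x \<in> slab k l w"
        have "- L < y $ k" using y xD(1) by (auto simp: slab_def)
        moreover have "\<bar>y $ i\<bar> < W" if "i \<noteq> k" for i
        proof -
          have "\<bar>y $ i - x $ i\<bar> < w" using y that by (simp add: slab_def)
          then show ?thesis using xD(3)[OF that] by linarith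
        qed
        ultimately show "?F y \<le> (\<Sum>e\<in>unit_steps. \<omega> y e * ?F (y + e))"
          by (intro fail_inf_subharmonic[OF env] near)
      next
        fix y :: "int ^ 'n" assume y: "y $ k = x $ k + l" "\<And>i. i \<noteq> k \<Longrightarrow> \<bar>y $ i - x $ i\<bar> \<le> w"
        have half: "2 powr (real_of_int (x $ k - y $ k) / l) = 1 / 2"
          using y(1) rl by (simp add: powr_minus_divide)
        have "Q y \<le> 5 / 8 * Q x" using Qy[OF y(2)] unfolding half by simp
        then have "h y \<le> ?hA" using y(1) by (simp add: h_def)
        then show "?F y \<le> S * ?hA" using le[of y] S by (meson mult_left_mono order_trans zero_le_one)
      next
        fix y :: "int ^ 'n" assume y: "\<bar>y $ k - x $ k\<bar> \<le> l" "\<And>i. i \<noteq> k \<Longrightarrow> \<bar>y $ i - x $ i\<bar> \<le> w"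
        have "real_of_int (x $ k - y $ k) \<le> l" using y(1) by linarith
        then have "2 powr (real_of_int (x $ k - y $ k) / l) \<le> 2 powr 1"
          using rl by (intro powr_mono) (simp_all add: divide_le_eq)
        then have "2 powr (real_of_int (x $ k - y $ k) / l) * (5 / 4) * Q x \<le> 2 * (5 / 4) * Q x"
          using Q_nonneg[of x] by (intro mult_right_mono) auto
        then have "Q y \<le> 5 / 2 * Q x" using Qy[OF y(2)] by linarith
        moreover have "bar (y $ k) \<le> bar (?t - l)"
          unfolding bar_def by (rule barrier_antimono[OF bar_facts]) (use y(1) in linarith)
        ultimately have "h y \<le> ?hC" by (simp add: h_def)
        then show "?F y \<le> S * ?hC" using le[of y] S by (meson mult_left_mono order_trans zero_le_one)
      next
        have "bar (?t + l) \<le> bar (?t - l)"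
          unfolding bar_def by (rule barrier_antimono[OF bar_facts]) (use rl in linarith)
        then show "S * ?hA \<le> S * ?hC" using S Q_nonneg[of x] by (intro mult_left_mono) auto
      qed
      also have "\<dots> = S * (15 / 16 * ?hA + 1 / 16 * ?hC)" by (simp add: algebra_simps)
      also have "\<dots> < S * h x"
      proof (rule mult_strict_left_mono)
        have "15 / 16 * bar (?t + l) + 1 / 16 * bar (?t - l) < bar ?t"
          unfolding bar_def by (rule barrier_drift[OF bar_facts])
        \<comment> \<open>For the lateral part,
          \<open>15/16 * 5/8 + 1/16 * 5/2 = 95/128 < 1\<close>.\<close>
        then show "15 / 16 * ?hA + 1 / 16 * ?hC < h x"
          using Q_nonneg[of x] by (simp add: h_def algebra_simps)
      qed (use S in simp)
      finally show ?thesis .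
    next
      case True
      \<comment> \<open>A bad site avoids all clean runs, and \<open>h x < 1\<close> keeps it short
        of their far ends; hence it lies before each of them.\<close>
      have below: "\<sigma> * x $ i < A i \<sigma>" if "(i, \<sigma>) \<in> I" for i \<sigma>
        using clean[OF x(1) True, of i \<sigma>] xD(2)[OF that] that by (auto simp: I_def)
      let ?a = "axis k 1 :: int ^ 'n"
      have ak: "(x + of_nat j *s ?a) $ k = x $ k + int j" for j by (simp add: axis_def)
      have ai: "(x + of_nat j *s ?a) $ i = x $ i" if "i \<noteq> k" for i j using that by (simp add: axis_def)
      \<comment> \<open>Level \<open>?t - 1\<close> appears because a deviating step may go back by
        one. Laterally the path and its neighbours do not get past the beginning of any run, so
        \<open>Q\<close> is replaced by \<open>q\<close> throughout.\<close>
      let ?C = "S * (bar (?t - 1) + q)" and ?D = "S * (bar (?t + m) + q)"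
      have q0: "0 \<le> q" by (simp add: q)
      have "?F x \<le> (1 - \<kappa> ^ m) * ?C + \<kappa> ^ m * ?D"
      proof (rule straight_path_le[OF env \<kappa>])
        fix j assume "j < m"
        then show "\<kappa> \<le> \<omega> (x + of_nat j *s ?a) ?a" by (rule ell[OF x(1)])
        have "x + of_nat j *s ?a \<in> slab k L W \<or> L \<le> (x + of_nat j *s ?a) $ k"
        proof (rule near)
          show "- L < (x + of_nat j *s ?a) $ k" using xD(1) l unfolding ak by linarith
          show "\<bar>(x + of_nat j *s ?a) $ i\<bar> < W" if "i \<noteq> k" for i
            using x(1) that unfolding ai[OF that] by (simp add: slab_def)
        qed
        then show "?F (x + of_nat j *s ?a) \<le> (\<Sum>e\<in>unit_steps. \<omega> (x + of_nat j *s ?a) e * ?F (x + of_nat j *s ?a + e))"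
          by (rule fail_inf_subharmonic[OF env])
      next
        fix j e assume j: "j < m" and e: "e \<in> (unit_steps :: (int ^ 'n) set)"
        let ?y = "x + of_nat j *s ?a + e"
        have yk: "x $ k - 1 \<le> ?y $ k"
          using unit_steps_abs_le[OF e, of k] ak[of j] by simp
        have "Q ?y \<le> q"
        proof (rule Q_le_q)
          show "- L \<le> ?y $ k" using yk xD(1) l by linarith
          fix i \<sigma> assume i: "(i, \<sigma>) \<in> I"
          then have "i \<noteq> k" "\<sigma> \<in> {1, -1}" by (auto simp: I_def)
          then have "\<sigma> * ?y $ i \<le> \<sigma> * x $ i + 1"
            using ai[of i j] unit_steps_abs_le[OF e, of i] by auto
          then show "\<sigma> * ?y $ i \<le> A i \<sigma>" using below[OF i] by linarith
        qed
        moreover have "bar (?y $ k) \<le> bar (?t - 1)"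
          unfolding bar_def by (rule barrier_antimono[OF bar_facts]) (use yk in linarith)
        ultimately have "h ?y \<le> bar (?t - 1) + q" by (simp add: h_def)
        then show "?F ?y \<le> ?C" using le[of ?y] S by (meson mult_left_mono order_trans zero_le_one)
      next
        let ?y = "x + of_nat m *s ?a"
        have "Q ?y \<le> q"
        proof (rule Q_le_q)
          show "- L \<le> ?y $ k" using xD(1) l unfolding ak by linarith
          fix i \<sigma> assume i: "(i, \<sigma>) \<in> I"
          then have ik: "i \<noteq> k" by (auto simp: I_def)
          show "\<sigma> * ?y $ i \<le> A i \<sigma>" unfolding ai[OF ik] using below[OF i] by simp
        qed
        then have "h ?y \<le> bar (?t + m) + q" unfolding h_def ak by simp
        then show "?F ?y \<le> ?D" using le[of ?y] S by (meson mult_left_mono order_trans zero_le_one)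
      next
        have "bar (?t + m) \<le> bar (?t - 1)"
          unfolding bar_def by (rule barrier_antimono[OF bar_facts]) simp
        then show "?D \<le> ?C" using S by (intro mult_left_mono) auto
      qed
      also have "\<dots> = S * ((1 - \<kappa> ^ m) * bar (?t - 1) + \<kappa> ^ m * bar (?t + m) + q)"
        by (simp add: algebra_simps)
      also have "\<dots> < S * h x"
      proof (rule mult_strict_left_mono)
        have "(1 - \<kappa> ^ m) * bar (?t - 1) + \<kappa> ^ m * bar (?t + m) + d0 * 2 powr (- ?t / l) \<le> bar ?t"
          unfolding bar_def
        proof (rule barrier_cross_window[OF bar_facts, of "x $ k div w"])
          show "x $ k div w \<in> B" by (rule B[OF x(1) True])
          have "(x $ k div w) * w \<le> x $ k" "x $ k < (x $ k div w + 1) * w"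
            using div_mult_mod_eq[of "x $ k" w] pos_mod_bound[OF l(2), of "x $ k"] pos_mod_sign[OF l(2), of "x $ k"]
            unfolding distrib_right by linarith+
          then have "real_of_int ((x $ k div w) * w) \<le> ?t" "?t < real_of_int ((x $ k div w + 1) * w)"
            by (simp_all only: of_int_le_iff of_int_less_iff)
          then show "real_of_int (x $ k div w) * w \<le> ?t" "?t < (real_of_int (x $ k div w) + 1) * w" by simp_all
          show "0 < \<kappa> ^ m" "\<kappa> ^ m \<le> 1" using \<kappa> by (auto intro: power_le_one)
          then show "4 * 2 powr (real_of_int w / l) \<le> K * \<kappa> ^ m" using \<kappa> by (simp add: K)
          have "real_of_int (int m) = w + l" unfolding m by simp
          then show "?t + (real_of_int w + l) \<le> ?t + m" by simp
        qed
        \<comment> \<open>The surplus left by \<open>barrier_cross_window\<close> is smallest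
          towards the right face, and \<open>q_less\<close> lets it absorb \<open>q\<close> even
          there.\<close>
        moreover have "q < d0 * 2 powr (- ?t / l)"
        proof -
          note q_less
          also have "2 powr (1 - 2 * L / l) = d0 * 2 powr (- real_of_int L / l)"
            by (simp add: d0_def flip: powr_add)
          also have "\<dots> \<le> d0 * 2 powr (- ?t / l)"
            using tL rl d0 by (intro mult_left_mono powr_mono divide_right_mono) auto
          finally show ?thesis .
        qed
        ultimately show "(1 - \<kappa> ^ m) * bar (?t - 1) + \<kappa> ^ m * bar (?t + m) + q < h x"
          using Q_nonneg[of x] by (simp add: h_def)
      qed (use S in simp)
      finally show ?thesis .
    qed
  qed
  also have "h 0 \<le> d0 * (1 + K) ^ card B + q"
  proof -
    have "bar 0 \<le> d0 * (1 + K) ^ card B"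
      using barrier_le[OF bar_facts, of 0] by (simp add: bar_def)
    moreover have "Q 0 \<le> q"
      by (rule Q_le_q) (use A l in \<open>auto simp: I_def\<close>)
    ultimately show ?thesis by (simp add: h_def)
  qed
  finally show ?thesis by (simp add: d0_def)
qed

section \<open>Independent and identically distributed environments\<close>

lemma fail_cong:
  assumes "\<And>y. y \<in> slab k l w \<Longrightarrow> \<omega> y = \<omega>' y"
  shows "fail k l w \<omega> N x = fail k l w \<omega>' N x"
  using assms by (induction N arbitrary: x) auto

lemma bad_cong:
  assumes "\<And>y. y - x \<in> slab k l w \<Longrightarrow> \<omega> y = \<omega>' y"
  shows "bad k l w \<omega> x = bad k l w \<omega>' x"
proof -
  have "fail k l w (env_shift x \<omega>) N 0 = fail k l w (env_shift x \<omega>') N 0" for N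
    by (rule fail_cong) (auto simp: env_shift_def intro!: assms)
  then show ?thesis by (simp add: bad_def)
qed

lemma measurable_fail: "(\<lambda>\<omega>. fail k l w \<omega> N x) \<in> borel_measurable env_algebra"
proof (induction N arbitrary: x)
  case (Suc N)
  show ?case
    unfolding fail.simps
    by (intro measurable_If borel_measurable_const borel_measurable_sum borel_measurable_times Suc measurable_site) auto
qed simp

lemma measurable_env_shift: "env_shift c \<in> measurable env_algebra env_algebra"
  unfolding env_shift_def[abs_def] env_algebra_def
  by (rule measurable_PiM_single') (auto simp: space_PiM)

lemma measurable_bad: "{\<omega> \<in> space env_algebra. bad k l w \<omega> x} \<in> sets env_algebra"
proof -
  have "(\<lambda>\<omega>. fail k l w (env_shift x \<omega>) N 0) \<in> borel_measurable env_algebra" for N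
    by (rule measurable_compose[OF measurable_env_shift measurable_fail])
  then show ?thesis unfolding bad_def by measurable
qed

section \<open>Bad sites with disjoint blocks: selection, independence, union bound\<close>

definition separated :: "'n \<Rightarrow> int \<Rightarrow> int \<Rightarrow> (int ^ 'n) set \<Rightarrow> bool" where
  "separated k l w X \<longleftrightarrow> (\<forall>x\<in>X. \<forall>x'\<in>X. x \<noteq> x' \<longrightarrow> (\<forall>y. \<not> (y - x \<in> slab k l w \<and> y - x' \<in> slab k l w)))"

lemma residue_class_subset:
  assumes "finite (B :: int set)" "3 * r < card B"
  obtains T where "T \<subseteq> B" "card T = Suc r" "\<And>s t. s \<in> T \<Longrightarrow> t \<in> T \<Longrightarrow> s \<noteq> t \<Longrightarrow> 3 \<le> \<bar>s - t\<bar>"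
proof -
  define C where "C j = {b \<in> B. b mod 3 = j}" for j :: int
  have "B = C 0 \<union> C 1 \<union> C 2" by (auto simp: C_def)
  then have "card B \<le> card (C 0) + card (C 1) + card (C 2)"
    using card_Un_le[of "C 0 \<union> C 1" "C 2"] card_Un_le[of "C 0" "C 1"] by simp
  then have "Suc r \<le> card (C 0) \<or> Suc r \<le> card (C 1) \<or> Suc r \<le> card (C 2)" using assms(2) by linarith
  then obtain j where j: "Suc r \<le> card (C j)" by blast
  then obtain T where T: "T \<subseteq> C j" "card T = Suc r" by (meson obtain_subset_with_card_n)
  have "3 \<le> \<bar>s - t\<bar>" if "s \<in> T" "t \<in> T" "s \<noteq> t" for s t
  proof -
    have "s mod 3 = j" "t mod 3 = j" using T that by (auto simp: C_def)
    then have "3 dvd (s - t)" by (metis mod_eq_dvd_iff)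
    then show ?thesis using that(3) zdvd_imp_le[of 3 "\<bar>s - t\<bar>"] by simp
  qed
  then show thesis using T that[of T] by (auto simp: C_def)
qed

text \<open>Bad sites in distinct windows of one residue class modulo 3 have disjoint blocks.\<close>

lemma separated_from_windows:
  fixes k i :: "'n::finite" and \<sigma> :: int
  assumes w: "0 < w" "l \<le> w" and \<sigma>: "\<sigma> \<in> {1, -1}" and Y: "finite Y"
    and many: "3 * r < card ((\<lambda>x. \<sigma> * x $ i div w) ` Y)"
  obtains X where "X \<subseteq> Y" "card X = Suc r" "separated k l w X"
proof -
  let ?f = "\<lambda>x :: int ^ 'n. \<sigma> * x $ i div w"
  obtain T where T: "T \<subseteq> ?f ` Y" "card T = Suc r" "\<And>s t. s \<in> T \<Longrightarrow> t \<in> T \<Longrightarrow> s \<noteq> t \<Longrightarrow> 3 \<le> \<bar>s - t\<bar>"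
    using residue_class_subset[OF _ many] Y by blast
  define X where "X = inv_into Y ?f ` T"
  have inj: "inj_on (inv_into Y ?f) T" using T(1) by (rule inj_on_inv_into)
  have "separated k l w X"
    unfolding separated_def
  proof (intro ballI impI allI notI)
    fix x x' y assume x: "x \<in> X" "x' \<in> X" "x \<noteq> x'" and y: "y - x \<in> slab k l w \<and> y - x' \<in> slab k l w"
    have f: "?f x \<in> T" "?f x' \<in> T" "?f x \<noteq> ?f x'"
    proof -
      obtain t t' where t: "t \<in> T" "x = inv_into Y ?f t" "t' \<in> T" "x' = inv_into Y ?f t'"
        using x by (auto simp: X_def)
      then have "?f x = t" "?f x' = t'" using T(1) f_inv_into_f[of t ?f Y] f_inv_into_f[of t' ?f Y] by auto
      then show "?f x \<in> T" "?f x' \<in> T" "?f x \<noteq> ?f x'" using t x(3) by auto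
    qed
    have "\<bar>(y - x) $ i\<bar> < w" "\<bar>(y - x') $ i\<bar> < w" using y w by (cases "i = k"; force simp: slab_def)+
    then have d: "\<bar>\<sigma> * x $ i - \<sigma> * x' $ i\<bar> < 2 * w" using \<sigma> by auto
    \<comment> \<open>Sites whose blocks meet are less than \<open>2 * w\<close> apart in every
      coordinate, along \<open>k\<close> because \<open>l \<le> w\<close>; so their window indices
      differ by at most two.\<close>
    have *: "b - a < 2 * w \<Longrightarrow> b div w - a div w < 3" for a b :: int
    proof (rule ccontr)
      assume ab: "b - a < 2 * w" "\<not> b div w - a div w < 3"
      then have "3 * w \<le> (b div w - a div w) * w" using w by (intro mult_right_mono) auto
      also have "\<dots> = b - b mod w - (a - a mod w)" by (simp add: minus_mod_eq_div_mult left_diff_distrib)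
      finally show False using ab w pos_mod_bound[of w a] pos_mod_sign[of w b] by linarith
    qed
    then have "\<bar>?f x - ?f x'\<bar> < 3"
      using *[of "\<sigma> * x $ i" "\<sigma> * x' $ i"] *[of "\<sigma> * x' $ i" "\<sigma> * x $ i"] d by linarith
    then show False using T(3)[OF f] by linarith
  qed
  moreover have "card X = Suc r" using inj T(2) by (simp add: X_def card_image)
  moreover have "X \<subseteq> Y" using T(1) by (auto simp: X_def intro: inv_into_into)
  ultimately show thesis using that by blast
qed

locale iid_environment =
  fixes \<mu> :: "(int ^ 'n::finite \<Rightarrow> real) measure"
  assumes prob_site: "prob_space \<mu>" and sets_site: "sets \<mu> = sets site_algebra"
begin

definition env_law :: "'n environment measure" where
  "env_law = PiM UNIV (\<lambda>_. \<mu>)"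

abbreviation bad_event :: "'n \<Rightarrow> int \<Rightarrow> int \<Rightarrow> int ^ 'n \<Rightarrow> 'n environment set" where
  "bad_event k l w x \<equiv> {\<omega> \<in> space env_law. bad k l w \<omega> x}"

lemma sets_env_law [measurable_cong]: "sets env_law = sets env_algebra"
  unfolding env_law_def env_algebra_def by (rule sets_PiM_cong) (simp_all add: sets_site)

lemma space_env_law: "space env_law = {\<omega>. \<forall>y. \<omega> y \<in> prob_vectors}"
  using sets_eq_imp_space_eq[OF sets_env_law] by (simp add: space_env)

lemma space_env_lawD: "\<omega> \<in> space env_law \<Longrightarrow> \<omega> y \<in> prob_vectors"
  by (simp add: space_env_law)

lemma measurable_env_law: "f \<in> measurable env_algebra M \<Longrightarrow> f \<in> measurable env_law M"
  using measurable_cong_sets[OF sets_env_law refl] by blast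

sublocale env: prob_space env_law
  unfolding env_law_def by (rule prob_space_PiM) (rule prob_site)

lemma distr_env_law_component: "distr env_law \<mu> (\<lambda>\<omega>. \<omega> x) = \<mu>"
proof -
  interpret product_prob_space "\<lambda>_ :: int ^ 'n. \<mu>" UNIV
    by (intro product_prob_spaceI prob_site)
  show ?thesis unfolding env_law_def by (rule PiM_component) simp
qed

lemma measurable_component_site: "(\<lambda>\<omega>. \<omega> x) \<in> measurable env_law \<mu>"
  unfolding env_law_def by (rule measurable_component_singleton) simp

lemma distr_env_law_shift: "distr env_law env_law (env_shift c) = env_law"
proof -
  have "distr (PiM UNIV (\<lambda>_. \<mu>)) (\<Pi>\<^sub>M i\<in>UNIV. \<mu>) (\<lambda>\<omega>. \<lambda>n\<in>UNIV. \<omega> (n + c)) = (\<Pi>\<^sub>M i\<in>UNIV. \<mu>)"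
    by (rule distr_PiM_reindex[of UNIV "\<lambda>_. \<mu>" "\<lambda>n. n + c" UNIV]) (auto intro: prob_site)
  then show ?thesis by (simp add: env_law_def env_shift_def[abs_def] restrict_UNIV)
qed

lemma prob_bad_shift:
  "env.prob (bad_event k l w x) = env.prob (bad_event k l w 0)"
proof -
  have m: "env_shift x \<in> measurable env_law env_law"
    using measurable_env_shift measurable_cong_sets[OF sets_env_law sets_env_law] by blast
  have b: "bad_event k l w 0 \<in> sets env_law"
    using measurable_bad[of k l w 0] by (simp add: sets_env_law sets_eq_imp_space_eq[OF sets_env_law])
  have s: "env_shift 0 \<omega> = \<omega>" for \<omega> :: "'n environment" by (simp add: env_shift_def[abs_def])
  have "env_shift x -` bad_event k l w 0 \<inter> space env_law = bad_event k l w x"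
    using measurable_space[OF m] by (auto simp: bad_def s)
  then show ?thesis
    using measure_distr[OF m b] by (simp add: distr_env_law_shift)
qed

lemma indep_vars_sites: "env.indep_vars (\<lambda>_. \<mu>) (\<lambda>x \<omega>. \<omega> x) UNIV"
proof (subst env.indep_vars_iff_distr_eq_PiM')
  show "distr env_law (PiM UNIV (\<lambda>_. \<mu>)) (\<lambda>\<omega>. \<lambda>i\<in>UNIV. \<omega> i) = (\<Pi>\<^sub>M i\<in>UNIV. distr env_law \<mu> (\<lambda>\<omega>. \<omega> i))"
    unfolding distr_env_law_component using distr_id[of env_law] by (simp add: env_law_def restrict_UNIV)
qed (auto intro: measurable_component_site)

text \<open>Reduces to independence of the restrictions to the disjoint regions. Completing a
  configuration on \<open>D s\<close> by a fixed environment outside turns the local function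
  \<open>f s\<close> into a measurable function of its restriction, without changing its
  value.\<close>

lemma nn_integral_prod_local:
  fixes f :: "'s \<Rightarrow> 'n environment \<Rightarrow> ennreal"
  assumes S: "finite S" and D: "disjoint_family_on D S"
    and f: "\<And>s. s \<in> S \<Longrightarrow> f s \<in> borel_measurable env_law"
    and loc: "\<And>s \<omega> \<omega>'. s \<in> S \<Longrightarrow> (\<And>y. y \<in> D s \<Longrightarrow> \<omega> y = \<omega>' y) \<Longrightarrow> f s \<omega> = f s \<omega>'"
  shows "(\<integral>\<^sup>+\<omega>. (\<Prod>s\<in>S. f s \<omega>) \<partial>env_law) = (\<Prod>s\<in>S. \<integral>\<^sup>+\<omega>. f s \<omega> \<partial>env_law)"
proof -
  obtain c where c: "c \<in> space env_law" using env.not_empty by blast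
  define ext where "ext = (\<lambda>s \<eta> y. if y \<in> D s then \<eta> y else c y)"
  have ind: "env.indep_vars (\<lambda>s. PiM (D s) (\<lambda>_. \<mu>)) (\<lambda>s \<omega>. restrict (\<lambda>i. \<omega> i) (D s)) S"
    by (rule env.indep_vars_restrict[OF indep_vars_sites _ D]) simp
  have ext: "ext s \<in> measurable (PiM (D s) (\<lambda>_. \<mu>)) env_law" for s
    unfolding env_law_def
  proof (rule measurable_PiM_single')
    show "(\<lambda>\<eta>. ext s \<eta> y) \<in> measurable (PiM (D s) (\<lambda>_. \<mu>)) \<mu>" for y
      using c by (cases "y \<in> D s") (auto simp: ext_def env_law_def space_PiM dest: PiE_mem intro!: measurable_component_singleton measurable_const)
    show "ext s \<in> space (PiM (D s) (\<lambda>_. \<mu>)) \<rightarrow> (\<Pi>\<^sub>E i\<in>UNIV. space \<mu>)"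
      using c by (auto simp: ext_def space_PiM env_law_def PiE_iff)
  qed
  have eq: "f s (ext s (restrict (\<lambda>i. \<omega> i) (D s))) = f s \<omega>" if "s \<in> S" for s \<omega>
    by (rule loc[OF that]) (simp add: ext_def)
  have "env.indep_vars (\<lambda>_. borel) (\<lambda>s \<omega>. f s (ext s (restrict (\<lambda>i. \<omega> i) (D s)))) S"
    by (rule env.indep_vars_compose2[OF ind]) (rule measurable_compose[OF ext f])
  from env.indep_vars_nn_integral[OF S this]
  have "(\<integral>\<^sup>+\<omega>. (\<Prod>s\<in>S. f s (ext s (restrict (\<lambda>i. \<omega> i) (D s)))) \<partial>env_law) =
     (\<Prod>s\<in>S. \<integral>\<^sup>+\<omega>. f s (ext s (restrict (\<lambda>i. \<omega> i) (D s))) \<partial>env_law)" by simp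
  also have "(\<Prod>s\<in>S. \<integral>\<^sup>+\<omega>. f s (ext s (restrict (\<lambda>i. \<omega> i) (D s))) \<partial>env_law) = (\<Prod>s\<in>S. \<integral>\<^sup>+\<omega>. f s \<omega> \<partial>env_law)"
    by (intro prod.cong nn_integral_cong refl) (simp add: eq)
  also have "(\<integral>\<^sup>+\<omega>. (\<Prod>s\<in>S. f s (ext s (restrict (\<lambda>i. \<omega> i) (D s)))) \<partial>env_law) = (\<integral>\<^sup>+\<omega>. (\<Prod>s\<in>S. f s \<omega>) \<partial>env_law)"
    by (intro prod.cong nn_integral_cong refl) (simp add: eq)
  finally show ?thesis .
qed

lemma sets_bad: "bad_event k l w x \<in> sets env_law"
  using measurable_bad[of k l w x] by (simp add: sets_env_law sets_eq_imp_space_eq[OF sets_env_law])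

text \<open>Badness is determined by the environment in the block, so separated sites give a
  product; translation invariance makes its factors equal.\<close>

lemma prob_all_bad:
  assumes X: "finite X" "separated k l w X"
  shows "env.prob {\<omega> \<in> space env_law. \<forall>x\<in>X. bad k l w \<omega> x} =
    env.prob (bad_event k l w 0) ^ card X"
proof -
  let ?B = "\<lambda>x. {\<omega>. bad k l w \<omega> x}"
  have ind: "(\<integral>\<^sup>+\<omega>. indicator (?B x) \<omega> \<partial>env_law) = ennreal (env.prob (bad_event k l w 0))" for x
  proof -
    have "(\<integral>\<^sup>+\<omega>. indicator (?B x) \<omega> \<partial>env_law) = (\<integral>\<^sup>+\<omega>. indicator (bad_event k l w x) \<omega> \<partial>env_law)"
      by (intro nn_integral_cong) (auto simp: indicator_def)
    then show ?thesis using sets_bad[of k l w x] prob_bad_shift[of k l w x] by (simp add: env.emeasure_eq_measure)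
  qed
  have "(\<integral>\<^sup>+\<omega>. (\<Prod>x\<in>X. indicator (?B x) \<omega>) \<partial>env_law) = (\<Prod>x\<in>X. \<integral>\<^sup>+\<omega>. indicator (?B x) \<omega> \<partial>env_law)"
  proof (rule nn_integral_prod_local[where D="\<lambda>x. {y. y - x \<in> slab k l w}"])
    show "disjoint_family_on (\<lambda>x. {y. y - x \<in> slab k l w}) X"
      using X(2) by (fastforce simp: disjoint_family_on_def separated_def)
    show "(indicator (?B x) :: _ \<Rightarrow> ennreal) \<in> borel_measurable env_law" for x
      using sets_bad[of k l w x] by (auto intro!: borel_measurable_indicator' simp: Collect_conj_eq Int_commute)
    show "indicator (?B x) \<omega> = (indicator (?B x) \<omega>' :: ennreal)"
      if "\<And>y. y \<in> {y. y - x \<in> slab k l w} \<Longrightarrow> \<omega> y = \<omega>' y" for x \<omega> \<omega>'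
      using bad_cong[of x k l w \<omega> \<omega>'] that by (simp add: indicator_def)
  qed (rule X)
  also have "\<dots> = ennreal (env.prob (bad_event k l w 0) ^ card X)"
    by (simp add: ind ennreal_power)
  also have "(\<integral>\<^sup>+\<omega>. (\<Prod>x\<in>X. indicator (?B x) \<omega>) \<partial>env_law) =
      (\<integral>\<^sup>+\<omega>. indicator {\<omega> \<in> space env_law. \<forall>x\<in>X. bad k l w \<omega> x} \<omega> \<partial>env_law)"
    using X(1) by (intro nn_integral_cong) (auto simp: indicator_def prod_zero_iff intro!: prod.neutral)
  also have "\<dots> = emeasure env_law {\<omega> \<in> space env_law. \<forall>x\<in>X. bad k l w \<omega> x}"
    by (intro nn_integral_indicator sets.sets_Collect_finite_All sets_bad X(1))
  finally show ?thesis by (simp add: env.emeasure_eq_measure)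
qed

definition many_bad :: "'n \<Rightarrow> int \<Rightarrow> int \<Rightarrow> (int ^ 'n) set \<Rightarrow> nat \<Rightarrow> 'n environment set" where
  "many_bad k l w V r =
     (\<Union>X\<in>{X. X \<subseteq> V \<and> card X = r \<and> separated k l w X}. {\<omega> \<in> space env_law. \<forall>x\<in>X. bad k l w \<omega> x})"

text \<open>Union bound over the separated \<open>r\<close>-element subsets, of which there are at
  most \<open>card V ^ r\<close>.\<close>

lemma prob_many_bad:
  assumes V: "finite V"
  shows "many_bad k l w V r \<in> sets env_law"
    and "env.prob (many_bad k l w V r) \<le> (card V * env.prob (bad_event k l w 0)) ^ r"
proof -
  let ?X = "{X. X \<subseteq> V \<and> card X = r \<and> separated k l w X}"
  let ?A = "\<lambda>X. {\<omega> \<in> space env_law. \<forall>x\<in>X. bad k l w \<omega> x}"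
  have fin: "finite ?X" using V by simp
  have A: "?A X \<in> sets env_law" if "X \<in> ?X" for X
    using that V finite_subset[of X V] by (intro sets.sets_Collect_finite_All sets_bad) auto
  show "many_bad k l w V r \<in> sets env_law"
    unfolding many_bad_def using fin A by (intro sets.finite_UN) auto
  have "env.prob (many_bad k l w V r) \<le> (\<Sum>X\<in>?X. env.prob (?A X))"
    unfolding many_bad_def using fin A by (intro env.finite_measure_subadditive_finite) auto
  also have "\<dots> = (\<Sum>X\<in>?X. env.prob (bad_event k l w 0) ^ r)"
    using V by (intro sum.cong refl) (auto simp: prob_all_bad finite_subset)
  also have "\<dots> = card ?X * env.prob (bad_event k l w 0) ^ r" by simp
  also have "\<dots> \<le> card V ^ r * env.prob (bad_event k l w 0) ^ r"
  proof (rule mult_right_mono)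
    have "card ?X \<le> card {X. X \<subseteq> V \<and> card X = r}" using V by (intro card_mono) auto
    also have "\<dots> = card V choose r" using V by (rule n_subsets)
    also have "\<dots> \<le> card V ^ r"
      by (cases "r \<le> card V") (auto intro: binomial_le_pow simp: binomial_eq_0)
    finally show "real (card ?X) \<le> real (card V ^ r)" by (simp only: of_nat_le_iff)
  qed simp
  finally show "env.prob (many_bad k l w V r) \<le> (card V * env.prob (bad_event k l w 0)) ^ r"
    by (simp add: power_mult_distrib)
qed

end

section \<open>One renormalisation step with explicit constants\<close>

lemma card_slab_le:
  fixes k :: "'n::finite"
  assumes "L \<le> W" "0 \<le> W"
  shows "real (card (slab k L W)) \<le> (2 * real_of_int W) ^ CARD('n)"
proof -
  have "slab k L W \<subseteq> vec_lambda ` (UNIV \<rightarrow>\<^sub>E {-W..<W})"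
  proof
    fix x assume x: "x \<in> slab k L W"
    have "x $ i \<in> {-W..<W}" for i
      using x assms by (cases "i = k") (auto simp: slab_def abs_less_iff)
    then show "x \<in> vec_lambda ` (UNIV \<rightarrow>\<^sub>E {-W..<W})"
      by (intro image_eqI[of _ _ "vec_nth x"]) auto
  qed
  then have "card (slab k L W) \<le> card (UNIV \<rightarrow>\<^sub>E {-W..<W} :: ('n \<Rightarrow> int) set)"
    by (meson card_image_le card_mono finite_PiE finite_atLeastLessThan_int finite_code finite_imageI order_trans)
  also have "\<dots> = nat (2 * W) ^ CARD('n)" by (simp add: card_PiE)
  finally have "real (card (slab k L W)) \<le> real (nat (2 * W) ^ CARD('n))" by (simp only: of_nat_le_iff)
  then show ?thesis using assms by simp
qed

text \<open>Pigeonhole with \<open>r + 1\<close> disjoint runs of \<open>g\<close> windows each: if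
  every run contained a point of \<open>Y\<close>, these points would occupy \<open>r + 1\<close>
  different windows.\<close>

lemma clean_run_exists:
  fixes f :: "'a \<Rightarrow> int"
  assumes w: "0 < w" and g: "0 \<le> g" and Y: "finite Y" "card ((\<lambda>x. f x div w) ` Y) \<le> r"
  shows "\<exists>j. 0 \<le> j \<and> j \<le> int r \<and> (\<forall>x\<in>Y. \<not> (j * (w * g) \<le> f x \<and> f x < j * (w * g) + w * g))"
proof (rule ccontr)
  assume "\<not> ?thesis"
  then have "\<forall>j. \<exists>x. j \<in> {0..int r} \<longrightarrow> x \<in> Y \<and> j * (w * g) \<le> f x \<and> f x < j * (w * g) + w * g"
    by (metis atLeastAtMost_iff)
  then obtain x where x: "\<And>j. j \<in> {0..int r} \<Longrightarrow> x j \<in> Y \<and> j * (w * g) \<le> f (x j) \<and> f (x j) < j * (w * g) + w * g"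
    by metis
  have win: "j * g \<le> f (x j) div w" "f (x j) div w < (j + 1) * g" if "j \<in> {0..int r}" for j
  proof -
    have "(j * g) * w \<le> f (x j)" "f (x j) < ((j + 1) * g) * w" using x[OF that] by (simp_all add: algebra_simps)
    moreover have "(f (x j) div w) * w \<le> f (x j)" "f (x j) < (f (x j) div w + 1) * w"
      using w div_mult_mod_eq[of "f (x j)" w] pos_mod_bound[OF w, of "f (x j)"] pos_mod_sign[OF w, of "f (x j)"]
      unfolding distrib_right by linarith+
    ultimately have "(j * g) * w < (f (x j) div w + 1) * w" "(f (x j) div w) * w < ((j + 1) * g) * w" by linarith+
    then have "j * g < f (x j) div w + 1" "f (x j) div w < (j + 1) * g"
      using w by (simp_all only: mult_less_cancel_right_pos)
    then show "j * g \<le> f (x j) div w" "f (x j) div w < (j + 1) * g" by linarith+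
  qed
  have "f (x i) div w < f (x j) div w" if "i \<in> {0..int r}" "j \<in> {0..int r}" "i < j" for i j
  proof -
    have "(i + 1) * g \<le> j * g" using that g by (intro mult_right_mono) auto
    then show ?thesis using win[OF that(1)] win[OF that(2)] by linarith
  qed
  then have "inj_on (\<lambda>j. f (x j) div w) {0..int r}" by (intro linorder_inj_onI) (auto simp: less_imp_neq)
  then have "card {0..int r} = card ((\<lambda>j. f (x j) div w) ` {0..int r})" by (simp add: card_image)
  also have "\<dots> \<le> card ((\<lambda>x. f x div w) ` Y)"
    using x Y by (intro card_mono) auto
  finally show False using Y by simp
qed

text \<open>Without 22 separated bad sites at most \<open>3 * 21 = 63\<close> windows are occupied
  in any direction, so one of 64 disjoint lateral runs is clean. The crossings cost
  \<open>(1 + K) ^ 63\<close>, at most \<open>2 powr (126 * l^3)\<close>, and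
  \<open>130 \<le> l\<close> is what makes \<open>l^4\<close> exceed \<open>126 * l^3\<close> with
  room for the lower-order terms.\<close>

lemma fail_inf_next_scale:
  fixes k :: "'n::finite" and \<omega> :: "'n environment" and l :: nat
  assumes env: "\<And>y. \<omega> y \<in> prob_vectors" and l: "130 \<le> l" "2 * CARD('n) \<le> l"
    and few: "\<And>X. X \<subseteq> slab k (int l ^ 5) (int l ^ 10) \<Longrightarrow> card X = 22 \<Longrightarrow> separated k l (int l ^ 2) X \<Longrightarrow>
      \<exists>x\<in>X. \<not> bad k l (int l ^ 2) \<omega> x"
    and ell: "\<And>x j. x \<in> slab k (int l ^ 5) (int l ^ 10) \<Longrightarrow> j < l ^ 2 + l \<Longrightarrow>
      2 powr (- real l) \<le> \<omega> (x + of_nat j *s axis k 1) (axis k 1)"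
  shows "fail_inf k \<omega> (int l ^ 5) (int l ^ 10) 0 \<le> 2 powr (- real l)"
proof -
  \<comment> \<open>A run consists of \<open>40 * l^4\<close> windows: as
    \<open>(5/4)^4 > 2\<close>, the lateral barrier drops by at least
    \<open>2 powr (10 * l^4)\<close> along it, more than the factor \<open>2 powr (2 * l^4)\<close>
    for the difference in level.\<close>
  define w L W G where "w = int l ^ 2" and "L = int l ^ 5" and "W = int l ^ 10" and "G = w * (40 * int l ^ 4)"
  define Y where "Y = {x \<in> slab k L W. bad k l w \<omega> x}"
  have finY: "finite Y" by (simp add: Y_def)
  have w0: "0 < w" "int l \<le> w" using l by (auto simp: w_def self_le_power)
  have win: "card ((\<lambda>x. \<sigma> * x $ i div w) ` Y) \<le> 63" if \<sigma>: "\<sigma> \<in> {1, -1}" for \<sigma> i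
  proof (rule ccontr)
    assume "\<not> ?thesis"
    then have "3 * 21 < card ((\<lambda>x. \<sigma> * x $ i div w) ` Y)" by simp
    then obtain X where X: "X \<subseteq> Y" "card X = Suc 21" "separated k (int l) w X"
      using separated_from_windows[OF w0 \<sigma> finY] by metis
    then show False using few[of X] by (auto simp: Y_def L_def W_def w_def)
  qed
  define run where "run = (\<lambda>i \<sigma> j. 0 \<le> j \<and> j \<le> 63 \<and> (\<forall>x\<in>Y. \<not> (j * G \<le> \<sigma> * x $ i \<and> \<sigma> * x $ i < j * G + G)))"
  define j where "j = (\<lambda>i \<sigma>. SOME j. run i \<sigma> j)"
  have j: "0 \<le> j i \<sigma> \<and> j i \<sigma> \<le> 63 \<and> (\<forall>x\<in>Y. \<not> (j i \<sigma> * G \<le> \<sigma> * x $ i \<and> \<sigma> * x $ i < j i \<sigma> * G + G))"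
    if \<sigma>: "\<sigma> \<in> {1, -1}" for i \<sigma>
  proof -
    have "\<exists>j. run i \<sigma> j"
      using clean_run_exists[OF w0(1) _ finY win[OF \<sigma>, of i], of "40 * int l ^ 4"] by (simp add: G_def run_def)
    then have "run i \<sigma> (j i \<sigma>)" unfolding j_def by (rule someI_ex)
    then show ?thesis by (simp add: run_def)
  qed
  define B where "B = (\<lambda>x. x $ k div w) ` Y"
  define K :: real where "K = 4 * 2 powr (w / l) / (2 powr (- real l)) ^ (l ^ 2 + l)"
  define q :: real where "q = 2 * CARD('n) * 2 powr (2 * L / int l) * (5 / 4) powr (- G / w)"
  have p2: "130 * real l \<le> real l ^ 2" using l by (simp add: power2_eq_square)
  have p3: "130 * real l ^ 2 \<le> real l ^ 3" using l mult_right_mono[of 130 "real l" "real l ^ 2"] by (simp add: eval_nat_numeral)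
  have p4: "130 * real l ^ 3 \<le> real l ^ 4" using l mult_right_mono[of 130 "real l" "real l ^ 3"] by (simp add: eval_nat_numeral)
  have l0: "130 \<le> real l" using l by simp
  have Ll: "real_of_int L / l = real l ^ 4" using l by (simp add: L_def eval_nat_numeral)
  have wl: "real_of_int w / l = real l" using l by (simp add: w_def eval_nat_numeral)
  have q_le: "q \<le> 2 powr (- 7 * real l ^ 4)"
  proof -
    have "real_of_int (- G) / w = 4 * (- 10 * real l ^ 4)" using w0 by (simp add: G_def)
    then have "(5 / 4 :: real) powr (- G / w) = ((5 / 4) powr 4) powr (- 10 * real l ^ 4)"
      by (simp only: powr_powr)
    also have "\<dots> \<le> 2 powr (- 10 * real l ^ 4)"
      by (rule powr_mono2') (auto simp: powr_numeral eval_nat_numeral)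
    finally have 1: "(5 / 4 :: real) powr (- G / w) \<le> 2 powr (- 10 * real l ^ 4)" .
    have "real (2 * CARD('n)) \<le> real l" using l(2) by (simp only: of_nat_le_iff)
    also have "real l \<le> 2 ^ l" by (rule less_imp_le) (rule of_nat_less_two_power)
    also have "\<dots> = 2 powr (real l)" by (simp add: powr_realpow)
    also have "\<dots> \<le> 2 powr (real l ^ 4)" using p2 p3 p4 l0 by (intro powr_mono) linarith+
    finally have 2: "real (2 * CARD('n)) \<le> 2 powr (real l ^ 4)" .
    have "q \<le> 2 powr (real l ^ 4) * 2 powr (2 * real l ^ 4) * 2 powr (- 10 * real l ^ 4)"
      unfolding q_def using 1 2 Ll by (intro mult_mono) auto
    also have "\<dots> = 2 powr (- 7 * real l ^ 4)" by (simp flip: powr_add)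
    finally show ?thesis .
  qed
  have "fail_inf k \<omega> L W 0 \<le> 2 powr (1 - L / int l) * (1 + K) ^ card B + q"
  proof (rule fail_inf_renormalization[OF env, where A = "\<lambda>i \<sigma>. j i \<sigma> * G" and m = "l ^ 2 + l"])
    show "1 \<le> int l" "0 < w" "0 < L" "0 < W" using l by (auto simp: w_def L_def W_def)
    show "int (l ^ 2 + l) = w + int l" by (simp add: w_def)
    show "0 < 2 powr - real l" "2 powr - real l \<le> 1" using powr_mono[of "- real l" 0 2] by auto
    show "finite B" using finY by (simp add: B_def)
    show "x $ k div w \<in> B" if "x \<in> slab k L W" "bad k (int l) w \<omega> x" for x
      using that by (auto simp: B_def Y_def)
    show "0 \<le> j i \<sigma> * G \<and> j i \<sigma> * G + G \<le> W - w" if "\<sigma> \<in> {1, -1}" for i \<sigma>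
    proof -
      have G0: "0 \<le> G" by (simp add: G_def w_def)
      have "j i \<sigma> * G + G \<le> 64 * G" using j[OF that, of i] G0 mult_right_mono[of "j i \<sigma>" 63 G] by simp
      also have "64 * G = 2560 * int l ^ 6" by (simp add: G_def w_def eval_nat_numeral)
      also have "\<dots> \<le> int l ^ 10 - int l ^ 2"
      proof -
        \<comment> \<open>The 64 runs together measure \<open>2560 * l^6\<close>, far below
          \<open>l^10\<close>, because \<open>l^4\<close> is at least \<open>130^4\<close>.\<close>
        have "int 130 ^ 4 \<le> int l ^ 4" using l by (intro power_mono) auto
        then have "int 130 ^ 4 * int l ^ 6 \<le> int l ^ 4 * int l ^ 6" by (intro mult_right_mono) auto
        also have "\<dots> = int l ^ 10" by (simp flip: power_add)
        finally have "285610000 * int l ^ 6 \<le> int l ^ 10" by simp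
        moreover have "int l ^ 2 \<le> int l ^ 6" "0 \<le> int l ^ 6" using l by (auto intro: power_increasing)
        ultimately show ?thesis by linarith
      qed
      finally show ?thesis using j[OF that, of i] G0 by (simp add: W_def w_def)
    qed
    show "\<not> (j i \<sigma> * G \<le> \<sigma> * x $ i \<and> \<sigma> * x $ i < j i \<sigma> * G + G)"
      if "x \<in> slab k L W" "bad k (int l) w \<omega> x" "\<sigma> \<in> {1, -1}" for x i \<sigma>
      using j[OF that(3), of i] that by (auto simp: Y_def)
    show "2 powr - real l \<le> \<omega> (x + of_nat i *s axis k 1) (axis k 1)" if "x \<in> slab k L W" "i < l ^ 2 + l" for x i
      using ell that by (simp add: L_def W_def)
    show "q < 2 powr (1 - 2 * L / int l)"
    proof -
      have "2 * real_of_int L / int l = 2 * real l ^ 4" using Ll by simp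
      moreover have "0 \<le> real l ^ 4" by simp
      ultimately have "- 7 * real l ^ 4 < 1 - 2 * real_of_int L / int l" by linarith
      then have "2 powr (- 7 * real l ^ 4) < 2 powr (1 - 2 * L / int l)" by simp
      then show ?thesis using q_le by linarith
    qed
  qed (simp_all add: q_def K_def)
  also have "\<dots> \<le> 2 powr (- real l - 1) + 2 powr (- real l - 1)"
  proof (rule add_mono)
    have pw: "(2 powr (- real l)) ^ (l ^ 2 + l) = 2 powr (- real l * (real l ^ 2 + real l))"
      by (simp add: powr_powr flip: powr_realpow)
    have "K = 2 powr 2 * 2 powr (real l) / 2 powr (- real l * (real l ^ 2 + real l))"
      unfolding K_def pw using wl by simp
    also have "\<dots> = 2 powr (2 + real l - (- real l * (real l ^ 2 + real l)))"
      by (simp only: powr_add powr_diff)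
    finally have "K = 2 powr (2 + real l + real l * (real l ^ 2 + real l))" by simp
    moreover have "2 + real l + real l * (real l ^ 2 + real l) = 2 + real l + real l ^ 2 + real l ^ 3"
      by (simp add: eval_nat_numeral algebra_simps)
    ultimately have Keq: "K = 2 powr (2 + real l + real l ^ 2 + real l ^ 3)" by simp
    have "1 \<le> K" unfolding Keq by (rule ge_one_powr_ge_zero) auto
    then have "1 + K \<le> 2 * K" by simp
    also have "2 * K = 2 powr (3 + real l + real l ^ 2 + real l ^ 3)"
      unfolding Keq using powr_add[of 2 1 "2 + real l + real l ^ 2 + real l ^ 3"] by (simp add: add.assoc)
    also have "\<dots> \<le> 2 powr (2 * real l ^ 3)" using p2 p3 l0 by (intro powr_mono) linarith+
    finally have "(1 + K) ^ card B \<le> (2 powr (2 * real l ^ 3)) ^ card B"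
      using \<open>1 \<le> K\<close> by (intro power_mono) auto
    also have "\<dots> \<le> (2 powr (2 * real l ^ 3)) ^ 63"
      using win[of 1 k] by (intro power_increasing ge_one_powr_ge_zero) (auto simp: B_def)
    also have "\<dots> = 2 powr (126 * real l ^ 3)" by (simp add: powr_powr flip: powr_numeral)
    finally have "2 powr (1 - L / int l) * (1 + K) ^ card B \<le> 2 powr (1 - L / int l) * 2 powr (126 * real l ^ 3)"
      by (intro mult_left_mono) auto
    also have "\<dots> = 2 powr (1 - real l ^ 4 + 126 * real l ^ 3)" using Ll by (simp flip: powr_add)
    also have "\<dots> \<le> 2 powr (- real l - 1)" using p2 p3 p4 l0 by (intro powr_mono) linarith+
    finally show "2 powr (1 - L / int l) * (1 + K) ^ card B \<le> 2 powr (- real l - 1)" .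
    have "2 powr (- 7 * real l ^ 4) \<le> 2 powr (- real l - 1)" using p2 p3 p4 l0 by (intro powr_mono) linarith+
    then show "q \<le> 2 powr (- real l - 1)" using q_le by linarith
  qed
  also have "\<dots> = 2 powr (- real l)" by (simp add: powr_diff)
  finally show ?thesis by (simp add: L_def W_def)
qed

section \<open>Superpolynomial decay along scales\<close>

lemma measurable_site_component: "e \<in> unit_steps \<Longrightarrow> (\<lambda>p. p e) \<in> borel_measurable site_algebra"
  unfolding site_algebra_def by (rule measurable_restrict_space1) (simp add: measurable_component_singleton)

text \<open>A union bound for the threshold \<open>2 powr (- l)\<close>: a bound on the number of
  sites of the large slab, times the number of positions on a straight path from such a site, times
  the tail estimate.\<close>

definition ellipticity_error :: "nat \<Rightarrow> real \<Rightarrow> real \<Rightarrow> nat \<Rightarrow> real" where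
  "ellipticity_error d C \<alpha> l = (2 * real l ^ 10) ^ d * (real l ^ 2 + real l) * (C * 2 powr (- \<alpha> * l))"

text \<open>The bounds \<open>130\<close> and \<open>2 * d\<close> make
  \<open>fail_inf_next_scale\<close> applicable; the exponent \<open>11 * M\<close> puts the
  ellipticity error on a par with the contribution of the bad sites.\<close>

definition large_scale :: "nat \<Rightarrow> real \<Rightarrow> real \<Rightarrow> real \<Rightarrow> nat \<Rightarrow> bool" where
  "large_scale d C \<alpha> M l \<longleftrightarrow> 130 \<le> l \<and> 2 * d \<le> l \<and> ellipticity_error d C \<alpha> l \<le> real l powr (- 11 * M)"

lemma eventually_large_scale:
  assumes "0 < \<alpha>"
  shows "eventually (large_scale d C \<alpha> M) sequentially"
proof -
  have "eventually (\<lambda>l. (2 * real l ^ 10) powr real d * (real l ^ 2 + real l) * ((\<bar>C\<bar> + 1) * 2 powr (- \<alpha> * l))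
      \<le> real l powr (- 11 * M)) sequentially"
  proof -
    have "0 < \<bar>C\<bar> + 1" by simp
    then show ?thesis using assms by real_asymp
  qed
  then show ?thesis
    using eventually_ge_at_top[of "130::nat"] eventually_ge_at_top[of "2 * d"]
  proof eventually_elim
    case (elim l)
    have "ellipticity_error d C \<alpha> l \<le> (2 * real l ^ 10) ^ d * (real l ^ 2 + real l) * ((\<bar>C\<bar> + 1) * 2 powr (- \<alpha> * l))"
      unfolding ellipticity_error_def by (intro mult_left_mono mult_right_mono) auto
    also have "(2 * real l ^ 10) ^ d = (2 * real l ^ 10) powr real d"
      using elim(2) by (intro powr_realpow[symmetric]) simp
    finally show ?case using elim by (simp add: large_scale_def)
  qed
qed

lemma eventually_two_powr_le: "eventually (\<lambda>l. 2 powr (- real l) \<le> (real l ^ 5) powr (- M) / 2) sequentially"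
  by real_asymp

text \<open>The constants \<open>C\<close> and \<open>\<alpha>\<close> are parameters next to the
  law so that scales can later be chosen from them alone, uniformly over all site laws with this
  tail and hence over small weights of the step to the left.\<close>

locale tail_environment = iid_environment \<mu> for \<mu> :: "(int ^ 'n::finite \<Rightarrow> real) measure" +
  fixes k :: 'n and C \<alpha> :: real
  assumes \<alpha>: "0 < \<alpha>"
    and tail: "\<And>t. 0 < t \<Longrightarrow> measure \<mu> {p \<in> space \<mu>. p (axis k 1) < t} \<le> C * t powr \<alpha>"
begin

abbreviation low_event :: "real \<Rightarrow> int ^ 'n \<Rightarrow> 'n environment set" where
  "low_event t y \<equiv> {\<omega> \<in> space env_law. \<omega> y (axis k 1) < t}"

definition prob_bad :: "nat \<Rightarrow> real" where
  "prob_bad l = env.prob (bad_event k (int l) (int l ^ 2) 0)"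

lemma C_nonneg: "0 \<le> C"
  using order_trans[OF measure_nonneg tail[of 1]] by simp

lemma low_site:
  assumes "0 < t"
  shows "low_event t y \<in> sets env_law"
    and "env.prob (low_event t y) \<le> C * t powr \<alpha>"
proof -
  have m: "(\<lambda>p. p (axis k 1)) \<in> borel_measurable \<mu>"
    using measurable_site_component[of "axis k 1"] measurable_cong_sets[OF sets_site refl] by auto
  have A: "{p \<in> space \<mu>. p (axis k 1) < t} \<in> sets \<mu>" using m by measurable
  have eq: "(\<lambda>\<omega>. \<omega> y) -` {p \<in> space \<mu>. p (axis k 1) < t} \<inter> space env_law = low_event t y"
    using measurable_space[OF measurable_component_site] by auto
  show "low_event t y \<in> sets env_law"
    using measurable_sets[OF measurable_component_site A, of y] by (simp only: eq)
  show "env.prob (low_event t y) \<le> C * t powr \<alpha>"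
    using tail[OF assms] measure_distr[OF measurable_component_site A, of y]
    by (simp only: eq distr_env_law_component)
qed

text \<open>The exceptional event has two causes: 22 separated bad sites in the large slab, or a
  weight to the right below the threshold on one of the straight paths. Off it the environment
  satisfies the hypotheses of \<open>fail_inf_next_scale\<close>.\<close>

lemma next_scale_event:
  assumes l: "130 \<le> l" "2 * CARD('n) \<le> l"
  obtains E where "E \<in> sets env_law"
    and "env.prob E \<le> ((2 * real l ^ 10) ^ CARD('n) * prob_bad l) ^ 22 + ellipticity_error CARD('n) C \<alpha> l"
    and "\<And>\<omega>. \<omega> \<in> space env_law - E \<Longrightarrow> fail_inf k \<omega> (int l ^ 5) (int l ^ 10) 0 \<le> 2 powr (- real l)"
proof -
  let ?V = "slab k (int l ^ 5) (int l ^ 10)"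
  let ?t = "2 powr (- real l)"
  let ?n = "l ^ 2 + l"
  define y where "y = (\<lambda>(x :: int ^ 'n, j :: nat). x + of_nat j *s axis k 1)"
  define F where "F = (\<Union>z\<in>?V \<times> {..<?n}. low_event ?t (y z))"
  define A where "A = many_bad k (int l) (int l ^ 2) ?V 22"
  have A: "A \<in> sets env_law" unfolding A_def by (rule prob_many_bad) simp
  have F: "F \<in> sets env_law" unfolding F_def by (intro sets.finite_UN low_site) auto
  have "int l ^ 5 \<le> int l ^ 10" using l by (intro power_increasing) auto
  then have "real (card ?V) \<le> (2 * real_of_int (int l ^ 10)) ^ CARD('n)"
    by (intro card_slab_le) auto
  then have V: "real (card ?V) \<le> (2 * real l ^ 10) ^ CARD('n)" by simp
  show thesis
  proof (rule that[of "A \<union> F"])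
    show "A \<union> F \<in> sets env_law" using A F by simp
    have "env.prob (A \<union> F) \<le> env.prob A + env.prob F" using A F by (rule measure_Un_le)
    moreover have "env.prob A \<le> ((2 * real l ^ 10) ^ CARD('n) * prob_bad l) ^ 22"
    proof -
      have "env.prob A \<le> (card ?V * prob_bad l) ^ 22"
        unfolding A_def prob_bad_def by (rule prob_many_bad) simp
      also have "\<dots> \<le> ((2 * real l ^ 10) ^ CARD('n) * prob_bad l) ^ 22"
        using V by (intro power_mono mult_right_mono) (auto simp: prob_bad_def)
      finally show ?thesis .
    qed
    moreover have "env.prob F \<le> ellipticity_error CARD('n) C \<alpha> l"
    proof -
      have "env.prob F \<le> (\<Sum>z\<in>?V \<times> {..<?n}. env.prob (low_event ?t (y z)))"
        unfolding F_def
      proof (rule env.finite_measure_subadditive_finite)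
        show "(\<lambda>z. low_event ?t (y z)) ` (?V \<times> {..<?n}) \<subseteq> env.events"
          by (intro image_subsetI low_site(1)) simp
      qed simp
      also have "\<dots> \<le> (\<Sum>z\<in>?V \<times> {..<?n}. C * ?t powr \<alpha>)"
        by (intro sum_mono low_site) simp
      also have "\<dots> = real (card ?V) * (real l ^ 2 + real l) * (C * 2 powr (- \<alpha> * l))"
        by (simp add: card_cartesian_product powr_powr mult.commute)
      also have "\<dots> \<le> ellipticity_error CARD('n) C \<alpha> l"
        unfolding ellipticity_error_def using V C_nonneg by (intro mult_right_mono) auto
      finally show ?thesis .
    qed
    ultimately show "env.prob (A \<union> F) \<le> ((2 * real l ^ 10) ^ CARD('n) * prob_bad l) ^ 22 + ellipticity_error CARD('n) C \<alpha> l"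
      by linarith
    fix \<omega> assume \<omega>: "\<omega> \<in> space env_law - (A \<union> F)"
    show "fail_inf k \<omega> (int l ^ 5) (int l ^ 10) 0 \<le> 2 powr (- real l)"
    proof (rule fail_inf_next_scale[OF _ l])
      show "\<omega> y \<in> prob_vectors" for y using \<omega> space_env_lawD by blast
      show "\<exists>x\<in>X. \<not> bad k l (int l ^ 2) \<omega> x"
        if "X \<subseteq> ?V" "card X = 22" "separated k l (int l ^ 2) X" for X
        using \<omega> that by (auto simp: A_def many_bad_def)
      show "?t \<le> \<omega> (x + of_nat j *s axis k 1) (axis k 1)" if "x \<in> ?V" "j < ?n" for x j
      proof -
        have "(x, j) \<in> ?V \<times> {..<?n}" using that by simp
        then have "\<not> \<omega> (y (x, j)) (axis k 1) < ?t" using \<omega> unfolding F_def by blast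
        then show ?thesis by (simp add: y_def)
      qed
    qed
  qed
qed

lemma good_if_fail_inf_less:
  assumes "\<And>y. \<omega> y \<in> prob_vectors" "fail_inf k \<omega> l w 0 < 1 / 16"
  shows "\<not> bad k l w \<omega> 0"
proof -
  have "eventually (\<lambda>N. fail k l w \<omega> N 0 < 1 / 16) sequentially"
    by (rule order_tendstoD(2)[OF fail_inf_lim assms(2)]) (rule assms)
  then obtain N where "fail k l w \<omega> N 0 < 1 / 16" by (auto simp: eventually_sequentially)
  moreover have "env_shift 0 \<omega> = \<omega>" by (simp add: env_shift_def[abs_def])
  ultimately show ?thesis unfolding bad_def by (metis less_le_not_le less_imp_le)
qed

text \<open>With 22 separated bad sites the bound \<open>l\<^bsup>-M/2\<^esup>\<close> per site gives \<open>l\<^bsup>-11M\<^esup>\<close>, which is more than enough for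
  the exponent \<open>2M\<close> at the scale \<open>l\<^sup>5\<close>.\<close>

lemma next_scale:
  assumes M: "22 * real CARD('n) \<le> M" and l: "large_scale CARD('n) C \<alpha> M l" and p: "prob_bad l \<le> real l powr (- M)"
  shows "\<exists>E\<in>sets env_law. env.prob E \<le> real (l ^ 5) powr (- (2 * M)) \<and>
      (\<forall>\<omega>\<in>space env_law - E. fail_inf k \<omega> (int (l ^ 5)) (int (l ^ 5) ^ 2) 0 \<le> 2 powr (- real l))"
    and "prob_bad (l ^ 5) \<le> real (l ^ 5) powr (- (2 * M))"
proof -
  have l': "130 \<le> l" "2 * CARD('n) \<le> l" using l by (auto simp: large_scale_def)
  have l0: "130 \<le> real l" using l' by simp
  have d1: "1 \<le> real CARD('n)" using zero_less_card_finite[where 'a='n] by linarith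
  from next_scale_event[OF l'] obtain E where E: "E \<in> sets env_law"
    "env.prob E \<le> ((2 * real l ^ 10) ^ CARD('n) * prob_bad l) ^ 22 + ellipticity_error CARD('n) C \<alpha> l"
    "\<And>\<omega>. \<omega> \<in> space env_law - E \<Longrightarrow> fail_inf k \<omega> (int l ^ 5) (int l ^ 10) 0 \<le> 2 powr (- real l)"
    by blast
  have sq: "int (l ^ 5) = int l ^ 5" "(int l ^ 5) ^ 2 = int l ^ 10" by (simp_all flip: power_mult)
  \<comment> \<open>The number of sites is at most \<open>l powr (11 * d)\<close>, hence at most
    \<open>l powr (M / 2)\<close> when \<open>22 * d \<le> M\<close>; half of the exponent survives
    the union bound.\<close>
  have "2 * real l ^ 10 \<le> real l * real l ^ 10" using l0 by (intro mult_right_mono) auto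
  also have "\<dots> = real l powr 11" using l0 by (simp add: powr_numeral eval_nat_numeral)
  finally have "(2 * real l ^ 10) ^ CARD('n) \<le> (real l powr 11) ^ CARD('n)"
    by (intro power_mono) auto
  also have "\<dots> = real l powr (11 * real CARD('n))"
    by (subst powr_power) (use l0 in \<open>auto simp: mult.commute powr_powr\<close>)
  finally have "(2 * real l ^ 10) ^ CARD('n) * prob_bad l \<le> real l powr (11 * real CARD('n)) * real l powr (- M)"
    using p by (intro mult_mono) (auto simp: prob_bad_def)
  also have "\<dots> = real l powr (11 * real CARD('n) - M)" by (simp flip: powr_add)
  also have "\<dots> \<le> real l powr (- M / 2)" using M l0 by (intro powr_mono) auto
  finally have "((2 * real l ^ 10) ^ CARD('n) * prob_bad l) ^ 22 \<le> (real l powr (- M / 2)) ^ 22"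
    by (intro power_mono) (auto simp: prob_bad_def)
  also have "\<dots> = real l powr (- 11 * M)" using powr_power[of "real l" "- M / 2" 22] l0 by simp
  finally have "env.prob E \<le> 2 * real l powr (- 11 * M)"
    using E(2) l by (simp add: large_scale_def)
  \<comment> \<open>A factor \<open>l powr M\<close> swallows the \<open>2\<close>; the remaining
    \<open>l powr (- 10 * M)\<close> is exactly the exponent \<open>2 * M\<close> at scale
    \<open>l ^ 5\<close>.\<close>
  also have "\<dots> \<le> real l powr M * real l powr (- 11 * M)"
  proof (rule mult_right_mono)
    have "2 \<le> real l powr 1" using l0 by simp
    also have "\<dots> \<le> real l powr M" using M d1 l0 by (intro powr_mono) linarith+
    finally show "2 \<le> real l powr M" .
  qed simp
  also have "\<dots> = real l powr (- 10 * M)" by (simp flip: powr_add)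
  also have "\<dots> = real (l ^ 5) powr (- (2 * M))"
    using powr_powr[of "real l" 5 "- (2 * M)"] l0 by (simp add: powr_numeral)
  finally have PE: "env.prob E \<le> real (l ^ 5) powr (- (2 * M))" .
  have small: "2 powr (- real l) < 1 / 16"
  proof -
    have "2 powr (- real l) < 2 powr (- 4)" using l0 by (intro powr_less_mono) auto
    then show ?thesis by (simp add: powr_minus powr_numeral)
  qed
  have "bad_event k (int (l ^ 5)) (int (l ^ 5) ^ 2) 0 \<subseteq> E"
    unfolding sq
  proof (rule subsetI, rule ccontr)
    fix \<omega> assume \<omega>: "\<omega> \<in> bad_event k (int l ^ 5) (int l ^ 10) 0" "\<omega> \<notin> E"
    then have "fail_inf k \<omega> (int l ^ 5) (int l ^ 10) 0 < 1 / 16" using E(3)[of \<omega>] small by simp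
    then have "\<not> bad k (int l ^ 5) (int l ^ 10) \<omega> 0"
      using \<omega> by (intro good_if_fail_inf_less space_env_lawD) auto
    then show False using \<omega> by simp
  qed
  then have "prob_bad (l ^ 5) \<le> env.prob E"
    unfolding prob_bad_def using E(1) by (rule env.finite_measure_mono)
  then show "prob_bad (l ^ 5) \<le> real (l ^ 5) powr (- (2 * M))" using PE by linarith
  show "\<exists>E\<in>sets env_law. env.prob E \<le> real (l ^ 5) powr (- (2 * M)) \<and>
      (\<forall>\<omega>\<in>space env_law - E. fail_inf k \<omega> (int (l ^ 5)) (int (l ^ 5) ^ 2) 0 \<le> 2 powr (- real l))"
    unfolding sq using E(1,3) PE by blast
qed

text \<open>Each passage to the next scale doubles the exponent, but \<open>large_scale\<close> for
  a larger exponent holds only from a later scale on. So the number \<open>j\<close> of doublings is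
  fixed first and the index is taken large afterwards. The error is split into an exceptional event
  and a quenched bound \<open>\<delta>\<close>, which simply add up under the annealed law.\<close>

lemma superpolynomial_decay:
  assumes l0: "\<And>l. l0 \<le> l \<Longrightarrow> large_scale CARD('n) C \<alpha> (22 * real CARD('n)) l"
    and base: "prob_bad l0 \<le> real l0 powr (- (22 * real CARD('n)))"
  shows "\<exists>L::nat\<ge>m. \<exists>E\<in>sets env_law. \<exists>\<delta>\<ge>0. env.prob E + \<delta> \<le> real L powr (- M) \<and>
    (\<forall>\<omega>\<in>space env_law - E. fail_inf k \<omega> (int L) (int L ^ 2) 0 \<le> \<delta>)"
proof -
  define M0 where "M0 = 22 * real CARD('n)"
  define s where "s n = l0 ^ (5 ^ n)" for n :: nat
  have l0': "130 \<le> l0" using l0[of l0] by (simp add: large_scale_def)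
  have s_Suc: "s (Suc n) = s n ^ 5" for n
    unfolding s_def power_mult[symmetric] by (simp add: mult.commute)
  have s_ge: "l0 \<le> s n" for n using l0' by (simp add: s_def self_le_power)
  have s_mono: "strict_mono s"
    using l0' by (auto simp: strict_mono_Suc_iff s_def intro!: power_strict_increasing)
  have M0: "22 * real CARD('n) \<le> 2 ^ j * M0" for j
    using mult_right_mono[of 1 "2 ^ j" M0] by (simp add: M0_def)
  have M0_pos: "1 \<le> M0" using zero_less_card_finite[where 'a='n] unfolding M0_def by linarith
  have "\<exists>N. \<forall>n\<ge>N. prob_bad (s n) \<le> real (s n) powr (- (2 ^ j * M0))" for j
  proof (induction j)
    case 0
    \<comment> \<open>At the basic exponent \<open>large_scale\<close> is available from
      \<open>l0\<close> on, so every scale is covered; the doubling is discarded here.\<close>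
    have "prob_bad (s n) \<le> real (s n) powr (- M0)" for n
    proof (induction n)
      case 0
      then show ?case using base by (simp add: s_def M0_def)
    next
      case (Suc n)
      have "prob_bad (s n ^ 5) \<le> real (s n ^ 5) powr (- (2 * M0))"
        using next_scale(2)[OF M0[of 0], of "s n"] Suc l0[OF s_ge] by (auto simp: M0_def)
      also have "\<dots> \<le> real (s n ^ 5) powr (- M0)"
        using M0_pos s_ge[of "Suc n"] l0' by (intro powr_mono) (auto simp: s_Suc simp flip: of_nat_power)
      finally show ?case by (simp only: s_Suc)
    qed
    then show ?case by simp
  next
    case (Suc j)
    then obtain N where N: "\<And>n. n \<ge> N \<Longrightarrow> prob_bad (s n) \<le> real (s n) powr (- (2 ^ j * M0))" by blast
    have "eventually (\<lambda>n. large_scale CARD('n) C \<alpha> (2 ^ j * M0) (s n)) sequentially"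
      using eventually_large_scale[OF \<alpha>] filterlim_subseq[OF s_mono] by (rule eventually_compose_filterlim)
    then obtain N' where N': "\<And>n. n \<ge> N' \<Longrightarrow> large_scale CARD('n) C \<alpha> (2 ^ j * M0) (s n)"
      by (auto simp: eventually_sequentially)
    have "prob_bad (s n) \<le> real (s n) powr (- (2 ^ Suc j * M0))" if n: "n \<ge> Suc (max N N')" for n
    proof -
      obtain i where i: "n = Suc i" "i \<ge> N" "i \<ge> N'" using n by (cases n) auto
      have "prob_bad (s i ^ 5) \<le> real (s i ^ 5) powr (- (2 * (2 ^ j * M0)))"
        by (rule next_scale(2)[OF M0[of j] N'[OF i(3)] N[OF i(2)]])
      then show ?thesis by (simp only: i s_Suc power_Suc mult.assoc)
    qed
    then show ?case by blast
  qed
  note decay = this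
  obtain j where j: "\<bar>M\<bar> < 2 ^ j" using real_arch_pow[of 2 "\<bar>M\<bar>"] by auto
  obtain N where N: "\<And>n. n \<ge> N \<Longrightarrow> prob_bad (s n) \<le> real (s n) powr (- (2 ^ j * M0))" using decay by blast
  \<comment> \<open>One half of the target is reserved for \<open>\<delta>\<close>, the other for
    the event \<open>E\<close>.\<close>
  have "eventually (\<lambda>l::nat. 2 powr (- real l) \<le> real (l ^ 5) powr (- \<bar>M\<bar>) / 2) sequentially"
    unfolding of_nat_power by (rule eventually_two_powr_le)
  from eventually_compose_filterlim[OF this filterlim_subseq[OF s_mono]]
    eventually_compose_filterlim[OF eventually_large_scale[OF \<alpha>] filterlim_subseq[OF s_mono], of "CARD('n)" C "2 ^ j * M0"]
    eventually_ge_at_top[of N] eventually_ge_at_top[of m]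
  have "eventually (\<lambda>n. 2 powr (- real (s n)) \<le> real (s n ^ 5) powr (- \<bar>M\<bar>) / 2 \<and>
      large_scale CARD('n) C \<alpha> (2 ^ j * M0) (s n) \<and> N \<le> n \<and> m \<le> n) sequentially"
    by eventually_elim simp
  then obtain n where n: "2 powr (- real (s n)) \<le> real (s n ^ 5) powr (- \<bar>M\<bar>) / 2"
      "large_scale CARD('n) C \<alpha> (2 ^ j * M0) (s n)" "N \<le> n" "m \<le> n"
    by (auto simp: eventually_sequentially)
  obtain E where E: "E \<in> sets env_law"
    "env.prob E \<le> real (s n ^ 5) powr (- (2 * (2 ^ j * M0)))"
    "\<And>\<omega>. \<omega> \<in> space env_law - E \<Longrightarrow> fail_inf k \<omega> (int (s n ^ 5)) (int (s n ^ 5) ^ 2) 0 \<le> 2 powr (- real (s n))"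
    using next_scale(1)[OF M0[of j] n(2) N[OF n(3)]] by meson
  let ?L = "s n ^ 5"
  have L: "130 \<le> real ?L" using s_ge[of "Suc n"] l0' unfolding s_Suc by linarith
  have "m \<le> s (Suc n)" using n(4) seq_suble[OF s_mono, of "Suc n"] by linarith
  have "real ?L powr (- (2 * (2 ^ j * M0))) \<le> real ?L powr (- \<bar>M\<bar> - 1)"
  proof (rule powr_mono)
    have "\<bar>M\<bar> * 1 \<le> 2 ^ j * M0" "1 * 1 \<le> 2 ^ j * M0" using j M0_pos by (intro mult_mono; simp)+
    then show "- (2 * (2 ^ j * M0)) \<le> - \<bar>M\<bar> - 1" by linarith
  qed (use L in linarith)
  also have "\<dots> = real ?L powr (- \<bar>M\<bar>) / real ?L" using L by (simp add: powr_diff del: of_nat_power)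
  also have "\<dots> \<le> real ?L powr (- \<bar>M\<bar>) / 2"
  proof -
    have "x powr a / x \<le> x powr a / 2" if "130 \<le> x" for x a :: real
      using that by (intro divide_left_mono mult_pos_pos) auto
    then show ?thesis using L by blast
  qed
  finally have "env.prob E + 2 powr (- real (s n)) \<le> real ?L powr (- \<bar>M\<bar>)" using E(2) n(1) by linarith
  also have "\<dots> \<le> real ?L powr (- M)" using L by (intro powr_mono) auto
  finally have "env.prob E + 2 powr (- real (s n)) \<le> real ?L powr (- M)" .
  with E(1,3) have "\<exists>E\<in>sets env_law. \<exists>\<delta>\<ge>0. env.prob E + \<delta> \<le> real ?L powr (- M) \<and>
      (\<forall>\<omega>\<in>space env_law - E. fail_inf k \<omega> (int ?L) (int ?L ^ 2) 0 \<le> \<delta>)"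
    by (meson powr_ge_zero)
  moreover have "m \<le> ?L" using \<open>m \<le> s (Suc n)\<close> by (simp only: s_Suc)
  ultimately show ?thesis by blast
qed

end

section \<open>The walk without steps to the left\<close>

text \<open>The walk is killed when it would step to the left, and being killed counts as no
  failure; \<open>fail_le_fail_noleft\<close> restores the omitted probability.\<close>

primrec fail_noleft :: "'n \<Rightarrow> int \<Rightarrow> int \<Rightarrow> 'n environment \<Rightarrow> nat \<Rightarrow> int ^ 'n \<Rightarrow> real" where
  "fail_noleft k l w \<omega> 0 x = (if l \<le> x $ k then 0 else 1)"
| "fail_noleft k l w \<omega> (Suc N) x =
     (if l \<le> x $ k then 0 else if x \<notin> slab k l w then 1
      else \<Sum>e\<in>unit_steps - {- axis k 1}. \<omega> x e * fail_noleft k l w \<omega> N (x + e))"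

text \<open>The discount makes a step to the right contract. A killed walk from level
  \<open>0\<close> reaches level \<open>l\<close> after \<open>l\<close> such steps, so undoing the
  discount costs at most \<open>2 powr l\<close>.\<close>

definition step_weight :: "'n \<Rightarrow> int ^ 'n \<Rightarrow> real" where
  "step_weight k e = (if e = axis k 1 then 1 / 2 else 1)"

text \<open>The expectation of \<open>2\<^bsup>-(number of steps to the right)\<^esup>\<close> on the event that the killed walk visits
  \<open>m\<close> sites within \<open>N\<close> steps, \<open>V\<close> being the sites visited so far. At each fresh site the walk
  steps to the right with a probability bounded away from zero, whence an exponential bound in \<open>m\<close>.\<close>

primrec spread :: "'n \<Rightarrow> nat \<Rightarrow> 'n environment \<Rightarrow> nat \<Rightarrow> (int ^ 'n) set \<Rightarrow> int ^ 'n \<Rightarrow> real" where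
  "spread k m \<omega> 0 V x = (if m \<le> card V then 1 else 0)"
| "spread k m \<omega> (Suc N) V x = (if m \<le> card V then 1
      else \<Sum>e\<in>unit_steps - {- axis k 1}. \<omega> x e * step_weight k e * spread k m \<omega> N (insert x V) (x + e))"

lemma step_weight_bounds: "0 \<le> step_weight k e" "step_weight k e \<le> 1"
  by (auto simp: step_weight_def)

lemma axis_neq_uminus: "axis k 1 \<noteq> - (axis k 1 :: int ^ 'n)"
  by (auto simp: vec_eq_iff axis_def)

lemma sum_step_weight_le:
  assumes "p \<in> prob_vectors"
  shows "(\<Sum>e\<in>unit_steps - {- axis k 1}. p e * step_weight k e) \<le> 1 - p (axis k 1) / 2"
proof -
  let ?U = "unit_steps - {- axis k 1}"
  have r: "axis k 1 \<in> ?U" using axis_neq_uminus[of k] by simp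
  have "(\<Sum>e\<in>?U. p e * step_weight k e) = p (axis k 1) / 2 + (\<Sum>e\<in>?U - {axis k 1}. p e * step_weight k e)"
    using r by (simp add: sum.remove[of ?U "axis k 1"] step_weight_def)
  also have "(\<Sum>e\<in>?U - {axis k 1}. p e * step_weight k e) = (\<Sum>e\<in>?U - {axis k 1}. p e)"
    by (rule sum.cong) (auto simp: step_weight_def)
  also have "(\<Sum>e\<in>?U - {axis k 1}. p e) = (\<Sum>e\<in>?U. p e) - p (axis k 1)"
    using r by (simp add: sum_diff1)
  also have "(\<Sum>e\<in>?U. p e) \<le> 1"
    using prob_vectorsD(2)[OF assms] prob_vectorsD(1)[OF assms, of "- axis k 1"] by (simp add: sum_diff1)
  finally show ?thesis by simp
qed

context
  fixes k :: "'n::finite" and \<omega> :: "'n environment"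
  assumes env: "\<And>y. \<omega> y \<in> prob_vectors"
begin

lemma fail_noleft_bounds: "0 \<le> fail_noleft k l w \<omega> N x" "fail_noleft k l w \<omega> N x \<le> 1"
proof (induction N arbitrary: x)
  case (Suc N)
  have p: "\<And>x e. e \<in> unit_steps \<Longrightarrow> 0 \<le> \<omega> x e" using prob_vectorsD(1)[OF env] by blast
  { case 1 show ?case using Suc(1) by (auto intro!: sum_nonneg mult_nonneg_nonneg intro: p) }
  { case 2
    have "(\<Sum>e\<in>unit_steps - {- axis k 1}. \<omega> x e * fail_noleft k l w \<omega> N (x + e)) \<le>
        (\<Sum>e\<in>unit_steps. \<omega> x e * fail_noleft k l w \<omega> N (x + e))"
      using p Suc(1) by (intro sum_mono2) auto
    also have "\<dots> \<le> 1" by (intro prob_vectors_average(1)[OF env] Suc(2))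
    finally show ?case by simp }
qed auto

lemma spread_nonneg: "0 \<le> spread k m \<omega> N V x"
  by (induction N arbitrary: V x)
     (auto intro!: sum_nonneg mult_nonneg_nonneg prob_vectorsD(1)[OF env] step_weight_bounds)

text \<open>Union bound over \<open>N\<close> steps: wherever the walk is in the slab, a step to the
  left has at most the probability obtained by summing these weights over the whole slab.\<close>

lemma fail_le_fail_noleft:
  "fail k l w \<omega> N x \<le> fail_noleft k l w \<omega> N x + N * (\<Sum>y\<in>slab k l w. \<omega> y (- axis k 1))"
proof (induction N arbitrary: x)
  case (Suc N)
  let ?U = "unit_steps - {- axis k 1 :: int ^ 'n}"
  define s where "s = (\<Sum>y\<in>slab k l w. \<omega> y (- axis k 1))"
  have s0: "0 \<le> s" unfolding s_def by (intro sum_nonneg prob_vectorsD(1)[OF env]) simp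
  show ?case
  proof (cases "x \<in> slab k l w")
    case True
    then have "x $ k < l" by (auto simp: slab_def)
    have le: "\<omega> x (- axis k 1) \<le> s"
      unfolding s_def using True by (intro member_le_sum) (auto intro: prob_vectorsD(1)[OF env])
    have p: "\<And>e. e \<in> unit_steps \<Longrightarrow> 0 \<le> \<omega> x e" using prob_vectorsD(1)[OF env] by blast
    have "(\<Sum>e\<in>unit_steps. \<omega> x e * fail k l w \<omega> N (x + e)) =
        \<omega> x (- axis k 1) * fail k l w \<omega> N (x + - axis k 1) + (\<Sum>e\<in>?U. \<omega> x e * fail k l w \<omega> N (x + e))"
      by (rule sum.remove) simp_all
    also have "\<omega> x (- axis k 1) * fail k l w \<omega> N (x + - axis k 1) \<le> s * 1"
      using le s0 fail_bounds[OF env] by (intro mult_mono) auto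
    also have "(\<Sum>e\<in>?U. \<omega> x e * fail k l w \<omega> N (x + e)) \<le> (\<Sum>e\<in>?U. \<omega> x e * (fail_noleft k l w \<omega> N (x + e) + N * s))"
      using p by (intro sum_mono mult_left_mono) (auto simp: s_def Suc)
    also have "\<dots> = (\<Sum>e\<in>?U. \<omega> x e * fail_noleft k l w \<omega> N (x + e)) + (\<Sum>e\<in>?U. \<omega> x e) * (N * s)"
      by (simp add: distrib_left sum.distrib sum_distrib_right)
    also have "(\<Sum>e\<in>?U. \<omega> x e) * (N * s) \<le> 1 * (N * s)"
      using prob_vectorsD(2)[OF env, of x] p[of "- axis k 1"] s0 by (intro mult_right_mono) (auto simp: sum_diff1)
    finally show ?thesis using True \<open>x $ k < l\<close> by (simp add: s_def algebra_simps)
  qed (use s0 in \<open>auto simp: s_def\<close>)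
qed simp

text \<open>From a nonnegative level the killed walk can fail only by a lateral exit, which takes
  \<open>m\<close> visited sites, or by surviving \<open>N\<close> steps. The hypotheses on
  \<open>V\<close> express that lateral displacement is bounded by the number of visited sites;
  survival is contracted by \<open>1 - \<kappa> / 2\<close> at every step, fresh site or
  not.\<close>

lemma fail_noleft_le_spread:
  assumes \<kappa>: "0 \<le> \<kappa>" "\<kappa> \<le> 1" and ell: "\<And>y. y \<in> slab k l m \<Longrightarrow> \<kappa> \<le> \<omega> y (axis k 1)"
    and x: "0 \<le> x $ k" "x $ k \<le> l" and V: "finite V" "\<And>i y. i \<noteq> k \<Longrightarrow> y \<in> V \<Longrightarrow> \<bar>y $ i\<bar> + 1 \<le> int (card V)"
      "\<And>i. i \<noteq> k \<Longrightarrow> \<bar>x $ i\<bar> \<le> int (card V)"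
  shows "fail_noleft k l m \<omega> N x \<le> 2 powr real_of_int (l - x $ k) * (spread k m \<omega> N V x + (1 - \<kappa> / 2) ^ N)"
  using x V
proof (induction N arbitrary: x V)
  case 0
  have "1 * 1 \<le> 2 powr real_of_int (l - x $ k) * (spread k m \<omega> 0 V x + (1 - \<kappa> / 2) ^ 0)"
    using 0 by (intro mult_mono ge_one_powr_ge_zero) auto
  then show ?case using fail_noleft_bounds(2)[of l m 0 x] by linarith
next
  case (Suc N)
  let ?U = "unit_steps - {- axis k 1 :: int ^ 'n}"
  let ?c = "2 powr real_of_int (l - x $ k)"
  have pow: "0 \<le> (1 - \<kappa> / 2) ^ n" for n using \<kappa> by (intro zero_le_power) auto
  have c: "1 \<le> ?c" using Suc.prems by (intro ge_one_powr_ge_zero) auto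
  consider "l \<le> x $ k" | "x $ k < l" "m \<le> card V" | "x $ k < l" "card V < m" by linarith
  then show ?case
  proof cases
    case 1
    have "0 \<le> ?c * (spread k m \<omega> (Suc N) V x + (1 - \<kappa> / 2) ^ Suc N)"
      by (intro mult_nonneg_nonneg add_nonneg_nonneg spread_nonneg pow) simp
    then show ?thesis using 1 by simp
  next
    case 2
    have "1 * 1 \<le> ?c * (spread k m \<omega> (Suc N) V x + (1 - \<kappa> / 2) ^ Suc N)"
      using 2 pow[of "Suc N"] by (intro mult_mono c) auto
    then show ?thesis using fail_noleft_bounds(2)[of l m "Suc N" x] by linarith
  next
    case 3
    have sl: "x \<in> slab k l m"
    proof -
      have "\<bar>x $ i\<bar> < int m" if "i \<noteq> k" for i using Suc.prems(5)[OF that] 3(2) by linarith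
      then show ?thesis using Suc.prems(1) 3(1) by (simp add: slab_def)
    qed
    let ?V = "insert x V"
    have p: "\<And>e. e \<in> unit_steps \<Longrightarrow> 0 \<le> \<omega> x e" using prob_vectorsD(1)[OF env] by blast
    have IH: "fail_noleft k l m \<omega> N (x + e) \<le> step_weight k e * (?c * (spread k m \<omega> N ?V (x + e) + (1 - \<kappa> / 2) ^ N))"
      if e: "e \<in> ?U" for e
    proof -
      have ek: "e = axis k 1 \<or> e $ k = 0" using e by (auto elim: unit_steps_cases[of e k])
      have eU: "e \<in> unit_steps" using e by simp
      \<comment> \<open>A fresh site raises the count by one, as much as the walk can move in a
        step; at a revisited site the invariant for \<open>V\<close> already contains the extra
        \<open>1\<close>.\<close>
      have cV: "\<bar>x $ i\<bar> + 1 \<le> int (card ?V)" if "i \<noteq> k" for i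
        using Suc.prems(3) Suc.prems(4)[OF that, of x] Suc.prems(5)[OF that]
        by (cases "x \<in> V") (auto simp: insert_absorb)
      have "fail_noleft k l m \<omega> N (x + e) \<le>
          2 powr real_of_int (l - (x + e) $ k) * (spread k m \<omega> N ?V (x + e) + (1 - \<kappa> / 2) ^ N)"
      proof (rule Suc.IH)
        show "0 \<le> (x + e) $ k" "(x + e) $ k \<le> l" using ek Suc.prems(1) 3(1) by (auto simp: axis_def)
        show "finite ?V" using Suc.prems by simp
        show "\<bar>y $ i\<bar> + 1 \<le> int (card ?V)" if "i \<noteq> k" "y \<in> ?V" for i y
        proof (cases "y = x")
          case False
          then have "\<bar>y $ i\<bar> + 1 \<le> int (card V)" using that Suc.prems(4) by simp
          moreover have "card V \<le> card ?V" using Suc.prems(3) by (intro card_mono) auto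
          ultimately show ?thesis by linarith
        qed (use cV[OF that(1)] in simp)
        show "\<bar>(x + e) $ i\<bar> \<le> int (card ?V)" if "i \<noteq> k" for i
          using cV[OF that] unit_steps_abs_le[OF eU, of i] by simp
      qed
      \<comment> \<open>A step to the right lowers the exponent by one, which is exactly its
        discount; the other surviving steps keep the level.\<close>
      also have "2 powr real_of_int (l - (x + e) $ k) = step_weight k e * ?c"
      proof (cases "e = axis k 1")
        case True
        then have "real_of_int (l - (x + e) $ k) = real_of_int (l - x $ k) - 1" by (simp add: axis_def)
        then show ?thesis using True by (simp only: powr_diff) (simp add: step_weight_def)
      qed (use ek in \<open>simp add: step_weight_def\<close>)
      finally show ?thesis by (simp only: mult.assoc)
    qed
    have "fail_noleft k l m \<omega> (Suc N) x = (\<Sum>e\<in>?U. \<omega> x e * fail_noleft k l m \<omega> N (x + e))"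
      using sl 3(1) by simp
    also have "\<dots> \<le> (\<Sum>e\<in>?U. \<omega> x e * (step_weight k e * (?c * (spread k m \<omega> N ?V (x + e) + (1 - \<kappa> / 2) ^ N))))"
      using p by (intro sum_mono mult_left_mono IH) auto
    also have "\<dots> = ?c * ((\<Sum>e\<in>?U. \<omega> x e * step_weight k e * spread k m \<omega> N ?V (x + e)) +
        (\<Sum>e\<in>?U. \<omega> x e * step_weight k e) * (1 - \<kappa> / 2) ^ N)"
      by (simp add: algebra_simps sum.distrib sum_distrib_left sum_distrib_right)
    also have "\<dots> \<le> ?c * ((\<Sum>e\<in>?U. \<omega> x e * step_weight k e * spread k m \<omega> N ?V (x + e)) +
        (1 - \<kappa> / 2) * (1 - \<kappa> / 2) ^ N)"
    proof (intro mult_left_mono add_left_mono mult_right_mono pow)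
      show "(\<Sum>e\<in>?U. \<omega> x e * step_weight k e) \<le> 1 - \<kappa> / 2"
        using sum_step_weight_le[OF env[of x], of k] ell[OF sl] by linarith
    qed simp
    finally show ?thesis using 3 by simp
  qed
qed

end

lemma measurable_spread: "(\<lambda>\<omega>. spread k m \<omega> N V x) \<in> borel_measurable env_algebra"
proof (induction N arbitrary: V x)
  case (Suc N)
  show ?case
    unfolding spread.simps
    by (intro measurable_If borel_measurable_const borel_measurable_sum borel_measurable_times Suc measurable_site) auto
qed simp

section \<open>Averaging the spread over the environment\<close>

context iid_environment
begin

lemma nn_integral_fresh_site:
  assumes \<psi>: "\<psi> \<in> borel_measurable env_law" and loc: "\<And>\<omega> \<omega>'. (\<And>y. y \<in> V \<Longrightarrow> \<omega> y = \<omega>' y) \<Longrightarrow> \<psi> \<omega> = \<psi> \<omega>'"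
    and f: "f \<in> borel_measurable \<mu>" and x: "x \<notin> V"
  shows "(\<integral>\<^sup>+\<omega>. \<psi> \<omega> * f (\<omega> x) \<partial>env_law) = (\<integral>\<^sup>+\<omega>. \<psi> \<omega> \<partial>env_law) * (\<integral>\<^sup>+p. f p \<partial>\<mu>)"
proof -
  define F where "F b = (if b then \<psi> else (\<lambda>\<omega>. f (\<omega> x)))" for b
  have fx: "(\<lambda>\<omega>. f (\<omega> x)) \<in> borel_measurable env_law"
    by (rule measurable_compose[OF measurable_component_site f])
  have "(\<integral>\<^sup>+\<omega>. (\<Prod>b\<in>UNIV. F b \<omega>) \<partial>env_law) = (\<Prod>b\<in>UNIV. \<integral>\<^sup>+\<omega>. F b \<omega> \<partial>env_law)"
  proof (rule nn_integral_prod_local[where D="\<lambda>b. if b then V else {x}"])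
    show "disjoint_family_on (\<lambda>b. if b then V else {x}) UNIV"
      using x by (auto simp: disjoint_family_on_def)
    show "F b \<in> borel_measurable env_law" for b using \<psi> fx by (simp add: F_def)
    show "F b \<omega> = F b \<omega>'" if "\<And>y. y \<in> (if b then V else {x}) \<Longrightarrow> \<omega> y = \<omega>' y" for b \<omega> \<omega>'
      using that loc[of \<omega> \<omega>'] by (cases b) (auto simp: F_def)
  qed simp
  moreover have "(\<integral>\<^sup>+\<omega>. f (\<omega> x) \<partial>env_law) = (\<integral>\<^sup>+p. f p \<partial>\<mu>)"
    using nn_integral_distr[OF measurable_component_site, of f x] f by (simp add: distr_env_law_component)
  ultimately show ?thesis by (simp add: UNIV_bool F_def mult.commute)
qed

text \<open>The weight \<open>\<psi>\<close> carries the transition factors of the path so far,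
  which depend on visited sites only; the induction multiplies it by one more factor. At a fresh
  site independence yields a factor \<open>\<rho>\<close>. At a revisited site the factor is merely
  at most \<open>1\<close>, but then the number of fresh sites still to come is unchanged.\<close>

lemma nn_integral_spread_le:
  assumes \<rho>: "(\<integral>\<^sup>+p. ennreal (\<Sum>e\<in>unit_steps - {- axis k 1}. p e * step_weight k e) \<partial>\<mu>) \<le> \<rho>"
    and V: "finite V"
    and \<psi>: "\<psi> \<in> borel_measurable env_law" and loc: "\<And>\<omega> \<omega>'. (\<And>y. y \<in> V \<Longrightarrow> \<omega> y = \<omega>' y) \<Longrightarrow> \<psi> \<omega> = \<psi> \<omega>'"
  shows "(\<integral>\<^sup>+\<omega>. \<psi> \<omega> * ennreal (spread k m \<omega> N V x) \<partial>env_law) \<le> \<rho> ^ (m - card V) * (\<integral>\<^sup>+\<omega>. \<psi> \<omega> \<partial>env_law)"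
  using V \<psi> loc
proof (induction N arbitrary: V x \<psi>)
  case 0
  show ?case by (cases "m \<le> card V") simp_all
next
  case (Suc N)
  let ?U = "unit_steps - {- axis k 1 :: int ^ 'n}"
  show ?case
  proof (cases "m \<le> card V")
    case True
    then show ?thesis by simp
  next
    case False
    let ?V = "insert x V"
    let ?c = "\<lambda>\<omega> e. ennreal (\<omega> x e * step_weight k e)"
    define S where "S p = (\<Sum>e\<in>?U. p e * step_weight k e)" for p
    have mc: "(\<lambda>\<omega>. ?c \<omega> e) \<in> borel_measurable env_law" if "e \<in> ?U" for e
      using that by (intro measurable_compose[OF _ measurable_ennreal] borel_measurable_times borel_measurable_const
          measurable_env_law measurable_site) simp
    have nn: "0 \<le> \<omega> x e * step_weight k e" if "\<omega> \<in> space env_law" "e \<in> ?U" for \<omega> e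
      using prob_vectorsD(1)[OF space_env_lawD[OF that(1)]] that(2) by (intro mult_nonneg_nonneg step_weight_bounds) auto
    have "(\<integral>\<^sup>+\<omega>. \<psi> \<omega> * ennreal (spread k m \<omega> (Suc N) V x) \<partial>env_law) =
        (\<integral>\<^sup>+\<omega>. (\<Sum>e\<in>?U. (\<psi> \<omega> * ?c \<omega> e) * ennreal (spread k m \<omega> N ?V (x + e))) \<partial>env_law)"
    proof (rule nn_integral_cong)
      fix \<omega> assume \<omega>: "\<omega> \<in> space env_law"
      have sp: "0 \<le> spread k m \<omega> N ?V y" for y by (rule spread_nonneg) (rule space_env_lawD[OF \<omega>])
      have "ennreal (spread k m \<omega> (Suc N) V x) = (\<Sum>e\<in>?U. ?c \<omega> e * ennreal (spread k m \<omega> N ?V (x + e)))"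
      proof -
        have "(\<Sum>e\<in>?U. ?c \<omega> e * ennreal (spread k m \<omega> N ?V (x + e))) =
            (\<Sum>e\<in>?U. ennreal (\<omega> x e * step_weight k e * spread k m \<omega> N ?V (x + e)))"
          by (intro sum.cong refl ennreal_mult[symmetric] nn[OF \<omega>] sp)
        also have "\<dots> = ennreal (\<Sum>e\<in>?U. \<omega> x e * step_weight k e * spread k m \<omega> N ?V (x + e))"
          by (intro sum_ennreal mult_nonneg_nonneg[OF nn[OF \<omega>] sp])
        finally show ?thesis using False by simp
      qed
      then show "\<psi> \<omega> * ennreal (spread k m \<omega> (Suc N) V x) =
          (\<Sum>e\<in>?U. (\<psi> \<omega> * ?c \<omega> e) * ennreal (spread k m \<omega> N ?V (x + e)))"
        by (simp add: sum_distrib_left mult.assoc)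
    qed
    also have "\<dots> = (\<Sum>e\<in>?U. \<integral>\<^sup>+\<omega>. (\<psi> \<omega> * ?c \<omega> e) * ennreal (spread k m \<omega> N ?V (x + e)) \<partial>env_law)"
      by (intro nn_integral_sum borel_measurable_times_ennreal Suc.prems(2) mc
          measurable_compose[OF measurable_env_law[OF measurable_spread] measurable_ennreal])
    also have "\<dots> \<le> (\<Sum>e\<in>?U. \<rho> ^ (m - card ?V) * (\<integral>\<^sup>+\<omega>. \<psi> \<omega> * ?c \<omega> e \<partial>env_law))"
    proof (rule sum_mono, rule Suc.IH)
      fix e assume e: "e \<in> ?U"
      show "finite ?V" using Suc.prems(1) by simp
      show "(\<lambda>\<omega>. \<psi> \<omega> * ?c \<omega> e) \<in> borel_measurable env_law" by (intro borel_measurable_times_ennreal Suc.prems(2) mc e)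
      show "\<psi> \<omega> * ?c \<omega> e = \<psi> \<omega>' * ?c \<omega>' e" if "\<And>y. y \<in> ?V \<Longrightarrow> \<omega> y = \<omega>' y" for \<omega> \<omega>'
      proof -
        have "\<psi> \<omega> = \<psi> \<omega>'" by (rule Suc.prems(3)) (rule that, simp)
        moreover have "\<omega> x = \<omega>' x" by (rule that) simp
        ultimately show ?thesis by (simp only:)
      qed
    qed
    also have "\<dots> = \<rho> ^ (m - card ?V) * (\<integral>\<^sup>+\<omega>. (\<Sum>e\<in>?U. \<psi> \<omega> * ?c \<omega> e) \<partial>env_law)"
    proof -
      have "(\<integral>\<^sup>+\<omega>. (\<Sum>e\<in>?U. \<psi> \<omega> * ?c \<omega> e) \<partial>env_law) = (\<Sum>e\<in>?U. \<integral>\<^sup>+\<omega>. \<psi> \<omega> * ?c \<omega> e \<partial>env_law)"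
        by (intro nn_integral_sum borel_measurable_times_ennreal Suc.prems(2) mc)
      then show ?thesis by (simp only: sum_distrib_left)
    qed
    also have "(\<integral>\<^sup>+\<omega>. (\<Sum>e\<in>?U. \<psi> \<omega> * ?c \<omega> e) \<partial>env_law) = (\<integral>\<^sup>+\<omega>. \<psi> \<omega> * ennreal (S (\<omega> x)) \<partial>env_law)"
    proof (rule nn_integral_cong)
      fix \<omega> assume \<omega>: "\<omega> \<in> space env_law"
      have "(\<Sum>e\<in>?U. ?c \<omega> e) = ennreal (S (\<omega> x))"
        unfolding S_def by (intro sum_ennreal nn[OF \<omega>])
      then show "(\<Sum>e\<in>?U. \<psi> \<omega> * ?c \<omega> e) = \<psi> \<omega> * ennreal (S (\<omega> x))"
        by (simp flip: sum_distrib_left)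
    qed
    also have "\<rho> ^ (m - card ?V) * (\<integral>\<^sup>+\<omega>. \<psi> \<omega> * ennreal (S (\<omega> x)) \<partial>env_law) \<le>
        \<rho> ^ (m - card V) * (\<integral>\<^sup>+\<omega>. \<psi> \<omega> \<partial>env_law)"
    proof (cases "x \<in> V")
      case True
      have "(\<integral>\<^sup>+\<omega>. \<psi> \<omega> * ennreal (S (\<omega> x)) \<partial>env_law) \<le> (\<integral>\<^sup>+\<omega>. \<psi> \<omega> * 1 \<partial>env_law)"
      proof (intro nn_integral_mono mult_left_mono)
        fix \<omega> assume "\<omega> \<in> space env_law"
        note p = space_env_lawD[OF this, of x]
        have "S (\<omega> x) \<le> 1"
          using sum_step_weight_le[OF p, of k] prob_vectorsD(1)[OF p, of "axis k 1"] by (simp add: S_def)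
        then show "ennreal (S (\<omega> x)) \<le> 1" by simp
      qed simp
      then show ?thesis using True by (simp add: insert_absorb mult_left_mono)
    next
      case xV: False
      have mS: "(\<lambda>p. ennreal (S p)) \<in> borel_measurable \<mu>"
        unfolding S_def
        by (intro measurable_compose[OF _ measurable_ennreal] borel_measurable_sum borel_measurable_times borel_measurable_const)
          (use measurable_site_component measurable_cong_sets[OF sets_site refl] in auto)
      have "(\<integral>\<^sup>+\<omega>. \<psi> \<omega> * ennreal (S (\<omega> x)) \<partial>env_law) = (\<integral>\<^sup>+\<omega>. \<psi> \<omega> \<partial>env_law) * (\<integral>\<^sup>+p. ennreal (S p) \<partial>\<mu>)"
        by (rule nn_integral_fresh_site[OF Suc.prems(2) _ mS xV]) (rule Suc.prems(3))
      also have "\<dots> \<le> (\<integral>\<^sup>+\<omega>. \<psi> \<omega> \<partial>env_law) * \<rho>"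
        unfolding S_def by (intro mult_left_mono \<rho>) simp
      finally have "\<rho> ^ (m - card ?V) * (\<integral>\<^sup>+\<omega>. \<psi> \<omega> * ennreal (S (\<omega> x)) \<partial>env_law) \<le>
          \<rho> ^ (m - card ?V) * ((\<integral>\<^sup>+\<omega>. \<psi> \<omega> \<partial>env_law) * \<rho>)" by (rule mult_left_mono) simp
      also have "\<dots> = \<rho> ^ Suc (m - card ?V) * (\<integral>\<^sup>+\<omega>. \<psi> \<omega> \<partial>env_law)" by (simp add: mult_ac)
      also have "Suc (m - card ?V) = m - card V" using xV Suc.prems(1) False by simp
      finally show ?thesis .
    qed
    finally show ?thesis .
  qed
qed

end

context tail_environment
begin

text \<open>With probability at least \<open>1/2\<close> the weight to the right is at least
  \<open>t\<close>, and then the discount saves \<open>t / 2\<close>; otherwise the sum is at most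
  \<open>1\<close>.\<close>

lemma integral_step_weight_le:
  assumes t: "0 < t" "t \<le> 1" "C * t powr \<alpha> \<le> 1 / 2"
  shows "(\<integral>\<^sup>+p. ennreal (\<Sum>e\<in>unit_steps - {- axis k 1}. p e * step_weight k e) \<partial>\<mu>) \<le> ennreal (1 - t / 4)"
proof -
  interpret site: prob_space \<mu> by (rule prob_site)
  let ?A = "{p \<in> space \<mu>. p (axis k 1) < t}"
  have m: "(\<lambda>p. p (axis k 1)) \<in> borel_measurable \<mu>"
    using measurable_site_component[of "axis k 1"] measurable_cong_sets[OF sets_site refl] by auto
  have A: "?A \<in> sets \<mu>" using m by measurable
  have sp: "space \<mu> \<subseteq> prob_vectors"
    using sets_eq_imp_space_eq[OF sets_site] by (auto simp: site_algebra_def space_restrict_space)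
  have "(\<integral>\<^sup>+p. ennreal (\<Sum>e\<in>unit_steps - {- axis k 1}. p e * step_weight k e) \<partial>\<mu>) \<le>
      (\<integral>\<^sup>+p. ennreal (1 - t / 2) + ennreal (t / 2) * indicator ?A p \<partial>\<mu>)"
  proof (rule nn_integral_mono)
    fix p assume p: "p \<in> space \<mu>"
    then have pv: "p \<in> prob_vectors" using sp by auto
    have le: "(\<Sum>e\<in>unit_steps - {- axis k 1}. p e * step_weight k e) \<le> 1 - p (axis k 1) / 2"
      by (rule sum_step_weight_le[OF pv])
    have p0: "0 \<le> p (axis k 1)" by (rule prob_vectorsD(1)[OF pv]) simp
    show "ennreal (\<Sum>e\<in>unit_steps - {- axis k 1}. p e * step_weight k e) \<le> ennreal (1 - t / 2) + ennreal (t / 2) * indicator ?A p"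
    proof (cases "p (axis k 1) < t")
      case True
      have "ennreal (\<Sum>e\<in>unit_steps - {- axis k 1}. p e * step_weight k e) \<le> ennreal (1 - t / 2 + t / 2)"
        using le p0 by (intro ennreal_leI) simp
      also have "\<dots> = ennreal (1 - t / 2) + ennreal (t / 2)" using t by (intro ennreal_plus) auto
      finally show ?thesis using True p by simp
    next
      case False
      then have "ennreal (\<Sum>e\<in>unit_steps - {- axis k 1}. p e * step_weight k e) \<le> ennreal (1 - t / 2)"
        using le by (intro ennreal_leI) simp
      then show ?thesis using False by simp
    qed
  qed
  also have "\<dots> = ennreal (1 - t / 2) + ennreal (t / 2) * emeasure \<mu> ?A"
    using A by (subst nn_integral_add) (auto simp: nn_integral_cmult site.emeasure_space_1)
  also have "\<dots> = ennreal (1 - t / 2 + t / 2 * site.prob ?A)"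
    using t by (simp add: site.emeasure_eq_measure flip: ennreal_mult ennreal_plus)
  also have "\<dots> \<le> ennreal (1 - t / 4)"
  proof (rule ennreal_leI)
    have "t / 2 * site.prob ?A \<le> t / 2 * (1 / 2)"
      using tail[OF t(1)] t by (intro mult_left_mono) auto
    then show "1 - t / 2 + t / 2 * site.prob ?A \<le> 1 - t / 4" by simp
  qed
  finally show ?thesis .
qed

text \<open>The terms stand for a site of low weight to the right in the block, a step to the left
  within \<open>N\<close> steps, a visit to \<open>l^2\<close> sites, and survival for
  \<open>N\<close> steps. The factor \<open>16\<close> is Markov's inequality at the threshold of
  \<open>bad\<close>.\<close>

lemma prob_bad_le:
  assumes l: "1 \<le> l" and \<kappa>: "0 < \<kappa>" "\<kappa> \<le> 1" and t: "0 < t" "t \<le> 1" "C * t powr \<alpha> \<le> 1 / 2"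
    and left: "(\<integral>\<^sup>+p. ennreal (p (- axis k 1)) \<partial>\<mu>) \<le> ennreal \<epsilon>" "0 \<le> \<epsilon>"
    and n: "n = card (slab k (int l) (int l ^ 2))"
  shows "prob_bad l \<le> n * (C * \<kappa> powr \<alpha>) +
    16 * (real N * real n * \<epsilon> + 2 powr l * ((1 - t / 4) ^ (l ^ 2) + (1 - \<kappa> / 2) ^ N))"
proof -
  let ?S = "slab k (int l) (int l ^ 2)" and ?B = "bad_event k (int l) (int l ^ 2) 0"
  define E where "E = (\<Union>y\<in>?S. low_event \<kappa> y)"
  define s where "s \<omega> = (\<Sum>y\<in>?S. ennreal (\<omega> y (- axis k 1)))" for \<omega> :: "'n environment"
  define G where "G \<omega> = ennreal (spread k (l ^ 2) \<omega> N {} 0)" for \<omega>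
  define q where "q = 16 * 2 powr l * (1 - \<kappa> / 2) ^ N"
  let ?X = "n * (C * \<kappa> powr \<alpha>) + (16 * real N * (real n * \<epsilon>) + (16 * 2 powr l * (1 - t / 4) ^ (l ^ 2) + q))"
  have q0: "0 \<le> q" using \<kappa> by (simp add: q_def)
  have E: "E \<in> sets env_law" unfolding E_def by (intro sets.finite_UN low_site \<kappa>) auto
  have mcomp: "(\<lambda>\<omega>. ennreal (\<omega> y (- axis k 1))) \<in> borel_measurable env_law" for y
    by (rule measurable_compose[OF measurable_env_law[OF measurable_site] measurable_ennreal]) simp
  have ms: "s \<in> borel_measurable env_law" unfolding s_def[abs_def] by (intro borel_measurable_sum mcomp)
  have mG: "G \<in> borel_measurable env_law"
    unfolding G_def[abs_def] by (rule measurable_compose[OF measurable_env_law[OF measurable_spread] measurable_ennreal])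
  have "emeasure env_law ?B = (\<integral>\<^sup>+\<omega>. indicator ?B \<omega> \<partial>env_law)" using sets_bad by simp
  also have "\<dots> \<le> (\<integral>\<^sup>+\<omega>. indicator E \<omega> + (ennreal (16 * N) * s \<omega> + (ennreal (16 * 2 powr l) * G \<omega> + ennreal q)) \<partial>env_law)"
  proof (rule nn_integral_mono)
    fix \<omega> assume \<omega>: "\<omega> \<in> space env_law"
    note env' = space_env_lawD[OF \<omega>]
    show "indicator ?B \<omega> \<le> indicator E \<omega> + (ennreal (16 * N) * s \<omega> + (ennreal (16 * 2 powr l) * G \<omega> + ennreal q))"
    proof (cases "\<omega> \<in> ?B \<and> \<omega> \<notin> E")
      case False
      then show ?thesis by (cases "\<omega> \<in> ?B") (auto simp: indicator_def intro: add_increasing2)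
    next
      case True
      have ell: "\<kappa> \<le> \<omega> y (axis k 1)" if "y \<in> slab k (int l) (int (l ^ 2))" for y
        using True that \<omega> by (force simp: E_def)
      let ?sr = "\<Sum>y\<in>?S. \<omega> y (- axis k 1)" and ?g = "spread k (l ^ 2) \<omega> N {} 0"
      have s0: "0 \<le> ?sr" by (intro sum_nonneg prob_vectorsD(1)[OF env']) simp
      have g0: "0 \<le> ?g" by (rule spread_nonneg[OF env'])
      have "env_shift 0 \<omega> = \<omega>" by (simp add: env_shift_def[abs_def])
      then have "1 / 16 < fail k (int l) (int l ^ 2) \<omega> N 0" using True by (auto simp: bad_def)
      also have "\<dots> \<le> fail_noleft k (int l) (int l ^ 2) \<omega> N 0 + N * ?sr"
        by (rule fail_le_fail_noleft[OF env'])
      also have "fail_noleft k (int l) (int l ^ 2) \<omega> N 0 \<le> 2 powr real_of_int (int l - 0 $ k) * (?g + (1 - \<kappa> / 2) ^ N)"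
        using fail_noleft_le_spread[where V="{}" and x=0 and m="l ^ 2" and l="int l" and N=N, OF env' _ \<kappa>(2) ell] \<kappa>(1) by simp
      finally have "1 \<le> 16 * N * ?sr + (16 * 2 powr l * ?g + q)" by (simp add: q_def algebra_simps)
      then have "ennreal 1 \<le> ennreal (16 * N * ?sr + (16 * 2 powr l * ?g + q))" by (rule ennreal_leI)
      also have "\<dots> = ennreal (16 * N) * ennreal ?sr + (ennreal (16 * 2 powr l) * ennreal ?g + ennreal q)"
        using s0 g0 q0 by (simp add: ennreal_plus ennreal_mult)
      also have "ennreal ?sr = s \<omega>"
        unfolding s_def by (intro sum_ennreal[symmetric] prob_vectorsD(1)[OF env']) simp
      finally show ?thesis using True by (simp add: G_def)
    qed
  qed
  also have "\<dots> = emeasure env_law E + (ennreal (16 * N) * (\<integral>\<^sup>+\<omega>. s \<omega> \<partial>env_law) +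
      (ennreal (16 * 2 powr l) * (\<integral>\<^sup>+\<omega>. G \<omega> \<partial>env_law) + ennreal q))"
    using E ms mG by (simp add: nn_integral_add nn_integral_cmult env.emeasure_space_1)
  also have "\<dots> \<le> ennreal (n * (C * \<kappa> powr \<alpha>)) + (ennreal (16 * N) * ennreal (n * \<epsilon>) +
      (ennreal (16 * 2 powr l) * ennreal ((1 - t / 4) ^ (l ^ 2)) + ennreal q))"
  proof (intro add_mono mult_left_mono)
    have "env.prob E \<le> (\<Sum>y\<in>?S. env.prob (low_event \<kappa> y))"
      unfolding E_def
    proof (rule env.finite_measure_subadditive_finite)
      show "(\<lambda>y. low_event \<kappa> y) ` ?S \<subseteq> env.events"
        by (intro image_subsetI low_site(1) \<kappa>)
    qed simp
    also have "\<dots> \<le> (\<Sum>y\<in>?S. C * \<kappa> powr \<alpha>)" by (intro sum_mono low_site \<kappa>)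
    finally show "emeasure env_law E \<le> ennreal (n * (C * \<kappa> powr \<alpha>))"
      by (simp add: env.emeasure_eq_measure n ennreal_leI)
    have "(\<integral>\<^sup>+\<omega>. s \<omega> \<partial>env_law) = (\<Sum>y\<in>?S. \<integral>\<^sup>+\<omega>. ennreal (\<omega> y (- axis k 1)) \<partial>env_law)"
      unfolding s_def by (rule nn_integral_sum) (rule mcomp)
    also have "\<dots> = (\<Sum>y\<in>?S. \<integral>\<^sup>+p. ennreal (p (- axis k 1)) \<partial>\<mu>)"
    proof (rule sum.cong[OF refl])
      fix y
      have "(\<lambda>p. ennreal (p (- axis k 1))) \<in> borel_measurable \<mu>"
        using measurable_compose[OF measurable_site_component[of "- axis k 1"] measurable_ennreal]
          measurable_cong_sets[OF sets_site refl] by auto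
      then show "(\<integral>\<^sup>+\<omega>. ennreal (\<omega> y (- axis k 1)) \<partial>env_law) = (\<integral>\<^sup>+p. ennreal (p (- axis k 1)) \<partial>\<mu>)"
        using nn_integral_distr[OF measurable_component_site, of "\<lambda>p. ennreal (p (- axis k 1))" y]
        by (simp add: distr_env_law_component)
    qed
    also have "\<dots> \<le> (\<Sum>y\<in>?S. ennreal \<epsilon>)" by (intro sum_mono left)
    also have "\<dots> = ennreal (n * \<epsilon>)" using left(2) by (simp add: n ennreal_mult ennreal_of_nat_eq_real_of_nat)
    finally show "(\<integral>\<^sup>+\<omega>. s \<omega> \<partial>env_law) \<le> ennreal (n * \<epsilon>)" .
    have "(\<integral>\<^sup>+\<omega>. 1 * G \<omega> \<partial>env_law) \<le> ennreal (1 - t / 4) ^ (l ^ 2 - card ({} :: (int ^ 'n) set)) * (\<integral>\<^sup>+\<omega>. 1 \<partial>env_law)"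
      unfolding G_def by (rule nn_integral_spread_le[OF integral_step_weight_le[OF t]]) auto
    then show "(\<integral>\<^sup>+\<omega>. G \<omega> \<partial>env_law) \<le> ennreal ((1 - t / 4) ^ (l ^ 2))"
      using t by (simp add: env.emeasure_space_1 ennreal_power)
  qed simp_all
  also have "\<dots> = ennreal (?X)"
    using left(2) t q0 C_nonneg by (simp add: ennreal_plus ennreal_mult)
  finally have "ennreal (prob_bad l) \<le> ennreal (?X)"
    by (simp only: env.emeasure_eq_measure prob_bad_def)
  moreover have "0 \<le> ?X"
    using left(2) t q0 C_nonneg by (intro add_nonneg_nonneg mult_nonneg_nonneg) auto
  ultimately have "prob_bad l \<le> ?X"
    by (simp only: ennreal_le_iff)
  then show ?thesis by (simp add: q_def algebra_simps)
qed

end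

section \<open>Choice of the base scale\<close>

lemma exists_powr_le:
  assumes "0 < \<alpha>" "0 < (T :: real)" "0 \<le> C"
  shows "\<exists>t. 0 < t \<and> t \<le> 1 \<and> C * t powr \<alpha> \<le> T"
proof (intro exI conjI)
  let ?t = "min 1 ((T / (C + 1)) powr (1 / \<alpha>))"
  show "0 < ?t" using assms by auto
  show "?t \<le> 1" by simp
  have "?t powr \<alpha> \<le> ((T / (C + 1)) powr (1 / \<alpha>)) powr \<alpha>"
    using assms by (intro powr_mono2) auto
  also have "\<dots> = T / (C + 1)" using assms by (simp add: powr_powr)
  finally have "C * ?t powr \<alpha> \<le> C * (T / (C + 1))" using assms by (intro mult_left_mono) auto
  also have "\<dots> \<le> T" using assms by (simp add: divide_le_eq algebra_simps)
  finally show "C * ?t powr \<alpha> \<le> T" .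
qed

text \<open>The scale has to be fixed before \<open>\<epsilon>\<close>: first the scale, then the ellipticity bound inside the
  block, then the time horizon, and finally the probability of a step to the left.\<close>

lemma exists_base_scale:
  fixes k :: "'n::finite"
  assumes \<alpha>: "0 < \<alpha>" and C: "0 \<le> C"
  obtains l0 \<epsilon> where "0 < \<epsilon>" and "\<And>l. l0 \<le> l \<Longrightarrow> large_scale CARD('n) C \<alpha> (22 * real CARD('n)) l"
    and "\<And>\<mu>. tail_environment \<mu> k C \<alpha> \<Longrightarrow> (\<integral>\<^sup>+p. ennreal (p (- axis k 1)) \<partial>\<mu>) \<le> ennreal \<epsilon> \<Longrightarrow>
      tail_environment.prob_bad \<mu> k l0 \<le> real l0 powr (- (22 * real CARD('n)))"
proof -
  define M0 where "M0 = 22 * real CARD('n)"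
  obtain t where t: "0 < t" "t \<le> 1" "C * t powr \<alpha> \<le> 1 / 2"
    using exists_powr_le[OF \<alpha> _ C, of "1 / 2"] by auto
  \<comment> \<open>Visiting \<open>l^2\<close> sites costs \<open>exp (- c * l^2)\<close>, which
    beats the factor \<open>2 powr l\<close> from the discount; a width linear in \<open>l\<close>
    would depend on the size of \<open>c\<close>.\<close>
  define c where "c = - ln (1 - t / 4)"
  have c: "0 < c" using t by (simp add: c_def)
  have "eventually (\<lambda>l. 16 * 2 powr real l * exp (- c * real l ^ 2) \<le> real l powr (- M0) / 4) sequentially"
    using c by real_asymp
  then have "eventually (\<lambda>l. 16 * 2 powr real l * exp (- c * real l ^ 2) \<le> real l powr (- M0) / 4 \<and>
      large_scale CARD('n) C \<alpha> M0 l) sequentially"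
    using eventually_large_scale[OF \<alpha>] by eventually_elim simp
  then obtain l0 where l0: "\<And>l. l0 \<le> l \<Longrightarrow> 16 * 2 powr real l * exp (- c * real l ^ 2) \<le> real l powr (- M0) / 4 \<and>
      large_scale CARD('n) C \<alpha> M0 l"
    by (auto simp: eventually_sequentially)
  have l0_ge: "130 \<le> l0" using l0[of l0] by (simp add: large_scale_def)
  \<comment> \<open>A quarter of the target for each of the four terms of
    \<open>prob_bad_le\<close>.\<close>
  define T where "T = real l0 powr (- M0) / 4"
  have T: "0 < T" using l0_ge by (simp add: T_def)
  have "(1 - t / 4) ^ (l0 ^ 2) = exp (- c * real l0 ^ 2)"
  proof -
    have "exp (- c * real l0 ^ 2) = exp (real (l0 ^ 2) * ln (1 - t / 4))" by (simp add: c_def mult.commute)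
    also have "\<dots> = (exp (ln (1 - t / 4))) ^ (l0 ^ 2)" by (rule exp_of_nat_mult)
    also have "exp (ln (1 - t / 4)) = 1 - t / 4" using t by (intro exp_ln) simp
    finally show ?thesis by simp
  qed
  then have 1: "16 * 2 powr real l0 * (1 - t / 4) ^ (l0 ^ 2) \<le> T" using l0[of l0] by (simp add: T_def)
  define n where "n = card (slab k (int l0) (int l0 ^ 2))"
  obtain \<kappa> where \<kappa>: "0 < \<kappa>" "\<kappa> \<le> 1" "(n * C) * \<kappa> powr \<alpha> \<le> T"
    using exists_powr_le[OF \<alpha> T, of "n * C"] C by auto
  obtain N where "(1 - \<kappa> / 2) ^ N < T / (16 * 2 powr real l0)"
    using real_arch_pow_inv[of "T / (16 * 2 powr real l0)" "1 - \<kappa> / 2"] T \<kappa> by auto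
  then have 2: "16 * 2 powr real l0 * (1 - \<kappa> / 2) ^ N \<le> T" by (simp add: field_simps)
  define \<epsilon> where "\<epsilon> = T / (16 * real N * n + 1)"
  have pos: "0 < 16 * real N * n + 1" by (intro add_nonneg_pos mult_nonneg_nonneg) auto
  then have \<epsilon>: "0 < \<epsilon>" unfolding \<epsilon>_def using T by (intro divide_pos_pos)
  have "16 * N * n * \<epsilon> \<le> (16 * real N * n + 1) * \<epsilon>" using \<epsilon> by (intro mult_right_mono) auto
  also have "\<dots> = T" using pos by (simp only: \<epsilon>_def nonzero_mult_div_cancel_left times_divide_eq_right)
  finally have 3: "16 * N * n * \<epsilon> \<le> T" .
  show thesis
  proof (rule that[OF \<epsilon>])
    show "large_scale CARD('n) C \<alpha> (22 * real CARD('n)) l" if "l0 \<le> l" for l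
      using l0[OF that] by (simp add: M0_def)
    fix \<mu> assume \<mu>: "tail_environment \<mu> k C \<alpha>" "(\<integral>\<^sup>+p. ennreal (p (- axis k 1)) \<partial>\<mu>) \<le> ennreal \<epsilon>"
    have "tail_environment.prob_bad \<mu> k l0 \<le> n * (C * \<kappa> powr \<alpha>) +
        16 * (real N * real n * \<epsilon> + 2 powr l0 * ((1 - t / 4) ^ (l0 ^ 2) + (1 - \<kappa> / 2) ^ N))"
      using l0_ge \<epsilon> by (intro tail_environment.prob_bad_le[OF \<mu>(1) _ \<kappa>(1,2) t \<mu>(2) _ n_def]) auto
    also have "\<dots> = (n * C) * \<kappa> powr \<alpha> + 16 * N * n * \<epsilon> + 16 * 2 powr l0 * (1 - t / 4) ^ (l0 ^ 2) +
        16 * 2 powr l0 * (1 - \<kappa> / 2) ^ N"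
      by (simp add: algebra_simps)
    also have "\<dots> \<le> 4 * T" using 1 2 3 \<kappa>(3) by linarith
    finally show "tail_environment.prob_bad \<mu> k l0 \<le> real l0 powr (- (22 * real CARD('n)))"
      by (simp add: T_def M0_def)
  qed
qed

section \<open>The annealed law\<close>

abbreviation wrong_exit :: "'n::finite \<Rightarrow> (int ^ 'n) set \<Rightarrow> int \<Rightarrow> (nat \<Rightarrow> int ^ 'n) set" where
  "wrong_exit k A n \<equiv>
     {X. exit_time A X < \<infinity> \<and> real_vec (X (the_enat (exit_time A X))) \<bullet> axis k 1 < real_of_int n}"

lemma exit_time_eqI:
  assumes "\<And>m. m < n \<Longrightarrow> X m \<in> A" "X n \<notin> A"
  shows "exit_time A X = enat n"
  unfolding exit_time_def
proof (rule antisym[OF INF_lower INF_greatest])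
  fix m assume "m \<in> {m. X m \<notin> A}"
  then show "enat n \<le> enat m" using assms(1)[of m] by (auto simp: not_less[symmetric])
qed (use assms in auto)

lemma sets_cylinder: "{X :: nat \<Rightarrow> int ^ 'n. \<forall>i\<le>j. X i = a i} \<in> sets path_algebra"
proof -
  have "{X. X i = a i} \<in> sets path_algebra" for i
    using measurable_sets[OF measurable_component_singleton[of i UNIV "\<lambda>_. count_space UNIV"], of "{a i}"]
    by (simp add: space_PiM vimage_def)
  moreover have "{X. \<forall>i\<le>j. X i = a i} = (\<Inter>i\<in>{..j}. {X. X i = a i})" by auto
  ultimately show ?thesis by (simp only:) (intro sets.finite_INT; simp)
qed

text \<open>A walk that first leaves the slab through the right face has stayed in \<open>A\<close>
  until then and leaves \<open>A\<close> at that very moment, since \<open>A\<close> lies below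
  level \<open>n\<close>; so a wrong exit from \<open>A\<close> entails a failure in the slab. The
  recursion of \<open>fail\<close> is followed along cylinders, whose probabilities are
  explicit.\<close>

lemma quenched_law_bad_exit_le:
  fixes k :: "'n::finite" and A :: "(int ^ 'n) set"
  assumes \<omega>: "\<omega> \<in> space env_algebra"
    and A: "slab k n w \<subseteq> A" "\<And>x. x \<in> A \<Longrightarrow> x $ k < n" and n: "0 < n" "0 < w"
  shows "emeasure (quenched_law 0 \<omega>) (wrong_exit k A n) \<le> ennreal (fail k n w \<omega> N 0)"
proof -
  let ?Q = "quenched_law 0 \<omega>"
  let ?B = "wrong_exit k A n"
  define cyl where "cyl j a = {X :: nat \<Rightarrow> int ^ 'n. \<forall>i\<le>j. X i = a i}" for j :: nat and a :: "nat \<Rightarrow> int ^ 'n"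
  interpret Q: prob_space ?Q by (rule prob_space_quenched_law[OF \<omega>])
  note sQ = prob_space_quenched_law(2)[OF \<omega>, of 0]
  have spQ: "space ?Q = UNIV" using sets_eq_imp_space_eq[OF sQ] by (simp add: space_PiM)
  have env: "\<omega> y \<in> prob_vectors" for y using \<omega> by (simp add: space_env)
  have B: "?B \<in> sets ?Q" unfolding sQ by (rule sets_exit_event)
  have C: "cyl j a \<in> sets ?Q" for j a unfolding sQ cyl_def by (rule sets_cylinder)
  have em_cyl: "emeasure ?Q (cyl j a) = (if a 0 = 0 then \<Prod>i<j. if a (Suc i) - a i \<in> unit_steps
      then ennreal (\<omega> (a i) (a (Suc i) - a i)) else 0 else 0)" for j a
    unfolding cyl_def by (rule quenched_law_cylinder[OF \<omega>])
  have step: "emeasure ?Q (cyl (Suc j) (a(Suc j := a j + e))) = emeasure ?Q (cyl j a) * ennreal (\<omega> (a j) e)"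
    if "e \<in> unit_steps" for j a e
  proof -
    let ?a = "a(Suc j := a j + e)"
    have "(\<Prod>i<j. if ?a (Suc i) - ?a i \<in> unit_steps then ennreal (\<omega> (?a i) (?a (Suc i) - ?a i)) else 0) =
        (\<Prod>i<j. if a (Suc i) - a i \<in> unit_steps then ennreal (\<omega> (a i) (a (Suc i) - a i)) else 0)"
      by (rule prod.cong) auto
    then show ?thesis using that unfolding em_cyl by (simp only: prod.lessThan_Suc) simp
  qed
  have right: "cyl j a \<inter> ?B = {}" if a: "\<And>i. i < j \<Longrightarrow> a i \<in> slab k n w" "n \<le> a j $ k" for j a
  proof -
    have False if X: "X \<in> cyl j a" "X \<in> ?B" for X
    proof -
      have "exit_time A X = enat j"
        using X(1) a A by (intro exit_time_eqI) (force simp: cyl_def)+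
      then show False using X a(2) by (simp add: cyl_def inner_axis real_vec_def)
    qed
    then show ?thesis by blast
  qed
  have main: "emeasure ?Q (cyl j a \<inter> ?B) \<le> emeasure ?Q (cyl j a) * ennreal (fail k n w \<omega> N (a j))"
    if "\<And>i. i < j \<Longrightarrow> a i \<in> slab k n w" for N j a
    using that
  proof (induction N arbitrary: j a)
    case (0 j a)
    show ?case
    proof (cases "n \<le> a j $ k")
      case True
      have "cyl j a \<inter> ?B = {}" by (rule right) (use 0 True in auto)
      then show ?thesis by simp
    next
      case False
      then show ?thesis using C by (simp add: emeasure_mono)
    qed
  next
    case (Suc N j a)
    consider "n \<le> a j $ k" | "a j $ k < n" "a j \<notin> slab k n w" | "a j \<in> slab k n w" by linarith
    then show ?case
    proof cases
      case 1
      have "cyl j a \<inter> ?B = {}" by (rule right) (use Suc.prems 1 in auto)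
      then show ?thesis by simp
    next
      case 2
      then show ?thesis using C by (simp add: emeasure_mono)
    next
      case 3
      then have "a j $ k < n" by (auto simp: slab_def)
      define D where "D e = cyl (Suc j) (a(Suc j := a j + e))" for e
      have D: "D e \<in> sets ?Q" for e unfolding D_def by (rule C)
      have Dsub: "D e \<subseteq> cyl j a" for e by (auto simp: D_def cyl_def split: if_splits)
      have disj: "disjoint_family_on D unit_steps"
        by (auto simp: disjoint_family_on_def D_def cyl_def)
      have emD: "emeasure ?Q (D e) = emeasure ?Q (cyl j a) * ennreal (\<omega> (a j) e)" if "e \<in> unit_steps" for e
        unfolding D_def by (rule step[OF that])
      have UD: "(\<Union>e\<in>unit_steps. D e) \<in> sets ?Q" using D by (intro sets.finite_UN) auto
      have total: "emeasure ?Q (\<Union>e\<in>unit_steps. D e) = emeasure ?Q (cyl j a)"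
      proof -
        have "emeasure ?Q (\<Union>e\<in>unit_steps. D e) = (\<Sum>e\<in>unit_steps. emeasure ?Q (D e))"
          using D disj by (intro sum_emeasure[symmetric]) auto
        also have "\<dots> = emeasure ?Q (cyl j a) * (\<Sum>e\<in>unit_steps. ennreal (\<omega> (a j) e))"
          by (simp add: emD sum_distrib_left)
        also have "(\<Sum>e\<in>unit_steps. ennreal (\<omega> (a j) e)) = 1"
          using prob_vectorsD[OF env[of "a j"]] by (simp add: sum_ennreal)
        finally show ?thesis by simp
      qed
      \<comment> \<open>The one-step continuations by unit steps exhaust the cylinder up to a null
        set, since their probabilities already add up to that of the cylinder.\<close>
      have null: "emeasure ?Q (cyl j a - (\<Union>e\<in>unit_steps. D e)) = 0"
        using total Dsub C UD by (subst emeasure_Diff) auto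
      have "emeasure ?Q (cyl j a \<inter> ?B) \<le> emeasure ?Q ((\<Union>e\<in>unit_steps. D e \<inter> ?B) \<union> (cyl j a - (\<Union>e\<in>unit_steps. D e)))"
        using D C B UD by (intro emeasure_mono sets.Un sets.finite_UN sets.Diff sets.Int) auto
      also have "\<dots> \<le> emeasure ?Q (\<Union>e\<in>unit_steps. D e \<inter> ?B) + emeasure ?Q (cyl j a - (\<Union>e\<in>unit_steps. D e))"
        using D C B UD by (intro emeasure_subadditive sets.finite_UN sets.Diff sets.Int) auto
      also have "\<dots> = emeasure ?Q (\<Union>e\<in>unit_steps. D e \<inter> ?B)" using null by simp
      also have "\<dots> \<le> (\<Sum>e\<in>unit_steps. emeasure ?Q (D e \<inter> ?B))"
        using D B by (intro emeasure_subadditive_finite) auto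
      also have "\<dots> \<le> (\<Sum>e\<in>unit_steps. emeasure ?Q (D e) * ennreal (fail k n w \<omega> N (a j + e)))"
      proof (rule sum_mono)
        fix e
        have "emeasure ?Q (cyl (Suc j) (a(Suc j := a j + e)) \<inter> ?B) \<le>
            emeasure ?Q (cyl (Suc j) (a(Suc j := a j + e))) * ennreal (fail k n w \<omega> N ((a(Suc j := a j + e)) (Suc j)))"
          by (rule Suc.IH) (use Suc.prems 3 in \<open>auto simp: less_Suc_eq\<close>)
        then show "emeasure ?Q (D e \<inter> ?B) \<le> emeasure ?Q (D e) * ennreal (fail k n w \<omega> N (a j + e))"
          by (simp add: D_def)
      qed
      also have "\<dots> = emeasure ?Q (cyl j a) * (\<Sum>e\<in>unit_steps. ennreal (\<omega> (a j) e) * ennreal (fail k n w \<omega> N (a j + e)))"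
        by (simp add: emD sum_distrib_left mult.assoc)
      also have "(\<Sum>e\<in>unit_steps. ennreal (\<omega> (a j) e) * ennreal (fail k n w \<omega> N (a j + e))) =
          (\<Sum>e\<in>unit_steps. ennreal (\<omega> (a j) e * fail k n w \<omega> N (a j + e)))"
        by (intro sum.cong refl ennreal_mult[symmetric] prob_vectorsD(1)[OF env] fail_bounds[OF env])
      also have "\<dots> = ennreal (\<Sum>e\<in>unit_steps. \<omega> (a j) e * fail k n w \<omega> N (a j + e))"
        by (intro sum_ennreal mult_nonneg_nonneg prob_vectorsD(1)[OF env] fail_bounds[OF env])
      finally show ?thesis using 3 \<open>a j $ k < n\<close> by simp
    qed
  qed
  have c1: "emeasure ?Q (cyl 0 (\<lambda>_. 0)) = 1" unfolding em_cyl by simp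
  then have "emeasure ?Q (UNIV - cyl 0 (\<lambda>_. 0)) = 0"
    using Q.emeasure_space_1 C[of 0 "\<lambda>_. 0"] sets.top[of ?Q] unfolding spQ by (subst emeasure_Diff) auto
  then have "emeasure ?Q ?B \<le> emeasure ?Q (cyl 0 (\<lambda>_. 0) \<inter> ?B) + 0"
    using B C[of 0 "\<lambda>_. 0"] sets.top[of ?Q] emeasure_mono[of ?B "(cyl 0 (\<lambda>_. 0) \<inter> ?B) \<union> (UNIV - cyl 0 (\<lambda>_. 0))" ?Q]
      emeasure_subadditive[of "cyl 0 (\<lambda>_. 0) \<inter> ?B" ?Q "UNIV - cyl 0 (\<lambda>_. 0)"]
    unfolding spQ by (force intro: order_trans)
  also have "\<dots> \<le> 1 * ennreal (fail k n w \<omega> N 0)"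
    using main[of 0 "\<lambda>_. 0" N] c1 by simp
  finally show ?thesis by simp
qed

text \<open>\<open>R\<close> fixes the axis and hence preserves the coordinate \<open>k\<close>, but
  it may turn the orthogonal hyperplane arbitrarily. The Euclidean norm of the lateral part is
  invariant and below \<open>d * n^2\<close> on the slab, so this half-width serves every such
  \<open>R\<close>.\<close>

lemma tilted_box_bounds:
  fixes k :: "'n::finite"
  assumes R: "rotation_matrix R" "R *v axis k 1 = axis k 1" and n: "0 < n"
  shows "slab k (int n) (int n ^ 2) \<subseteq> tilted_box k R n (CARD('n) * real n ^ 2)"
    and "\<And>x. x \<in> tilted_box k R n L' \<Longrightarrow> x $ k < int n"
proof -
  have orth: "orthogonal_matrix R" using R by (simp add: rotation_matrix_def)
  then have inv: "transpose R ** R = mat 1" "R ** transpose R = mat 1" by (auto simp: orthogonal_matrix_def)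
  have lev: "(R *v v) $ k = v $ k" for v
  proof -
    have "(R *v v) $ k = (R *v v) \<bullet> (R *v axis k 1)" by (simp add: R(2) inner_axis)
    also have "\<dots> = v \<bullet> axis k 1"
      using orth by (metis dot_lmul_matrix inv(1) matrix_vector_mul_assoc matrix_vector_mul_lid vector_transpose_matrix transpose_transpose)
    finally show ?thesis by (simp add: inner_axis)
  qed
  show "x $ k < int n" if x: "x \<in> tilted_box k R n L'" for x
  proof -
    obtain v where "real_vec x = R *v v" "v $ k < n" using x by (auto simp: tilted_box_def)
    then have "real_vec x $ k < n" by (simp add: lev)
    then show ?thesis by (simp add: real_vec_def)
  qed
  show "slab k (int n) (int n ^ 2) \<subseteq> tilted_box k R n (CARD('n) * real n ^ 2)"
  proof
    fix x assume x: "x \<in> slab k (int n) (int n ^ 2)"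
    define v where "v = transpose R *v real_vec x"
    have Rv: "R *v v = real_vec x" unfolding v_def by (simp only: matrix_vector_mul_assoc inv matrix_vector_mul_lid)
    have vk: "v $ k = real_of_int (x $ k)" using lev[of v] by (simp add: Rv real_vec_def)
    have bound: "\<bar>v $ i\<bar> < CARD('n) * real n ^ 2" if "i \<noteq> k" for i
    proof -
      define y where "y = real_vec x - real_of_int (x $ k) *\<^sub>R axis k 1"
      have "R *v (v - real_of_int (x $ k) *\<^sub>R axis k 1) = y"
        by (simp add: y_def Rv matrix_vector_mult_diff_distrib matrix_vector_mult_scaleR R(2))
      then have ny: "norm (v - real_of_int (x $ k) *\<^sub>R axis k 1) = norm y"
        using orth by (metis orthogonal_transformation_matrix orthogonal_transformation_norm matrix_of_matrix_vector_mul matrix_vector_mul_linear orthogonal_transformation)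
      have yi: "\<bar>y $ j\<bar> < real n ^ 2" for j
      proof (cases "j = k")
        case True
        then show ?thesis using n by (simp add: y_def real_vec_def axis_def)
      next
        case False
        then have "\<bar>x $ j\<bar> < int n ^ 2" using x by (simp add: slab_def)
        then have "real_of_int \<bar>x $ j\<bar> < real_of_int (int n ^ 2)" by (simp only: of_int_less_iff)
        then show ?thesis using False by (simp add: y_def real_vec_def axis_def)
      qed
      have "\<bar>v $ i\<bar> = \<bar>(v - real_of_int (x $ k) *\<^sub>R axis k 1) $ i\<bar>" using that by (simp add: axis_def)
      also have "\<dots> \<le> norm y" using component_le_norm_cart ny by metis
      also have "\<dots> \<le> (\<Sum>j\<in>UNIV. \<bar>y $ j\<bar>)" by (rule norm_le_l1_cart)
      also have "\<dots> < (\<Sum>j\<in>(UNIV :: 'n set). real n ^ 2)" by (intro sum_strict_mono yi) auto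
      finally show ?thesis by simp
    qed
    have "v $ k \<in> {- real n<..<real n}"
    proof -
      have "\<bar>x $ k\<bar> < int n" using x by (simp add: slab_def)
      then have "real_of_int \<bar>x $ k\<bar> < real_of_int (int n)" by (simp only: of_int_less_iff)
      then show ?thesis by (auto simp: vk)
    qed
    moreover have "\<forall>i. i \<noteq> k \<longrightarrow> v $ i \<in> {- (CARD('n) * real n ^ 2)<..<CARD('n) * real n ^ 2}"
      using bound by (fastforce simp: abs_less_iff)
    ultimately show "x \<in> tilted_box k R n (CARD('n) * real n ^ 2)"
      unfolding tilted_box_def using Rv by (auto intro!: image_eqI[of _ _ v])
  qed
qed

context iid_environment
begin

lemma annealed_law_bad_exit_le:
  fixes k :: 'n
  assumes R: "rotation_matrix R" "R *v axis k 1 = axis k 1" and n: "0 < n"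
    and E: "E \<in> sets env_law" and \<delta>: "0 \<le> \<delta>"
    and fail: "\<And>\<omega>. \<omega> \<in> space env_law - E \<Longrightarrow> fail_inf k \<omega> (int n) (int n ^ 2) 0 \<le> \<delta>"
  defines "A \<equiv> tilted_box k R n (CARD('n) * real n ^ 2)"
  shows "measure (annealed_law env_law 0) (wrong_exit k A (int n)) \<le> env.prob E + \<delta>"
proof -
  let ?B = "wrong_exit k A (int n)"
  have "emeasure (annealed_law env_law 0) ?B = (\<integral>\<^sup>+\<omega>. emeasure (quenched_law 0 \<omega>) ?B \<partial>env_law)"
    by (rule emeasure_annealed_law[OF env.prob_space_axioms sets_env_law sets_exit_event])
  also have "\<dots> \<le> (\<integral>\<^sup>+\<omega>. indicator E \<omega> + ennreal \<delta> \<partial>env_law)"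
  proof (rule nn_integral_mono)
    fix \<omega> assume \<omega>: "\<omega> \<in> space env_law"
    then have \<omega>': "\<omega> \<in> space env_algebra" using sets_eq_imp_space_eq[OF sets_env_law] by simp
    show "emeasure (quenched_law 0 \<omega>) ?B \<le> indicator E \<omega> + ennreal \<delta>"
    proof (cases "\<omega> \<in> E")
      case True
      interpret Q: prob_space "quenched_law 0 \<omega>" by (rule prob_space_quenched_law[OF \<omega>'])
      show ?thesis using Q.emeasure_le_1[of ?B] True by (simp add: add_increasing2)
    next
      case False
      have le: "emeasure (quenched_law 0 \<omega>) ?B \<le> ennreal (fail k (int n) (int n ^ 2) \<omega> N 0)" for N
        using quenched_law_bad_exit_le[OF \<omega>', of k "int n" "int n ^ 2" A N] tilted_box_bounds[OF R n] n
        by (simp add: A_def)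
      have "(\<lambda>N. ennreal (fail k (int n) (int n ^ 2) \<omega> N 0)) \<longlonglongrightarrow> ennreal (fail_inf k \<omega> (int n) (int n ^ 2) 0)"
        by (intro tendsto_ennrealI fail_inf_lim space_env_lawD[OF \<omega>])
      then have "emeasure (quenched_law 0 \<omega>) ?B \<le> ennreal (fail_inf k \<omega> (int n) (int n ^ 2) 0)"
        by (rule LIMSEQ_le_const) (use le in blast)
      also have "\<dots> \<le> ennreal \<delta>" using fail False \<omega> by (intro ennreal_leI) auto
      finally show ?thesis using False by simp
    qed
  qed
  also have "\<dots> = ennreal (env.prob E + \<delta>)"
    using E \<delta> by (simp add: nn_integral_add env.emeasure_eq_measure env.prob_space flip: ennreal_mult)
  finally have "emeasure (annealed_law env_law 0) ?B \<le> ennreal (env.prob E + \<delta>)" .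
  moreover have "0 \<le> env.prob E + \<delta>" using \<delta> by (intro add_nonneg_nonneg measure_nonneg)
  ultimately show ?thesis
    unfolding measure_def[of "annealed_law env_law 0"] by (intro enn2real_leI)
qed

end

section \<open>Moments of the Dirichlet law\<close>

text \<open>As the kernels vanish on the negative half-line, their product encodes the simplex constraint.\<close>

definition gamma_kernel :: "real \<Rightarrow> real \<Rightarrow> ennreal" where
  "gamma_kernel a x = ennreal (x powr (a - 1)) * indicator {0<..} x"

lemma measurable_gamma_kernel [measurable]: "gamma_kernel a \<in> borel_measurable borel"
  unfolding gamma_kernel_def[abs_def] by measurable

text \<open>Euler's Beta integral after the substitution \<open>x = t * y\<close>; for
  \<open>t \<le> 0\<close> one of the two kernels always vanishes.\<close>

lemma gamma_kernel_convolution: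
  assumes a: "0 < a" and c: "0 < c"
  shows "(\<integral>\<^sup>+x. gamma_kernel a x * gamma_kernel c (t - x) \<partial>lborel) = ennreal (Beta a c) * gamma_kernel (a + c) t"
proof (cases "0 < t")
  case False
  then have 0: "gamma_kernel a x * gamma_kernel c (t - x) = 0" for x
    by (auto simp: gamma_kernel_def indicator_def)
  have "gamma_kernel (a + c) t = 0" using False by (simp add: gamma_kernel_def)
  then show ?thesis by (simp only: 0 nn_integral_const mult_zero_left mult_zero_right)
next
  case True
  have "ennreal (Beta a c) = (\<integral>\<^sup>+y. indicator {0..1} y * ennreal (y powr (a - 1) * (1 - y) powr (c - 1)) \<partial>lborel)"
    using nn_integral_has_integral_lebesgue[OF _ has_integral_Beta_real[OF a c]]
    by (simp add: ennreal_mult' ennreal_indicator)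
  also have "\<dots> = (\<integral>\<^sup>+y. gamma_kernel a y * gamma_kernel c (1 - y) \<partial>lborel)"
    by (intro nn_integral_cong) (auto simp: gamma_kernel_def indicator_def ennreal_mult')
  finally have B: "(\<integral>\<^sup>+y. gamma_kernel a y * gamma_kernel c (1 - y) \<partial>lborel) = ennreal (Beta a c)" by simp
  have "(\<integral>\<^sup>+x. gamma_kernel a x * gamma_kernel c (t - x) \<partial>lborel) =
      ennreal \<bar>t\<bar> * (\<integral>\<^sup>+y. gamma_kernel a (0 + t * y) * gamma_kernel c (t - (0 + t * y)) \<partial>lborel)"
    using True by (intro nn_integral_real_affine) auto
  also have "(\<integral>\<^sup>+y. gamma_kernel a (0 + t * y) * gamma_kernel c (t - (0 + t * y)) \<partial>lborel) =
      (\<integral>\<^sup>+y. ennreal (t powr (a + c - 2)) * (gamma_kernel a y * gamma_kernel c (1 - y)) \<partial>lborel)"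
  proof (rule nn_integral_cong)
    fix y
    show "gamma_kernel a (0 + t * y) * gamma_kernel c (t - (0 + t * y)) =
        ennreal (t powr (a + c - 2)) * (gamma_kernel a y * gamma_kernel c (1 - y))"
    proof (cases "0 < y \<and> y < 1")
      case False
      have "\<not> 0 < t * y \<or> \<not> 0 < t - t * y"
        using False True by (simp add: zero_less_mult_iff)
      then show ?thesis using False by (auto simp: gamma_kernel_def indicator_def)
    next
      case y: True
      have 1: "0 < t * y" "0 < t - t * y" using y True by auto
      have "t - t * y = t * (1 - y)" by (simp add: algebra_simps)
      then have "(t * y) powr (a - 1) * (t - t * y) powr (c - 1) =
          t powr (a - 1) * t powr (c - 1) * (y powr (a - 1) * (1 - y) powr (c - 1))"
        using y True by (simp add: powr_mult)
      also have "t powr (a - 1) * t powr (c - 1) = t powr (a + c - 2)"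
        by (simp flip: powr_add)
      finally show ?thesis using y 1 by (simp add: gamma_kernel_def flip: ennreal_mult)
    qed
  qed
  also have "\<dots> = ennreal (t powr (a + c - 2)) * ennreal (Beta a c)"
    by (subst nn_integral_cmult) (auto simp: B)
  also have "ennreal \<bar>t\<bar> * (ennreal (t powr (a + c - 2)) * ennreal (Beta a c)) = ennreal (Beta a c) * gamma_kernel (a + c) t"
  proof -
    have "t * t powr (a + c - 2) = t powr (a + c - 1)"
      using True powr_add[of t 1 "a + c - 2"] by (simp add: algebra_simps)
    then have "gamma_kernel (a + c) t = ennreal t * ennreal (t powr (a + c - 2))"
      using True by (simp add: gamma_kernel_def flip: ennreal_mult)
    then show ?thesis using True by (simp only: abs_of_pos mult_ac)
  qed
  finally show ?thesis .
qed

text \<open>Coordinates are integrated out one at a time: a convolution merges the removed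
  coordinate with the residual one and replaces \<open>c\<close> by \<open>a i + c\<close>. Hence
  \<open>c\<close> has to vary in the induction, and the Beta factors telescope.\<close>

lemma nn_integral_dirichlet:
  fixes a :: "'i \<Rightarrow> real"
  assumes "finite I" "\<And>i. i \<in> I \<Longrightarrow> 0 < a i" "0 < c"
  shows "(\<integral>\<^sup>+q. (\<Prod>i\<in>I. gamma_kernel (a i) (q i)) * gamma_kernel c (t - (\<Sum>i\<in>I. q i)) \<partial>PiM I (\<lambda>_. lborel)) =
    ennreal ((\<Prod>i\<in>I. Gamma (a i)) * Gamma c / Gamma ((\<Sum>i\<in>I. a i) + c)) * gamma_kernel ((\<Sum>i\<in>I. a i) + c) t"
  using assms
proof (induction I arbitrary: c rule: finite_induct)
  case empty
  then have "0 < Gamma c" by (intro Gamma_real_pos) simp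
  then show ?case by (simp add: PiM_empty nn_integral_count_space_finite)
next
  case (insert i I)
  interpret product_sigma_finite "\<lambda>_ :: 'i. lborel :: real measure" by standard
  let ?P = "\<lambda>q. \<Prod>j\<in>I. gamma_kernel (a j) (q j)"
  have a: "0 < a i" "\<And>j. j \<in> I \<Longrightarrow> 0 < a j" using insert.prems by auto
  have comp: "(\<lambda>q. q j) \<in> borel_measurable (PiM J (\<lambda>_. lborel :: real measure))" if "j \<in> J" for j and J :: "'i set"
    using measurable_component_singleton[OF that, of "\<lambda>_. lborel :: real measure"] by simp
  note meas = borel_measurable_times_ennreal borel_measurable_prod_ennreal borel_measurable_const comp
    measurable_compose[OF _ measurable_gamma_kernel] borel_measurable_diff borel_measurable_sum
  have "(\<integral>\<^sup>+q. (\<Prod>j\<in>insert i I. gamma_kernel (a j) (q j)) * gamma_kernel c (t - (\<Sum>j\<in>insert i I. q j)) \<partial>PiM (insert i I) (\<lambda>_. lborel)) =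
      (\<integral>\<^sup>+q. (\<integral>\<^sup>+x. (\<Prod>j\<in>insert i I. gamma_kernel (a j) ((q(i := x)) j)) *
        gamma_kernel c (t - (\<Sum>j\<in>insert i I. (q(i := x)) j)) \<partial>lborel) \<partial>PiM I (\<lambda>_. lborel))"
    using insert.hyps
    by (intro product_nn_integral_insert meas)
  also have "\<dots> = (\<integral>\<^sup>+q. ennreal (Beta (a i) c) *
      (?P q * gamma_kernel (a i + c) (t - sum q I)) \<partial>PiM I (\<lambda>_. lborel))"
  proof (rule nn_integral_cong)
    fix q :: "'i \<Rightarrow> real"
    have s: "(\<Prod>j\<in>insert i I. gamma_kernel (a j) ((q(i := x)) j)) * gamma_kernel c (t - (\<Sum>j\<in>insert i I. (q(i := x)) j)) =
       ?P q * (gamma_kernel (a i) x * gamma_kernel c ((t - sum q I) - x))" for x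
    proof -
      have "(\<Prod>j\<in>I. gamma_kernel (a j) ((q(i := x)) j)) = ?P q"
        by (rule prod.cong) (use insert.hyps in auto)
      moreover have "(\<Sum>j\<in>I. (q(i := x)) j) = sum q I"
        by (rule sum.cong) (use insert.hyps in auto)
      ultimately show ?thesis
        using insert.hyps by (simp add: mult_ac diff_diff_eq add.commute[of "sum q I" x])
    qed
    have "(\<integral>\<^sup>+x. ?P q * (gamma_kernel (a i) x * gamma_kernel c ((t - sum q I) - x)) \<partial>lborel) =
        ?P q * (ennreal (Beta (a i) c) * gamma_kernel (a i + c) (t - sum q I))"
      by (subst nn_integral_cmult) (auto simp: gamma_kernel_convolution[OF a(1) insert.prems(2)])
    then show "(\<integral>\<^sup>+x. (\<Prod>j\<in>insert i I. gamma_kernel (a j) ((q(i := x)) j)) *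
        gamma_kernel c (t - (\<Sum>j\<in>insert i I. (q(i := x)) j)) \<partial>lborel) =
        ennreal (Beta (a i) c) * (?P q * gamma_kernel (a i + c) (t - sum q I))"
      unfolding s by (simp only: mult_ac)
  qed
  also have "\<dots> = ennreal (Beta (a i) c) * (\<integral>\<^sup>+q. ?P q *
      gamma_kernel (a i + c) (t - sum q I) \<partial>PiM I (\<lambda>_. lborel))"
    by (intro nn_integral_cmult meas)
  also have "\<dots> = ennreal (Beta (a i) c) * (ennreal ((\<Prod>i\<in>I. Gamma (a i)) * Gamma (a i + c) /
      Gamma ((\<Sum>i\<in>I. a i) + (a i + c))) * gamma_kernel ((\<Sum>i\<in>I. a i) + (a i + c)) t)"
    using a insert.prems(2) by (subst insert.IH) auto
  also have "\<dots> = ennreal ((\<Prod>i\<in>insert i I. Gamma (a i)) * Gamma c / Gamma ((\<Sum>i\<in>insert i I. a i) + c)) *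
      gamma_kernel ((\<Sum>i\<in>insert i I. a i) + c) t"
  proof -
    have eq: "(\<Sum>i\<in>I. a i) + (a i + c) = (\<Sum>i\<in>insert i I. a i) + c" using insert.hyps by simp
    have "0 \<le> (\<Sum>i\<in>I. a i)" using a(2) by (intro sum_nonneg) (auto intro: less_imp_le)
    then have pos: "0 < Gamma (a i + c)" "0 < Gamma ((\<Sum>i\<in>insert i I. a i) + c)"
      using a insert.prems(2) insert.hyps by (auto intro!: Gamma_real_pos)
    have "0 \<le> (\<Prod>i\<in>I. Gamma (a i))" using a(2) by (intro prod_nonneg) (auto intro!: less_imp_le[OF Gamma_real_pos])
    moreover have "0 \<le> Beta (a i) c"
      using a(1) insert.prems(2) pos by (auto simp: Beta_def intro!: divide_nonneg_pos mult_nonneg_nonneg less_imp_le[OF Gamma_real_pos])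
    moreover have "Beta (a i) c * ((\<Prod>i\<in>I. Gamma (a i)) * Gamma (a i + c) / Gamma ((\<Sum>i\<in>insert i I. a i) + c)) =
        (\<Prod>i\<in>insert i I. Gamma (a i)) * Gamma c / Gamma ((\<Sum>i\<in>insert i I. a i) + c)"
      using pos insert.hyps by (simp add: Beta_def field_simps)
    ultimately show ?thesis
      unfolding eq using pos by (simp add: ennreal_mult' divide_nonneg_pos flip: mult.assoc ennreal_mult)
  qed
  finally show ?case .
qed

text \<open>Multiplying the density by powers of the coordinates shifts its parameters by
  \<open>s\<close>, so a mixed moment is a quotient of normalising constants. Prescribing
  \<open>g\<close> on positive vectors only is enough because the chart yields no others; this
  admits integrands with their own convention at \<open>0\<close>.\<close>

lemma nn_integral_dirichlet_law:
  fixes \<beta> s :: "int ^ 'n::finite \<Rightarrow> real"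
  assumes j: "j \<in> unit_steps" and \<beta>: "\<And>e. e \<in> unit_steps \<Longrightarrow> 0 < \<beta> e" and s: "\<And>e. e \<in> unit_steps \<Longrightarrow> 0 < \<beta> e + s e"
    and g: "g \<in> borel_measurable site_algebra"
    and eq: "\<And>p. (\<And>e. e \<in> unit_steps \<Longrightarrow> 0 < p e) \<Longrightarrow> g p = ennreal (\<Prod>e\<in>unit_steps. p e powr s e)"
  shows "(\<integral>\<^sup>+p. g p \<partial>dirichlet_law j \<beta>) =
    ennreal (Gamma (\<Sum>e\<in>unit_steps. \<beta> e) / (\<Prod>e\<in>unit_steps. Gamma (\<beta> e)) *
      ((\<Prod>e\<in>unit_steps. Gamma (\<beta> e + s e)) / Gamma (\<Sum>e\<in>unit_steps. \<beta> e + s e)))"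
proof -
  let ?U = "unit_steps :: (int ^ 'n) set"
  let ?J = "?U - {j}"
  let ?D = "\<lambda>q. (\<Prod>e\<in>?J. gamma_kernel (\<beta> e + s e) (q e)) *
    gamma_kernel (\<beta> j + s j) (1 - (\<Sum>e\<in>?J. q e))"
  let ?L = "PiM ?J (\<lambda>_. lborel :: real measure)"
  let ?R = "restrict_space ?L (simplex_chart j)"
  let ?c = "Gamma (\<Sum>e\<in>?U. \<beta> e) / (\<Prod>e\<in>?U. Gamma (\<beta> e))"
  have c0: "0 \<le> ?c"
    using \<beta> by (intro divide_nonneg_nonneg prod_nonneg) (auto intro!: less_imp_le[OF Gamma_real_pos] sum_pos simp: ex_in_conv[symmetric] intro: exI[of _ j] j)
  have m1: "complete_at j \<in> measurable ?R site_algebra" by (rule measurable_complete_at[OF j])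
  have mdens: "(\<lambda>p. ennreal (dirichlet_density \<beta> p)) \<in> borel_measurable site_algebra"
    unfolding dirichlet_density_def
    by (intro measurable_compose[OF _ measurable_ennreal] borel_measurable_times borel_measurable_const
        borel_measurable_prod powr_real_measurable measurable_site_component)
  have "(\<integral>\<^sup>+p. g p \<partial>dirichlet_law j \<beta>) =
      (\<integral>\<^sup>+q. g (complete_at j q) \<partial>density ?R (\<lambda>q. ennreal (dirichlet_density \<beta> (complete_at j q))))"
    unfolding dirichlet_law_def using m1 g by (intro nn_integral_distr) auto
  also have "\<dots> = (\<integral>\<^sup>+q. ennreal (dirichlet_density \<beta> (complete_at j q)) * g (complete_at j q) \<partial>?R)"
    by (intro nn_integral_density measurable_compose[OF m1 mdens] measurable_compose[OF m1 g])
  also have "\<dots> = (\<integral>\<^sup>+q. ennreal (dirichlet_density \<beta> (complete_at j q)) * g (complete_at j q) * indicator (simplex_chart j) q \<partial>?L)"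
    using measurable_complete_at(1)[OF j] by (intro nn_integral_restrict_space) (simp add: space_PiM Int_absorb2 sets.Int_space_eq2)
  also have "\<dots> = (\<integral>\<^sup>+q. ennreal ?c * ?D q \<partial>?L)"
  proof (rule nn_integral_cong)
    fix q assume q: "q \<in> space ?L"
    let ?p = "complete_at j q"
    have pj: "?p j = 1 - (\<Sum>e\<in>?J. q e)" and pe: "\<And>e. e \<in> ?J \<Longrightarrow> ?p e = q e" by (auto simp: complete_at_def)
    have rhs: "?D q =
        (\<Prod>e\<in>?U. gamma_kernel (\<beta> e + s e) (?p e))"
      using j pe by (simp add: prod.remove[of ?U j] pj mult.commute)
    show "ennreal (dirichlet_density \<beta> ?p) * g ?p * indicator (simplex_chart j) q =
        ennreal ?c * ?D q"
    \<comment> \<open>Positive coordinates are automatically at most \<open>1\<close>, because they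
      sum to \<open>1\<close>, so \<open>q\<close> is in the chart. Otherwise both sides
      vanish.\<close>
    proof (cases "\<forall>e\<in>?U. 0 < ?p e")
      case True
      have "?p e \<le> 1" if "e \<in> ?U" for e
      proof -
        have "(\<Sum>e\<in>?U. ?p e) = 1"
          using j pe by (simp add: sum.remove[of ?U j] pj)
        moreover have "?p e \<le> (\<Sum>e\<in>?U. ?p e)" using True that by (intro member_le_sum) (auto intro: less_imp_le)
        ultimately show ?thesis by simp
      qed
      then have "q \<in> simplex_chart j" using q True by (auto simp: simplex_chart_def space_PiM)
      moreover have "g ?p = ennreal (\<Prod>e\<in>?U. ?p e powr s e)" using True by (intro eq) auto
      moreover have "(\<Prod>e\<in>?U. gamma_kernel (\<beta> e + s e) (?p e)) = ennreal (\<Prod>e\<in>?U. ?p e powr (\<beta> e - 1) * ?p e powr s e)"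
      proof -
        have "(\<Prod>e\<in>?U. gamma_kernel (\<beta> e + s e) (?p e)) = (\<Prod>e\<in>?U. ennreal (?p e powr (\<beta> e - 1) * ?p e powr s e))"
          using True by (intro prod.cong refl) (simp add: gamma_kernel_def algebra_simps flip: powr_add)
        also have "\<dots> = ennreal (\<Prod>e\<in>?U. ?p e powr (\<beta> e - 1) * ?p e powr s e)"
          by (intro prod_ennreal) simp
        finally show ?thesis .
      qed
      moreover have "ennreal (c * A) * ennreal B = ennreal c * ennreal (A * B)" if "0 \<le> c" "0 \<le> A" "0 \<le> B" for c A B
        using that by (simp add: ennreal_mult mult_ac)
      note this[OF c0, of "\<Prod>e\<in>?U. ?p e powr (\<beta> e - 1)" "\<Prod>e\<in>?U. ?p e powr s e"]
      ultimately show ?thesis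
        unfolding rhs dirichlet_density_def by (simp add: prod.distrib prod_nonneg del: times_divide_eq_left)
    next
      case False
      then obtain e where e: "e \<in> ?U" "\<not> 0 < ?p e" by blast
      then have "q \<notin> simplex_chart j" by (auto simp: simplex_chart_def)
      moreover have "(\<Prod>e\<in>?U. gamma_kernel (\<beta> e + s e) (?p e)) = 0"
        using e by (intro prod_zero) (auto simp: gamma_kernel_def intro!: bexI[of _ e])
      ultimately show ?thesis unfolding rhs by simp
    qed
  qed
  also have "\<dots> = ennreal ?c * (\<integral>\<^sup>+q. ?D q \<partial>?L)"
  proof (intro nn_integral_cmult borel_measurable_times_ennreal borel_measurable_prod_ennreal
        measurable_compose[OF _ measurable_gamma_kernel] borel_measurable_diff borel_measurable_sum borel_measurable_const)
    show "(\<lambda>q. q e) \<in> borel_measurable ?L" if "e \<in> ?J" for e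
      using measurable_component_singleton[OF that, of "\<lambda>_. lborel :: real measure"] by simp
    then show "(\<lambda>q. q e) \<in> borel_measurable ?L" if "e \<in> ?J" for e using that by blast
  qed
  also have "(\<integral>\<^sup>+q. ?D q \<partial>?L) =
      ennreal ((\<Prod>e\<in>?J. Gamma (\<beta> e + s e)) * Gamma (\<beta> j + s j) / Gamma ((\<Sum>e\<in>?J. \<beta> e + s e) + (\<beta> j + s j))) *
      gamma_kernel ((\<Sum>e\<in>?J. \<beta> e + s e) + (\<beta> j + s j)) 1"
    using j s by (intro nn_integral_dirichlet) auto
  also have "\<dots> = ennreal ((\<Prod>e\<in>?U. Gamma (\<beta> e + s e)) / Gamma (\<Sum>e\<in>?U. \<beta> e + s e))"
    using j by (simp add: gamma_kernel_def prod.remove[of ?U j] sum.remove[of ?U j "\<lambda>e. \<beta> e + s e"] add.commute mult.commute del: sum.distrib)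
  also have "ennreal ?c * ennreal ((\<Prod>e\<in>?U. Gamma (\<beta> e + s e)) / Gamma (\<Sum>e\<in>?U. \<beta> e + s e)) =
      ennreal (?c * ((\<Prod>e\<in>?U. Gamma (\<beta> e + s e)) / Gamma (\<Sum>e\<in>?U. \<beta> e + s e)))"
    using c0 by (rule ennreal_mult'[symmetric])
  finally show ?thesis .
qed

section \<open>Moments and tails of a single coordinate\<close>

lemma sum_unit_steps_pos:
  fixes \<beta> :: "int ^ 'n::finite \<Rightarrow> real"
  assumes "\<And>e. e \<in> unit_steps \<Longrightarrow> 0 < \<beta> e"
  shows "0 < sum \<beta> unit_steps"
proof (rule sum_pos)
  show "unit_steps \<noteq> ({} :: (int ^ 'n) set)" by (metis axis_unit_steps(1) empty_iff)
qed (use assms in auto)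

lemma nn_integral_dirichlet_law_powr:
  fixes \<beta> :: "int ^ 'n::finite \<Rightarrow> real"
  assumes j: "j \<in> unit_steps" and \<beta>: "\<And>e. e \<in> unit_steps \<Longrightarrow> 0 < \<beta> e"
    and i: "i \<in> unit_steps" "0 < \<beta> i + s"
    and g: "g \<in> borel_measurable site_algebra"
    and eq: "\<And>p. (\<And>e. e \<in> unit_steps \<Longrightarrow> 0 < p e) \<Longrightarrow> g p = ennreal (p i powr s)"
  shows "(\<integral>\<^sup>+p. g p \<partial>dirichlet_law j \<beta>) =
    ennreal (Gamma (sum \<beta> unit_steps) * Gamma (\<beta> i + s) / (Gamma (\<beta> i) * Gamma (sum \<beta> unit_steps + s)))"
proof -
  let ?U = "unit_steps :: (int ^ 'n) set"
  let ?s = "\<lambda>e. if e = i then s else 0"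
  have "(\<integral>\<^sup>+p. g p \<partial>dirichlet_law j \<beta>) =
    ennreal (Gamma (\<Sum>e\<in>?U. \<beta> e) / (\<Prod>e\<in>?U. Gamma (\<beta> e)) *
      ((\<Prod>e\<in>?U. Gamma (\<beta> e + ?s e)) / Gamma (\<Sum>e\<in>?U. \<beta> e + ?s e)))"
  proof (rule nn_integral_dirichlet_law[OF j \<beta> _ g])
    show "0 < \<beta> e + ?s e" if "e \<in> ?U" for e using \<beta>[OF that] i by simp
    fix p :: "int ^ 'n \<Rightarrow> real" assume p: "\<And>e. e \<in> ?U \<Longrightarrow> 0 < p e"
    have "(\<Prod>e\<in>?U. p e powr ?s e) = p i powr s * (\<Prod>e\<in>?U - {i}. p e powr ?s e)"
      using i by (simp add: prod.remove[of ?U i])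
    also have "(\<Prod>e\<in>?U - {i}. p e powr ?s e) = 1"
      by (rule prod.neutral) (use p in \<open>auto simp: less_imp_neq[symmetric]\<close>)
    finally show "g p = ennreal (\<Prod>e\<in>?U. p e powr ?s e)" using eq[OF p] by simp
  qed
  also have "(\<Sum>e\<in>?U. \<beta> e + ?s e) = (\<Sum>e\<in>?U. \<beta> e) + s"
    using i by (simp add: sum.distrib)
  also have "(\<Prod>e\<in>?U. Gamma (\<beta> e + ?s e)) = Gamma (\<beta> i + s) * (\<Prod>e\<in>?U - {i}. Gamma (\<beta> e))"
    using i by (simp add: prod.remove[of ?U i])
  also have "(\<Prod>e\<in>?U. Gamma (\<beta> e)) = Gamma (\<beta> i) * (\<Prod>e\<in>?U - {i}. Gamma (\<beta> e))"
    using i by (simp add: prod.remove[of ?U i])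
  also have "Gamma (\<Sum>e\<in>?U. \<beta> e) / (Gamma (\<beta> i) * (\<Prod>e\<in>?U - {i}. Gamma (\<beta> e))) *
      (Gamma (\<beta> i + s) * (\<Prod>e\<in>?U - {i}. Gamma (\<beta> e)) / Gamma ((\<Sum>e\<in>?U. \<beta> e) + s)) =
      Gamma (\<Sum>e\<in>?U. \<beta> e) * Gamma (\<beta> i + s) / (Gamma (\<beta> i) * Gamma ((\<Sum>e\<in>?U. \<beta> e) + s))"
  proof -
    have "0 < (\<Prod>e\<in>?U - {i}. Gamma (\<beta> e))" using \<beta> by (intro prod_pos) (auto intro: Gamma_real_pos)
    moreover have "x / (y * P) * (z * P / w) = x * z / (y * w)" if "0 < P" for x y z w P :: real
      using that by simp
    ultimately show ?thesis by blast
  qed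
  finally show ?thesis .
qed

context
  fixes j :: "int ^ 'n::finite" and \<beta> :: "int ^ 'n \<Rightarrow> real"
  assumes j: "j \<in> unit_steps" and \<beta>: "\<And>e. e \<in> unit_steps \<Longrightarrow> 0 < \<beta> e"
begin

lemma sets_dirichlet_law: "sets (dirichlet_law j \<beta>) = sets site_algebra"
  by (simp add: dirichlet_law_def)

lemma prob_space_dirichlet_law: "prob_space (dirichlet_law j \<beta>)"
proof (rule prob_spaceI)
  have "Gamma (sum \<beta> unit_steps) \<noteq> 0" "Gamma (\<beta> j) \<noteq> 0"
    using Gamma_real_pos[OF sum_unit_steps_pos[of \<beta>, OF \<beta>]] Gamma_real_pos[OF \<beta>[OF j]] by auto
  \<comment> \<open>The total mass is the moment of exponent \<open>0\<close>.\<close>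
  moreover have "(\<integral>\<^sup>+p. 1 \<partial>dirichlet_law j \<beta>) =
    ennreal (Gamma (sum \<beta> unit_steps) * Gamma (\<beta> j + 0) / (Gamma (\<beta> j) * Gamma (sum \<beta> unit_steps + 0)))"
    by (rule nn_integral_dirichlet_law_powr[OF j \<beta> j]) (use \<beta>[OF j] j in \<open>auto simp: less_imp_neq[symmetric]\<close>)
  ultimately show "emeasure (dirichlet_law j \<beta>) (space (dirichlet_law j \<beta>)) = 1" by simp
qed

lemma dirichlet_law_mean:
  assumes i: "i \<in> unit_steps"
  shows "(\<integral>\<^sup>+p. ennreal (p i) \<partial>dirichlet_law j \<beta>) = ennreal (\<beta> i / sum \<beta> unit_steps)"
proof -
  let ?S = "sum \<beta> unit_steps"
  have S: "0 < ?S" by (rule sum_unit_steps_pos[OF \<beta>])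
  have "(\<integral>\<^sup>+p. ennreal (p i) \<partial>dirichlet_law j \<beta>) = ennreal (Gamma ?S * Gamma (\<beta> i + 1) / (Gamma (\<beta> i) * Gamma (?S + 1)))"
  proof (rule nn_integral_dirichlet_law_powr[OF j \<beta> i])
    show "0 < \<beta> i + 1" using \<beta>[OF i] by simp
    show "(\<lambda>p. ennreal (p i)) \<in> borel_measurable site_algebra"
      by (rule measurable_compose[OF measurable_site_component[OF i] measurable_ennreal])
    show "ennreal (p i) = ennreal (p i powr 1)" if "\<And>e. e \<in> unit_steps \<Longrightarrow> 0 < p e" for p
      using that[OF i] by simp
  qed
  also have "Gamma (\<beta> i + 1) = \<beta> i * Gamma (\<beta> i)" using \<beta>[OF i] by (intro Gamma_plus1) auto
  also have "Gamma (?S + 1) = ?S * Gamma ?S" using S by (intro Gamma_plus1) auto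
  also have "Gamma ?S * (\<beta> i * Gamma (\<beta> i)) / (Gamma (\<beta> i) * (?S * Gamma ?S)) = \<beta> i / ?S"
    using Gamma_real_pos[OF S] Gamma_real_pos[OF \<beta>[OF i]] by simp
  finally show ?thesis .
qed

lemma dirichlet_law_inverse_moment:
  assumes i: "i \<in> unit_steps" and \<alpha>: "\<alpha> < \<beta> i"
  shows "(\<integral>\<^sup>+p. 1 / ennreal (p i powr \<alpha>) \<partial>dirichlet_law j \<beta>) =
    ennreal (Gamma (sum \<beta> unit_steps) * Gamma (\<beta> i - \<alpha>) / (Gamma (\<beta> i) * Gamma (sum \<beta> unit_steps - \<alpha>)))"
    (is "?L = ?R")
proof -
  have "?L = ennreal (Gamma (sum \<beta> unit_steps) * Gamma (\<beta> i + (- \<alpha>)) /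
      (Gamma (\<beta> i) * Gamma (sum \<beta> unit_steps + (- \<alpha>))))"
  proof (rule nn_integral_dirichlet_law_powr[OF j \<beta> i])
    show "0 < \<beta> i + - \<alpha>" using \<alpha> by simp
    have [measurable]: "(\<lambda>p. p i) \<in> borel_measurable site_algebra" by (rule measurable_site_component[OF i])
    show "(\<lambda>p. 1 / ennreal (p i powr \<alpha>)) \<in> borel_measurable site_algebra" by measurable
    show "1 / ennreal (p i powr \<alpha>) = ennreal (p i powr - \<alpha>)" if "\<And>e. e \<in> unit_steps \<Longrightarrow> 0 < p e" for p
      using that[OF i] by (simp add: powr_minus divide_ennreal_def inverse_ennreal)
  qed
  then show ?thesis by simp
qed

text \<open>Markov's inequality for the moment of order \<open>- \<alpha>\<close>.\<close>

lemma dirichlet_law_tail: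
  assumes i: "i \<in> unit_steps" and \<alpha>: "0 < \<alpha>" "\<alpha> < \<beta> i" and t: "0 < t"
  shows "measure (dirichlet_law j \<beta>) {p \<in> space (dirichlet_law j \<beta>). p i < t} \<le>
    Gamma (sum \<beta> unit_steps) * Gamma (\<beta> i - \<alpha>) / (Gamma (\<beta> i) * Gamma (sum \<beta> unit_steps - \<alpha>)) * t powr \<alpha>"
    (is "measure ?M ?A \<le> ?K * _")
proof -
  interpret prob_space ?M by (rule prob_space_dirichlet_law)
  let ?S = "sum \<beta> unit_steps"
  have "\<beta> i \<le> ?S" using i \<beta> by (intro member_le_sum) (auto intro: less_imp_le)
  then have K: "0 \<le> ?K"
    using \<alpha> \<beta>[OF i] by (intro divide_nonneg_nonneg mult_nonneg_nonneg) (auto intro!: less_imp_le[OF Gamma_real_pos])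
  have [measurable]: "(\<lambda>p. p i) \<in> borel_measurable ?M"
    using measurable_site_component[OF i] measurable_cong_sets[OF sets_dirichlet_law refl] by blast
  have A: "?A \<in> sets ?M" by measurable
  have "emeasure ?M ?A = (\<integral>\<^sup>+p. indicator ?A p \<partial>?M)" using A by simp
  also have "\<dots> \<le> (\<integral>\<^sup>+p. ennreal (t powr \<alpha>) * (1 / ennreal (p i powr \<alpha>)) \<partial>?M)"
  proof (rule nn_integral_mono)
    fix p assume "p \<in> space ?M"
    then have "p \<in> prob_vectors"
      using sets_eq_imp_space_eq[OF sets_dirichlet_law] by (auto simp: site_algebra_def space_restrict_space)
    then have p0: "0 \<le> p i" using i by (rule prob_vectorsD(1))
    show "indicator ?A p \<le> ennreal (t powr \<alpha>) * (1 / ennreal (p i powr \<alpha>))"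
    proof (cases "p \<in> ?A")
      case True
      show ?thesis
      proof (cases "p i = 0")
        case True
        then show ?thesis using t by (simp add: divide_ennreal_def ennreal_mult_top)
      next
        case False
        then have pi: "0 < p i" using p0 by simp
        then have "1 \<le> t powr \<alpha> * (1 / p i powr \<alpha>)"
          using True \<alpha> powr_mono2[of \<alpha> "p i" t] by (simp add: le_divide_eq)
        then have "ennreal 1 \<le> ennreal (t powr \<alpha> * (1 / p i powr \<alpha>))" by (rule ennreal_leI)
        also have "\<dots> = ennreal (t powr \<alpha>) * (1 / ennreal (p i powr \<alpha>))"
          using pi by (subst ennreal_mult) (auto simp: divide_ennreal[symmetric])
        finally show ?thesis using True by simp
      qed
    qed simp
  qed
  also have "\<dots> = ennreal (t powr \<alpha>) * ennreal ?K"
    by (subst nn_integral_cmult) (auto simp: dirichlet_law_inverse_moment[OF i \<alpha>(2)])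
  also have "\<dots> = ennreal (?K * t powr \<alpha>)" 
    using ennreal_mult[OF powr_ge_zero[of t \<alpha>] K] by (simp only: mult.commute)
  finally have "ennreal (measure ?M ?A) \<le> ennreal (?K * t powr \<alpha>)" by (simp only: emeasure_eq_measure)
  moreover have "0 \<le> ?K * t powr \<alpha>" using K by (intro mult_nonneg_nonneg) simp_all
  ultimately show ?thesis by (simp only: ennreal_le_iff)
qed

end

text \<open>Supplies a tail constant uniform in the weight of the step to the left: for weights up
  to \<open>1\<close> the total parameter stays in a compact interval, on which the ratio is
  continuous.\<close>

lemma Gamma_ratio_bounded:
  assumes "0 < \<alpha>" "\<alpha> < (S :: real)"
  obtains B where "0 < B" and "\<And>x. S \<le> x \<Longrightarrow> x \<le> S + 1 \<Longrightarrow> Gamma x / Gamma (x - \<alpha>) \<le> B"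
proof -
  have "continuous_on {S..S + 1} (\<lambda>x. Gamma x * rGamma (x - \<alpha>))"
  proof (rule continuous_on_mult)
    show "continuous_on {S..S + 1} (\<lambda>x. Gamma x)"
      using assms by (intro continuous_on_Gamma continuous_on_id) (auto elim!: nonpos_Ints_cases)
    show "continuous_on {S..S + 1} (\<lambda>x. rGamma (x - \<alpha>))"
      by (rule continuous_on_compose2[OF continuous_on_rGamma[of UNIV]]) (auto intro!: continuous_intros)
  qed
  then have "compact ((\<lambda>x. Gamma x * rGamma (x - \<alpha>)) ` {S..S + 1})" by (intro compact_continuous_image) auto
  then obtain B where B: "0 < B" "\<forall>y\<in>(\<lambda>x. Gamma x * rGamma (x - \<alpha>)) ` {S..S + 1}. norm y \<le> B"
    using compact_imp_bounded bounded_pos by blast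
  show thesis
  proof (rule that[OF B(1)])
    fix x assume x: "S \<le> x" "x \<le> S + 1"
    then have "norm (Gamma x * rGamma (x - \<alpha>)) \<le> B" using B(2) by auto
    then have "Gamma x * rGamma (x - \<alpha>) \<le> B" unfolding real_norm_def by linarith
    then show "Gamma x / Gamma (x - \<alpha>) \<le> B" by (simp add: rGamma_inverse_Gamma divide_inverse)
  qed
qed

text \<open>Among the unit steps only \<open>- axis k 1\<close> points backwards, so the maximum
  involves only directions whose weight exceeds \<open>\<alpha>\<close>.\<close>

lemma eta_dirichlet_env_finite:
  fixes k :: "'n::finite" and \<beta> :: "int ^ 'n \<Rightarrow> real"
  assumes \<beta>: "\<And>e. e \<in> unit_steps \<Longrightarrow> 0 < \<beta> e" and \<alpha>: "\<And>e. e \<in> unit_steps \<Longrightarrow> e \<noteq> - axis k 1 \<Longrightarrow> \<alpha> < \<beta> e"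
  shows "eta (dirichlet_env (- axis k 1) \<beta>) (axis k 1) \<alpha> < \<infinity>"
proof -
  let ?j = "- axis k 1 :: int ^ 'n"
  let ?V = "{e \<in> unit_steps. real_vec e \<bullet> (axis k 1 :: real ^ 'n) \<ge> 0}"
  interpret iid_environment "dirichlet_law ?j \<beta>"
    by (rule iid_environment.intro) (simp_all add: prob_space_dirichlet_law \<beta> sets_dirichlet_law)
  have fin: "(\<integral>\<^sup>+\<omega>. 1 / ennreal (\<omega> 0 e powr \<alpha>) \<partial>dirichlet_env ?j \<beta>) < \<infinity>" if "e \<in> ?V" for e
  proof -
    have e: "e \<in> unit_steps" "e \<noteq> ?j"
    proof -
      have "real_vec ?j \<bullet> (axis k 1 :: real ^ 'n) = - 1" by (simp add: inner_axis real_vec_def)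
      then show "e \<in> unit_steps" "e \<noteq> ?j" using that by auto
    qed
    have [measurable]: "(\<lambda>p. p e) \<in> borel_measurable (dirichlet_law ?j \<beta>)"
      using measurable_site_component[OF e(1)] measurable_cong_sets[OF sets_site refl] by blast
    have "(\<integral>\<^sup>+\<omega>. 1 / ennreal (\<omega> 0 e powr \<alpha>) \<partial>env_law) = (\<integral>\<^sup>+p. 1 / ennreal (p e powr \<alpha>) \<partial>dirichlet_law ?j \<beta>)"
      using nn_integral_distr[OF measurable_component_site, of "\<lambda>p. 1 / ennreal (p e powr \<alpha>)" 0]
      by (simp add: distr_env_law_component)
    also have "\<dots> < \<infinity>"
      by (subst dirichlet_law_inverse_moment) (use \<beta> \<alpha> e in auto)
    finally show ?thesis by (simp only: env_law_def dirichlet_env_def)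
  qed
  have "axis k 1 \<in> ?V" by (simp add: inner_axis real_vec_def)
  then have "?V \<noteq> {}" by blast
  then show ?thesis
    unfolding eta_def using fin by (subst Max_less_iff) auto
qed

theorem theorem5:
  fixes k :: "'n::finite" and \<beta> :: "int ^ 'n \<Rightarrow> real"
  assumes "\<And>e. e \<in> unit_steps \<Longrightarrow> e \<noteq> - axis k 1 \<Longrightarrow> \<beta> e > 0"
  shows "\<exists>\<epsilon>. 0 < \<epsilon> \<and> \<epsilon> < 1 \<and>
    (\<forall>b. 0 < b \<longrightarrow> b \<le> \<epsilon> \<longrightarrow>
      (let \<PP> = dirichlet_env (- axis k 1) (\<beta>(- axis k 1 := b)); l = axis k (1::real) in
        (\<exists>\<alpha>>0. eta \<PP> l \<alpha> < \<infinity>) \<and>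
        (\<forall>\<alpha> R M. 0 < \<alpha> \<longrightarrow> eta \<PP> l \<alpha> < \<infinity> \<longrightarrow>
           rotation_matrix R \<longrightarrow> R *v axis k 1 = l \<longrightarrow>
           M \<ge> 15 * real CARD('n) + 5 \<longrightarrow>
           polynomial_condition k R \<alpha> \<PP> M l)))"
proof -
  define j where "j = - axis k (1::int)"
  have j: "j \<in> unit_steps" by (simp add: j_def)
  let ?U = "unit_steps - {j}"
  have kU: "axis k 1 \<in> ?U" using axis_neq_uminus[of k] by (simp add: j_def)
  \<comment> \<open>Built from the fixed weights alone, hence independent of \<open>b\<close>; the
    factor \<open>1/2\<close> keeps it strictly below each of them.\<close>
  define \<alpha> where "\<alpha> = Min (\<beta> ` ?U) / 2"
  have Min: "0 < Min (\<beta> ` ?U)"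
  proof -
    have "Min (\<beta> ` ?U) \<in> \<beta> ` ?U" by (rule Min_in) (simp, use kU in blast)
    then obtain e where "e \<in> ?U" "Min (\<beta> ` ?U) = \<beta> e" by auto
    then show ?thesis using assms[of e] by (simp add: j_def)
  qed
  then have \<alpha>: "0 < \<alpha>" by (simp add: \<alpha>_def)
  have \<alpha>_less: "\<alpha> < \<beta> e" if "e \<in> ?U" for e
  proof -
    have "Min (\<beta> ` ?U) \<le> \<beta> e" using that by (intro Min_le) auto
    then show ?thesis using Min unfolding \<alpha>_def by linarith
  qed
  define S where "S = (\<Sum>e\<in>?U. \<beta> e)"
  have "\<beta> (axis k 1) \<le> S"
    unfolding S_def using kU assms by (intro member_le_sum) (auto simp: j_def intro: less_imp_le)
  then have S: "\<alpha> < S" using \<alpha>_less[OF kU] by linarith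
  obtain B where B: "0 < B" "\<And>x. S \<le> x \<Longrightarrow> x \<le> S + 1 \<Longrightarrow> Gamma x / Gamma (x - \<alpha>) \<le> B"
    using Gamma_ratio_bounded[OF \<alpha> S] by blast
  \<comment> \<open>The constant in \<open>dirichlet_law_tail\<close> is the product of this
    quotient, which does not involve \<open>b\<close>, and of a ratio bounded by
    \<open>B\<close>.\<close>
  define G where "G = Gamma (\<beta> (axis k 1) - \<alpha>) / Gamma (\<beta> (axis k 1))"
  have G: "0 < G"
    unfolding G_def using \<alpha>_less[OF kU] \<alpha> by (intro divide_pos_pos Gamma_real_pos) auto
  define C where "C = B * G"
  have C: "0 \<le> C" using B G by (simp add: C_def)
  obtain l0 \<epsilon>0 where \<epsilon>0: "0 < \<epsilon>0" and l0: "\<And>l. l0 \<le> l \<Longrightarrow> large_scale CARD('n) C \<alpha> (22 * real CARD('n)) l"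
    and base: "\<And>\<mu>. tail_environment \<mu> k C \<alpha> \<Longrightarrow> (\<integral>\<^sup>+p. ennreal (p (- axis k 1)) \<partial>\<mu>) \<le> ennreal \<epsilon>0 \<Longrightarrow>
      tail_environment.prob_bad \<mu> k l0 \<le> real l0 powr (- (22 * real CARD('n)))"
    using exists_base_scale[OF \<alpha> C, of k] by metis
  \<comment> \<open>The mean weight of a step to the left is \<open>b / (S + b)\<close>, at most
    \<open>\<epsilon>0\<close> once \<open>b \<le> \<epsilon>0 * S\<close>; the bound
    \<open>1 / 2\<close> also keeps \<open>S + b\<close> in the range of \<open>B\<close>.\<close>
  define \<epsilon> where "\<epsilon> = min (1 / 2) (\<epsilon>0 * S)"
  have \<epsilon>: "0 < \<epsilon>" "\<epsilon> < 1" using \<epsilon>0 S \<alpha> by (auto simp: \<epsilon>_def)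
  have main: "(\<exists>\<alpha>>0. eta (dirichlet_env j (\<beta>(j := b))) (axis k 1) \<alpha> < \<infinity>) \<and>
      (\<forall>\<alpha> R M. rotation_matrix R \<longrightarrow> R *v axis k 1 = axis k 1 \<longrightarrow>
        polynomial_condition k R \<alpha> (dirichlet_env j (\<beta>(j := b))) M (axis k 1))"
    if b: "0 < b" "b \<le> \<epsilon>" for b
  proof -
    let ?\<beta> = "\<beta>(j := b)"
    let ?\<mu> = "dirichlet_law j ?\<beta>"
    have \<beta>: "0 < ?\<beta> e" if "e \<in> unit_steps" for e using assms[OF that] b by (auto simp: j_def)
    have sum: "(\<Sum>e\<in>unit_steps. ?\<beta> e) = S + b"
    proof -
      have "(\<Sum>e\<in>unit_steps. ?\<beta> e) = b + (\<Sum>e\<in>?U. ?\<beta> e)" using j by (simp add: sum.remove[of _ j])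
      also have "(\<Sum>e\<in>?U. ?\<beta> e) = S" unfolding S_def by (rule sum.cong) auto
      finally show ?thesis by simp
    qed
    have k\<beta>: "?\<beta> (axis k 1) = \<beta> (axis k 1)" using kU by auto
    have te: "tail_environment ?\<mu> k C \<alpha>"
    proof (rule tail_environment.intro)
      show "iid_environment ?\<mu>"
        by (rule iid_environment.intro[OF prob_space_dirichlet_law[where \<beta> = ?\<beta>, OF j \<beta>] sets_dirichlet_law[where \<beta> = ?\<beta>, OF j \<beta>]])
      show "tail_environment_axioms ?\<mu> k C \<alpha>"
      proof (rule tail_environment_axioms.intro[OF \<alpha>])
        fix t :: real assume t: "0 < t"
        have "Gamma (S + b) * Gamma (\<beta> (axis k 1) - \<alpha>) / (Gamma (\<beta> (axis k 1)) * Gamma (S + b - \<alpha>)) =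
            Gamma (S + b) / Gamma (S + b - \<alpha>) * G"
          by (simp add: G_def)
        also have "\<dots> \<le> C"
          unfolding C_def using B(2)[of "S + b"] b \<epsilon> G by (intro mult_right_mono) auto
        finally have "Gamma (S + b) * Gamma (\<beta> (axis k 1) - \<alpha>) / (Gamma (\<beta> (axis k 1)) * Gamma (S + b - \<alpha>)) *
            t powr \<alpha> \<le> C * t powr \<alpha>"
          by (rule mult_right_mono) simp
        moreover have "measure ?\<mu> {p \<in> space ?\<mu>. p (axis k 1) < t} \<le> Gamma (S + b) * Gamma (\<beta> (axis k 1) - \<alpha>) /
            (Gamma (\<beta> (axis k 1)) * Gamma (S + b - \<alpha>)) * t powr \<alpha>"
          using dirichlet_law_tail[where \<beta> = ?\<beta> and i = "axis k 1" and \<alpha> = \<alpha> and t = t, OF j \<beta>]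
            \<alpha> \<alpha>_less[OF kU] t
          unfolding sum k\<beta> by simp
        ultimately show "measure ?\<mu> {p \<in> space ?\<mu>. p (axis k 1) < t} \<le> C * t powr \<alpha>"
          by (rule order_trans[rotated])
      qed
    qed
    interpret tail_environment ?\<mu> k C \<alpha> by (rule te)
    have law: "dirichlet_env j ?\<beta> = env_law" by (simp add: dirichlet_env_def env_law_def)
    have "(\<integral>\<^sup>+p. ennreal (p (- axis k 1)) \<partial>?\<mu>) \<le> ennreal \<epsilon>0"
    proof -
      have "(\<integral>\<^sup>+p. ennreal (p j) \<partial>?\<mu>) = ennreal (b / (S + b))"
        using dirichlet_law_mean[where \<beta> = ?\<beta>, OF j \<beta> j] unfolding sum by simp
      also have "\<dots> \<le> ennreal \<epsilon>0"
      proof (rule ennreal_leI)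
        have "b \<le> \<epsilon>0 * S" using b(2) by (simp add: \<epsilon>_def)
        also have "\<dots> \<le> \<epsilon>0 * (S + b)" using \<epsilon>0 b by (intro mult_left_mono) auto
        finally show "b / (S + b) \<le> \<epsilon>0" using S \<alpha> b by (simp add: divide_le_eq)
      qed
      finally show ?thesis by (simp add: j_def)
    qed
    note base' = base[OF te this]
    have "polynomial_condition k R \<alpha>' (dirichlet_env j ?\<beta>) M (axis k 1)"
      if R: "rotation_matrix R" "R *v axis k 1 = axis k 1" for \<alpha>' R M
    proof -
      \<comment> \<open>\<open>L\<close> has to exceed \<open>c0\<close>, and
        \<open>CARD('n) \<le> L\<close> brings the half-width \<open>CARD('n) * L^2\<close> below
        \<open>70 * L^3\<close>.\<close>
      define m where "m = nat \<lceil>c0 (dirichlet_env j ?\<beta>) (axis k 1) \<alpha>'\<rceil> + CARD('n)"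
      obtain L :: nat and E \<delta> where L: "m \<le> L" and E: "E \<in> sets env_law" and \<delta>: "0 \<le> \<delta>"
        and le: "env.prob E + \<delta> \<le> real L powr (- M)"
        and fail: "\<And>\<omega>. \<omega> \<in> space env_law - E \<Longrightarrow> fail_inf k \<omega> (int L) (int L ^ 2) 0 \<le> \<delta>"
        using superpolynomial_decay[OF l0 base', of m M] by blast
      have dL: "real CARD('n) \<le> real L" using L unfolding m_def by linarith
      have L0: "0 < L" using L zero_less_card_finite[where 'a='n] unfolding m_def by linarith
      let ?L' = "real CARD('n) * real L ^ 2"
      have "c0 (dirichlet_env j ?\<beta>) (axis k 1) \<alpha>' \<le> real L" using L unfolding m_def by linarith
      moreover have "0 < ?L'" using L0 by simp
      moreover have "?L' \<le> 70 * real L ^ 3"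
      proof -
        have "?L' \<le> real L * real L ^ 2" using dL by (intro mult_right_mono) auto
        also have "\<dots> = real L ^ 3" by (simp add: power3_eq_cube power2_eq_square)
        also have "\<dots> \<le> 70 * real L ^ 3" by simp
        finally show ?thesis .
      qed
      moreover have "measure (annealed_law (dirichlet_env j ?\<beta>) 0)
          {X. exit_time (tilted_box k R (real L) ?L') X < \<infinity> \<and>
            real_vec (X (the_enat (exit_time (tilted_box k R (real L) ?L') X))) \<bullet> axis k 1 < real L} \<le> real L powr (- M)"
        using annealed_law_bad_exit_le[OF R L0 E \<delta> fail] le unfolding law of_int_of_nat_eq by linarith
      ultimately show ?thesis unfolding polynomial_condition_def by blast
    qed
    moreover have "eta (dirichlet_env j ?\<beta>) (axis k 1) \<alpha> < \<infinity>"
      unfolding j_def using \<beta> \<alpha>_less by (intro eta_dirichlet_env_finite) (auto simp: j_def)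
    ultimately show ?thesis using \<alpha> by blast
  qed
  show ?thesis
    using \<epsilon> main unfolding j_def Let_def by (intro exI[of _ \<epsilon>]) blast
qed

end
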